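(* Let $n\geq 1$ and $r\leq n$, and let $X_1,\dots,X_r$ be the vector fields on $\mathbb{R}^{2n}$ described in the context (the Hamiltonian vector fields of a Williamson basis $q_1,\dots,q_r$ of a Cartan subalgebra of $\mathfrak{sp}(2r,\mathbb{R})\subset\mathfrak{sp}(2n,\mathbb{R})$). Let $g_1,\dots,g_r$ be germs at $0$ of smooth real functions on $\mathbb{R}^{2n}$ such that $$X_i(g_j)=X_j(g_i)\qquad\text{for all } i,j\in\{1,\dots,r\}.$$ Then there exist a germ of smooth function $G$ and $r$ germs of smooth functions $f_1,\dots,f_r$ at $0$ such that (1) $X_j(f_i)=0$ for all $i,j\in\{1,\dots,r\}$, and (2) $g_i=f_i+X_i(G)$ for all $i\in\{1,\dots,r\}$.
   Context: Coordinates on $\mathbb{R}^{2n}$ are $(x_1,y_1,\dots,x_n,y_n)$ with symplectic form $\omega=\sum_{i=1}^n dx_i\wedge dy_i$. Fix integers $k_e,k_h,k_f\geq 0$ with $r=k_e+k_h+2k_f\leq n$. The quadratic functions $q_1,\dots,q_r$ are: $q_i=x_i^2+y_i^2$ for $1\le i\le k_e$ (elliptic); $q_i=x_iy_i$ for $k_e+1\le i\le k_e+k_h$ (hyperbolic); and for $i=k_e+k_h+2j-1$, $1\le j\le k_f$, the focus-focus pair $q_i=x_iy_i+x_{i+1}y_{i+1}$, $q_{i+1}=x_iy_{i+1}-x_{i+1}y_i$. $X_i$ denotes the Hamiltonian vector field of $q_i$; explicitly: for elliptic $i$, $X_i=2(-y_i\partial_{x_i}+x_i\partial_{y_i})$;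 for hyperbolic $i$, $X_i=-x_i\partial_{x_i}+y_i\partial_{y_i}$; for a focus-focus pair $(i,i+1)$, $X_i=-x_i\partial_{x_i}+y_i\partial_{y_i}-x_{i+1}\partial_{x_{i+1}}+y_{i+1}\partial_{y_{i+1}}$ and $X_{i+1}=-x_i\partial_{x_{i+1}}+y_{i+1}\partial_{y_i}+x_{i+1}\partial_{x_i}-y_i\partial_{y_{i+1}}$. (By Williamson's theorem, every Cartan subalgebra of the algebra of quadratic forms on $\mathbb{R}^{2r}$ has such a basis in suitable symplectic coordinates.) All objects are $C^\infty$. *)

theory Defs
  imports "HOL-Analysis.Analysis"
begin

text \<open>Points of R^(2n) are pairs (x, y) with x, y :: real^'n; the coordinate
  pair (x_j, y_j), j = 1..n, is (fst p $ e j, snd p $ e j) for a fixed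
  enumeration e of the index type by {1..n}.  The symplectic form is
  sum_j dx_j wedge dy_j.\<close>

type_synonym ('n) pt = "(real^'n) \<times> (real^'n)"

definition dpartial :: "'a::euclidean_space \<Rightarrow> ('a \<Rightarrow> real) \<Rightarrow> ('a \<Rightarrow> real)" where
  "dpartial b f = (\<lambda>x. frechet_derivative f (at x) b)"

definition smooth_on :: "'a::euclidean_space set \<Rightarrow> ('a \<Rightarrow> real) \<Rightarrow> bool" where
  "smooth_on U f \<longleftrightarrow> (\<forall>bs. set bs \<subseteq> Basis \<longrightarrow> foldr dpartial bs f differentiable_on U)"

definition vf_apply :: "('a::real_normed_vector \<Rightarrow> 'a) \<Rightarrow> ('a \<Rightarrow> real) \<Rightarrow> 'a \<Rightarrow> real" where
  "vf_apply X f p = frechet_derivative f (at p) (X p)"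

definition xc :: "(nat \<Rightarrow> 'n::finite) \<Rightarrow> nat \<Rightarrow> 'n pt \<Rightarrow> real" where
  "xc e j p = fst p $ e j"
definition yc :: "(nat \<Rightarrow> 'n::finite) \<Rightarrow> nat \<Rightarrow> 'n pt \<Rightarrow> real" where
  "yc e j p = snd p $ e j"

definition ex :: "(nat \<Rightarrow> 'n::finite) \<Rightarrow> nat \<Rightarrow> 'n pt" where
  "ex e j = (axis (e j) 1, 0)"
definition ey :: "(nat \<Rightarrow> 'n::finite) \<Rightarrow> nat \<Rightarrow> 'n pt" where
  "ey e j = (0, axis (e j) 1)"

text \<open>The Hamiltonian vector fields X_i (1-based index i) of the Williamson basis
  q_1..q_r with ke elliptic, kh hyperbolic and kf focus-focus blocks.\<close>
definition hamVF :: "(nat \<Rightarrow> 'n::finite) \<Rightarrow> nat \<Rightarrow> nat \<Rightarrow> nat \<Rightarrow> nat \<Rightarrow> 'n pt \<Rightarrow> 'n pt" where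
  "hamVF e ke kh kf i p =
    (let x = (\<lambda>j. xc e j p); y = (\<lambda>j. yc e j p) in
     if 1 \<le> i \<and> i \<le> ke then
       2 *\<^sub>R ((- y i) *\<^sub>R ex e i + x i *\<^sub>R ey e i)
     else if ke < i \<and> i \<le> ke + kh then
       (- x i) *\<^sub>R ex e i + y i *\<^sub>R ey e i
     else if ke + kh < i \<and> i \<le> ke + kh + 2 * kf then
       (if odd (i - (ke + kh)) then
          (let a = i; b = i + 1 in
            (- x a) *\<^sub>R ex e a + y a *\<^sub>R ey e a + (- x b) *\<^sub>R ex e b + y b *\<^sub>R ey e b)
        else
          (let a = i - 1; b = i in
            (- x a) *\<^sub>R ex e b + y b *\<^sub>R ey e a + x b *\<^sub>R ex e a + (- y a) *\<^sub>R ey e b))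
     else 0)"

end

theory Submission
  imports Defs
begin

text \<open>After a cutoff all functions are global, and the \<open>X i\<close> are commuting linear vector fields.
  The \<open>X i\<close> are treated one at a time: if a single smooth \<open>h\<close> can be written near \<open>0\<close> as
  \<open>h = f + X i (G)\<close> with \<open>X i (f) = 0\<close>, in such a way that \<open>L(h) = X i (k)\<close> implies \<open>L(f) = 0\<close>
  and \<open>L(h) = 0\<close> implies \<open>L(G) = 0\<close> for all the other fields \<open>L\<close>, then subtracting
  \<open>X j (G)\<close> from every \<open>g j\<close> makes \<open>g i\<close> invariant under all fields and does not
  disturb the \<open>g j\<close> that already are.

  For a field generating a circle action, \<open>f\<close> is the average of \<open>h\<close> and \<open>G\<close> is a weighted average.

  For \<open>X = - x \<partial>x + y \<partial>y\<close> (with \<open>x\<close>, \<open>y\<close> in \<open>\<real>\<close> or \<open>\<real>\<^sup>2\<close>) let \<open>b l\<close> be the part of \<open>h\<close>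
  of degree \<open>l\<close> in \<open>y\<close> and \<open>a l\<close> the part of \<open>b l\<close> of degree \<open>l\<close> in \<open>x\<close>. Then \<open>X(a l) = 0\<close>, and
  \<open>X(B l) = b l - a l\<close> has an explicit smooth solution. Borel summation in \<open>y\<close> turns the \<open>a l\<close>, \<open>B l\<close>
  into smooth functions \<open>f0\<close>, \<open>G0\<close> for which \<open>X(f0)\<close> and \<open>h - f0 - X(G0)\<close> are flat along \<open>y = 0\<close>.
  A function flat along \<open>y = 0\<close> and cut off in \<open>x\<close> is \<open>X\<close> of its integral along the backward flow,
  which corrects both defects.\<close>

section \<open>Smooth functions\<close>

text \<open>The obstacle is non-uniqueness. \<open>G\<close> is fixed only up to functions killed by
  \<open>X\<close>, and for hyperbolic \<open>X\<close> even \<open>f\<close> is not determined: if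
  \<open>\<phi>\<close> is flat at 0, then \<open>\<phi> (x y)\<close> is invariant and yet equals
  \<open>X\<close> of the smooth function \<open>\<phi> (x y) * ln \<bar>y\<bar>\<close>. A solution
  chosen for one field may thus spoil what was achieved for the others, so both implications have to
  be built into the construction. They survive because Taylor coefficients, remainders, series and
  flow integrals are all natural under linear fields commuting with the dilations in
  \<open>x\<close> and in \<open>y\<close>, and because the cutoffs depend only on norms which those
  fields preserve. For the hyperbolic model a monomial of degree \<open>i\<close> in
  \<open>x\<close> and \<open>j\<close> in \<open>y\<close> is an eigenfunction with eigenvalue
  \<open>j - i\<close>; the resonances \<open>i = j\<close> are exactly the \<open>a l\<close>,
  which is why they go into \<open>f\<close>. The Borel cutoffs are not \<open>X\<close>-invariant,
  which is where the flat errors come from. A formal solution along \<open>y = 0\<close> alone is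
  enough: the flow used for the correction contracts \<open>y\<close>, where flatness gives
  convergence, and expands \<open>x\<close>, where the cutoff gives control.\<close>

abbreviation smooth :: "('a::euclidean_space \<Rightarrow> real) \<Rightarrow> bool" where
  "smooth \<equiv> smooth_on UNIV"

abbreviation iter_dpartial :: "'a::euclidean_space list \<Rightarrow> ('a \<Rightarrow> real) \<Rightarrow> 'a \<Rightarrow> real" where
  "iter_dpartial \<equiv> foldr dpartial"

lemma dpartial_eqI: "(f has_derivative f') (at x) \<Longrightarrow> dpartial b f x = f' b"
  unfolding dpartial_def using frechet_derivative_at by metis

lemma vf_apply_eqI: "(f has_derivative f') (at x) \<Longrightarrow> vf_apply X f x = f' (X x)"
  unfolding vf_apply_def using frechet_derivative_at by metis

text \<open>An order-by-order form of \<open>smooth_on\<close>. The recursion strips the derivative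
  that is applied first, so closure properties follow by induction on \<open>k\<close> with the
  function generalised.\<close>

fun Dk :: "nat \<Rightarrow> 'a::euclidean_space set \<Rightarrow> ('a \<Rightarrow> real) \<Rightarrow> bool" where
  "Dk 0 S f \<longleftrightarrow> True"
| "Dk (Suc k) S f \<longleftrightarrow> (\<forall>x\<in>S. f differentiable (at x)) \<and> (\<forall>b\<in>Basis. Dk k S (dpartial b f))"

lemma Dk_pred: "Dk (Suc k) S f \<Longrightarrow> Dk k S f"
  by (induction k arbitrary: f) auto

lemma Dk_mono: "Dk k S f \<Longrightarrow> T \<subseteq> S \<Longrightarrow> Dk k T f"
  by (induction k arbitrary: f) auto

lemma Dk_Un: "Dk k S f \<Longrightarrow> Dk k T f \<Longrightarrow> Dk k (S \<union> T) f"
  by (induction k arbitrary: f) auto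

lemma dpartial_cong:
  assumes "open S" "x \<in> S" "\<And>y. y \<in> S \<Longrightarrow> f y = g y"
  shows "dpartial b f x = dpartial b g x"
proof -
  have "(f has_derivative D) (at x) \<longleftrightarrow> (g has_derivative D) (at x)" for D
    using has_derivative_transform_within_open[of f D x UNIV S g]
      has_derivative_transform_within_open[of g D x UNIV S f] assms by auto
  then show ?thesis unfolding dpartial_def frechet_derivative_def by simp
qed

lemma vf_apply_cong:
  fixes f g :: "'a::euclidean_space \<Rightarrow> real"
  assumes "open S" "x \<in> S" "\<And>y. y \<in> S \<Longrightarrow> f y = g y"
  shows "vf_apply X f x = vf_apply X g x"
  using dpartial_cong[OF assms] by (simp add: dpartial_def vf_apply_def)

lemma differentiable_cong:
  assumes "open S" "x \<in> S" "\<And>y. y \<in> S \<Longrightarrow> f y = g y" "f differentiable at x"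
  shows "g differentiable at x"
  using assms has_derivative_transform_within_open[of f _ x UNIV S g] unfolding differentiable_def by blast

lemma Dk_cong:
  assumes "open S" "\<And>y. y \<in> S \<Longrightarrow> f y = g y"
  shows "Dk k S f \<Longrightarrow> Dk k S g"
  using assms
proof (induction k arbitrary: f g)
  case (Suc k)
  have "g differentiable at x" if "x \<in> S" for x
    using differentiable_cong[of S x f g] Suc.prems that by auto
  moreover have "Dk k S (dpartial b g)" if "b \<in> Basis" for b
    using Suc.IH[of "dpartial b f" "dpartial b g"] Suc.prems dpartial_cong[of S _ f g b] that by auto
  ultimately show ?case by auto
qed auto

lemma smooth_on_Cons:
  assumes "open S"
  shows "smooth_on S f \<longleftrightarrow> (\<forall>x\<in>S. f differentiable at x) \<and> (\<forall>b\<in>Basis. smooth_on S (dpartial b f))"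
proof
  assume s: "smooth_on S f"
  have "f differentiable_on S" using s[unfolded smooth_on_def, rule_format, of "[]"] by simp
  moreover have "smooth_on S (dpartial b f)" if "b \<in> Basis" for b
    unfolding smooth_on_def
  proof (intro allI impI)
    fix bs :: "'a list" assume "set bs \<subseteq> Basis"
    then show "iter_dpartial bs (dpartial b f) differentiable_on S"
      using s[unfolded smooth_on_def, rule_format, of "bs @ [b]"] that by simp
  qed
  ultimately show "(\<forall>x\<in>S. f differentiable at x) \<and> (\<forall>b\<in>Basis. smooth_on S (dpartial b f))"
    using differentiable_on_eq_differentiable_at[OF assms] by blast
next
  assume r: "(\<forall>x\<in>S. f differentiable at x) \<and> (\<forall>b\<in>Basis. smooth_on S (dpartial b f))"
  show "smooth_on S f" unfolding smooth_on_def
  proof (intro allI impI)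
    fix bs :: "'a list" assume bs: "set bs \<subseteq> Basis"
    show "iter_dpartial bs f differentiable_on S"
    proof (cases bs rule: rev_cases)
      case Nil
      then show ?thesis using r assms by (simp add: differentiable_on_eq_differentiable_at)
    next
      case (snoc cs b)
      then have "smooth_on S (dpartial b f)" "set cs \<subseteq> Basis" using r bs by auto
      then have "iter_dpartial cs (dpartial b f) differentiable_on S" unfolding smooth_on_def by blast
      then show ?thesis using snoc by simp
    qed
  qed
qed

lemma Dk_foldr: "(\<forall>k. Dk k S f) \<Longrightarrow> set bs \<subseteq> Basis \<Longrightarrow> (\<forall>k. Dk k S (iter_dpartial bs f))"
  by (induction bs) (simp_all, metis Dk.simps(2))

lemma smooth_on_Dk:
  assumes "open S" shows "smooth_on S f \<longleftrightarrow> (\<forall>k. Dk k S f)"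
proof
  assume "smooth_on S f"
  then have "Dk k S f" for k
  proof (induction k arbitrary: f)
    case (Suc k) then show ?case using smooth_on_Cons[OF assms, of f] by simp
  qed simp
  then show "\<forall>k. Dk k S f" ..
next
  assume D: "\<forall>k. Dk k S f"
  show "smooth_on S f" unfolding smooth_on_def
  proof (intro allI impI)
    fix bs :: "'a list" assume "set bs \<subseteq> Basis"
    then have "Dk (Suc 0) S (iter_dpartial bs f)" using Dk_foldr[OF D] by blast
    then show "iter_dpartial bs f differentiable_on S"
      using assms by (auto simp: differentiable_on_eq_differentiable_at)
  qed
qed

lemma smooth_on_mono: "smooth_on S f \<Longrightarrow> open S \<Longrightarrow> open T \<Longrightarrow> T \<subseteq> S \<Longrightarrow> smooth_on T f"
  using smooth_on_Dk Dk_mono by metis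

lemma smooth_on_Un: "smooth_on S f \<Longrightarrow> smooth_on T f \<Longrightarrow> open S \<Longrightarrow> open T \<Longrightarrow> smooth_on (S \<union> T) f"
  using smooth_on_Dk[of S f] smooth_on_Dk[of T f] smooth_on_Dk[of "S \<union> T" f] Dk_Un by blast

lemma smooth_on_cong: "smooth_on S f \<Longrightarrow> open S \<Longrightarrow> (\<And>y. y \<in> S \<Longrightarrow> f y = g y) \<Longrightarrow> smooth_on S g"
  using smooth_on_Dk Dk_cong by metis

lemma smooth_on_differentiable: "smooth_on S f \<Longrightarrow> open S \<Longrightarrow> x \<in> S \<Longrightarrow> f differentiable at x"
  using smooth_on_Cons by blast

lemma smooth_differentiable: "smooth f \<Longrightarrow> f differentiable at x"
  using smooth_on_differentiable[of UNIV f x] by simp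

lemma smooth_has_derivative: "smooth f \<Longrightarrow> (f has_derivative frechet_derivative f (at x)) (at x)"
  using smooth_differentiable frechet_derivative_works by blast

lemma smooth_continuous_on: "smooth f \<Longrightarrow> continuous_on S f"
  by (meson continuous_at_imp_continuous_on differentiable_imp_continuous_within smooth_differentiable)

lemma smooth_dpartial: "smooth f \<Longrightarrow> b \<in> Basis \<Longrightarrow> smooth (dpartial b f)"
  using smooth_on_Cons[of UNIV f] by simp

lemma frechet_derivative_expand:
  fixes f :: "'a::euclidean_space \<Rightarrow> real"
  assumes "f differentiable at x"
  shows "frechet_derivative f (at x) v = (\<Sum>b\<in>Basis. (v \<bullet> b) * dpartial b f x)"
proof -
  have l: "linear (frechet_derivative f (at x))" using assms by (rule linear_frechet_derivative)
  have "frechet_derivative f (at x) v = frechet_derivative f (at x) (\<Sum>b\<in>Basis. (v \<bullet> b) *\<^sub>R b)"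
    by (simp add: euclidean_representation)
  also have "\<dots> = (\<Sum>b\<in>Basis. (v \<bullet> b) * dpartial b f x)"
    by (simp add: linear_sum[OF l] linear_scale[OF l] dpartial_def)
  finally show ?thesis .
qed

lemma Dk_const: "Dk k S (\<lambda>_. c)"
proof -
  have d: "dpartial b (\<lambda>_::'a. c) = (\<lambda>_. 0)" for b c by (auto simp: dpartial_def)
  show ?thesis by (induction k arbitrary: c) (auto simp: d)
qed

lemma frechet_derivative_add:
  assumes "f differentiable at x" "g differentiable at x"
  shows "frechet_derivative (\<lambda>x. f x + g x) (at x) v = frechet_derivative f (at x) v + frechet_derivative g (at x) v"
proof -
  have "((\<lambda>x. f x + g x) has_derivative (\<lambda>v. frechet_derivative f (at x) v + frechet_derivative g (at x) v)) (at x)"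
    using assms by (intro has_derivative_add) (auto simp: frechet_derivative_works[symmetric])
  from frechet_derivative_at[OF this] show ?thesis by (metis (no_types))
qed

lemma dpartial_add:
  assumes "f differentiable at x" "g differentiable at x"
  shows "dpartial b (\<lambda>x. f x + g x) x = dpartial b f x + dpartial b g x"
  unfolding dpartial_def using frechet_derivative_add[OF assms] .

lemma Dk_add:
  assumes "open S"
  shows "Dk k S f \<Longrightarrow> Dk k S g \<Longrightarrow> Dk k S (\<lambda>x. f x + g x)"
proof (induction k arbitrary: f g)
  case (Suc k)
  have e: "dpartial b (\<lambda>x. f x + g x) x = dpartial b f x + dpartial b g x" if "x \<in> S" for b x
    using Suc.prems that by (simp add: dpartial_add)
  have "Dk k S (dpartial b (\<lambda>x. f x + g x))" if "b \<in> Basis" for b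
    by (rule Dk_cong[where f="\<lambda>x. dpartial b f x + dpartial b g x", OF assms]) (use Suc e that in auto)
  then show ?case using Suc.prems by auto
qed auto

lemma dpartial_mult:
  fixes f g :: "'a::euclidean_space \<Rightarrow> real"
  assumes "f differentiable at x" "g differentiable at x"
  shows "dpartial b (\<lambda>x. f x * g x) x = dpartial b f x * g x + f x * dpartial b g x"
proof -
  have "((\<lambda>x. f x * g x) has_derivative (\<lambda>h. f x * frechet_derivative g (at x) h + frechet_derivative f (at x) h * g x)) (at x)"
    using assms by (intro has_derivative_mult) (auto simp: frechet_derivative_works[symmetric])
  from dpartial_eqI[OF this] show ?thesis by (simp add: dpartial_def)
qed

lemma Dk_mult:
  assumes "open S"
  shows "Dk k S f \<Longrightarrow> Dk k S g \<Longrightarrow> Dk k S (\<lambda>x. f x * g x)"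
proof (induction k arbitrary: f g)
  case (Suc k)
  have "Dk k S (dpartial b (\<lambda>x. f x * g x))" if "b \<in> Basis" for b
    apply (rule Dk_cong[where f="\<lambda>x. dpartial b f x * g x + f x * dpartial b g x", OF assms])
    using Suc that Dk_pred[of k S f] Dk_pred[of k S g] assms
    by (auto intro!: Dk_add simp: dpartial_mult)
  then show ?case using Suc.prems by auto
qed auto

lemma Dk_sum:
  assumes "open S"
  shows "(\<And>i. i \<in> I \<Longrightarrow> Dk k S (f i)) \<Longrightarrow> Dk k S (\<lambda>x. \<Sum>i\<in>I. f i x)"
  by (induction I rule: infinite_finite_induct) (auto intro: Dk_const Dk_add[OF assms])

text \<open>The chain rule in coordinates: it exhibits each partial of the composite as a sum of
  products, the shape on which the induction in \<open>Dk_compose\<close> runs.\<close>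

lemma comp_has_derivative:
  fixes f :: "'b::euclidean_space \<Rightarrow> real" and u :: "'a::euclidean_space \<Rightarrow> 'b"
  assumes f: "f differentiable at (u x)" and u: "\<And>c. c \<in> Basis \<Longrightarrow> (\<lambda>x. u x \<bullet> c) differentiable at x"
  shows "((\<lambda>x. f (u x)) has_derivative
     (\<lambda>h. \<Sum>c\<in>Basis. dpartial c f (u x) * frechet_derivative (\<lambda>x. u x \<bullet> c) (at x) h)) (at x)"
proof -
  define u' where "u' h = (\<Sum>c\<in>Basis. frechet_derivative (\<lambda>x. u x \<bullet> c) (at x) h *\<^sub>R c)" for h
  have u1: "(u has_derivative u') (at x)"
    unfolding u'_def using u
    by (subst has_derivative_componentwise_within)
       (auto simp: inner_sum_left inner_Basis if_distrib sum.delta frechet_derivative_works[symmetric] cong: if_cong)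
  have "((\<lambda>x. f (u x)) has_derivative (\<lambda>h. frechet_derivative f (at (u x)) (u' h))) (at x)"
    using has_derivative_compose[OF u1, of f] f frechet_derivative_works by auto
  moreover have "frechet_derivative f (at (u x)) (u' h) = 
     (\<Sum>c\<in>Basis. dpartial c f (u x) * frechet_derivative (\<lambda>x. u x \<bullet> c) (at x) h)" for h
    using frechet_derivative_expand[OF f, of "u' h"]
    by (auto simp: u'_def inner_sum_left inner_Basis if_distrib sum.delta mult.commute cong: if_cong intro!: sum.cong)
  ultimately show ?thesis by simp
qed

lemma Dk_compose:
  fixes f :: "'b::euclidean_space \<Rightarrow> real" and u :: "'a::euclidean_space \<Rightarrow> 'b"
  assumes "open S" "open T" "u ` S \<subseteq> T"
  shows "Dk k T f \<Longrightarrow> (\<And>c. c \<in> Basis \<Longrightarrow> Dk k S (\<lambda>x. u x \<bullet> c)) \<Longrightarrow> Dk k S (\<lambda>x. f (u x))"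
proof (induction k arbitrary: f)
  case (Suc k)
  have d: "((\<lambda>x. f (u x)) has_derivative
     (\<lambda>h. \<Sum>c\<in>Basis. dpartial c f (u x) * frechet_derivative (\<lambda>x. u x \<bullet> c) (at x) h)) (at x)" if "x \<in> S" for x
  proof (rule comp_has_derivative)
    show "f differentiable at (u x)" using Suc.prems(1) assms(3) that by auto
    show "(\<lambda>x. u x \<bullet> c) differentiable at x" if "c \<in> Basis" for c
      using Suc.prems(2)[OF that] \<open>x \<in> S\<close> by simp
  qed
  have "Dk k S (dpartial b (\<lambda>x. f (u x)))" if "b \<in> Basis" for b
  proof (rule Dk_cong[where f="\<lambda>x. \<Sum>c\<in>Basis. dpartial c f (u x) * dpartial b (\<lambda>x. u x \<bullet> c) x", OF assms(1)])
    show "Dk k S (\<lambda>x. \<Sum>c\<in>Basis. dpartial c f (u x) * dpartial b (\<lambda>x. u x \<bullet> c) x)"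
    proof (rule Dk_sum[OF assms(1)], rule Dk_mult[OF assms(1)])
      fix c :: 'b assume c: "c \<in> Basis"
      show "Dk k S (\<lambda>x. dpartial c f (u x))"
      proof (rule Suc.IH)
        show "Dk k T (dpartial c f)" using Suc.prems(1) c by simp
        show "Dk k S (\<lambda>x. u x \<bullet> d)" if "d \<in> Basis" for d
          using Suc.prems(2)[OF that] by (rule Dk_pred)
      qed
      show "Dk k S (dpartial b (\<lambda>x. u x \<bullet> c))" using Suc.prems(2)[OF c] that by simp
    qed
    show "(\<Sum>c\<in>Basis. dpartial c f (u x) * dpartial b (\<lambda>x. u x \<bullet> c) x) = dpartial b (\<lambda>x. f (u x)) x" if "x \<in> S" for x
      using dpartial_eqI[OF d[OF that], of b] by (simp add: dpartial_def)
  qed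
  moreover have "(\<lambda>x. f (u x)) differentiable at x" if "x \<in> S" for x
    using d[OF that] unfolding differentiable_def by blast
  ultimately show ?case by simp
qed simp

lemma smooth_onI: "open S \<Longrightarrow> (\<And>k. Dk k S f) \<Longrightarrow> smooth_on S f"
  using smooth_on_Dk by blast
lemma smooth_onD: "smooth_on S f \<Longrightarrow> open S \<Longrightarrow> Dk k S f"
  using smooth_on_Dk by blast

lemma smooth_on_const[intro]: "open S \<Longrightarrow> smooth_on S (\<lambda>_. c)"
  by (rule smooth_onI) (auto intro: Dk_const)
lemma smooth_on_add[intro]: "open S \<Longrightarrow> smooth_on S f \<Longrightarrow> smooth_on S g \<Longrightarrow> smooth_on S (\<lambda>x. f x + g x)"
  by (rule smooth_onI, assumption, rule Dk_add) (auto intro: smooth_onD)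
lemma smooth_on_mult[intro]: "open S \<Longrightarrow> smooth_on S f \<Longrightarrow> smooth_on S g \<Longrightarrow> smooth_on S (\<lambda>x. f x * g x)"
  by (rule smooth_onI, assumption, rule Dk_mult) (auto intro: smooth_onD)
lemma smooth_on_sum[intro]: "open S \<Longrightarrow> (\<And>i. i \<in> I \<Longrightarrow> smooth_on S (f i)) \<Longrightarrow> smooth_on S (\<lambda>x. \<Sum>i\<in>I. f i x)"
  by (rule smooth_onI, assumption, rule Dk_sum) (auto intro: smooth_onD)
lemma smooth_on_diff[intro]:
  assumes "open S" "smooth_on S f" "smooth_on S g" shows "smooth_on S (\<lambda>x. f x - g x)"
proof -
  have "smooth_on S (\<lambda>x. f x + (-1) * g x)" 
    by (intro smooth_on_add smooth_on_mult smooth_on_const assms)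
  then show ?thesis by simp
qed
lemma smooth_on_compose:
  fixes f :: "'b::euclidean_space \<Rightarrow> real" and u :: "'a::euclidean_space \<Rightarrow> 'b"
  assumes "open S" "open T" "u ` S \<subseteq> T" "smooth_on T f" "\<And>c. c \<in> Basis \<Longrightarrow> smooth_on S (\<lambda>x. u x \<bullet> c)"
  shows "smooth_on S (\<lambda>x. f (u x))"
  by (rule smooth_onI[OF assms(1)], rule Dk_compose[OF assms(1-3)]) (auto intro: smooth_onD assms)
lemma smooth_compose:
  fixes f :: "'b::euclidean_space \<Rightarrow> real" and u :: "'a::euclidean_space \<Rightarrow> 'b"
  shows "smooth f \<Longrightarrow> (\<And>c. c \<in> Basis \<Longrightarrow> smooth (\<lambda>x. u x \<bullet> c)) \<Longrightarrow> smooth (\<lambda>x. f (u x))"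
  using smooth_on_compose[of UNIV UNIV u f] by simp
lemma smooth_compose_real:
  fixes u :: "'a::euclidean_space \<Rightarrow> real"
  shows "smooth f \<Longrightarrow> smooth u \<Longrightarrow> smooth (\<lambda>x. f (u x))"
  using smooth_compose[of f u] by simp

lemma smooth_linear:
  fixes l :: "'a::euclidean_space \<Rightarrow> real"
  assumes "bounded_linear l" shows "smooth l"
proof -
  have d: "(l has_derivative l) (at x)" for x using assms by (rule bounded_linear_imp_has_derivative)
  have "dpartial b l = (\<lambda>_. l b)" for b using dpartial_eqI[OF d] by auto
  then show ?thesis using d by (subst smooth_on_Cons) (auto simp: differentiable_def)
qed

lemma smooth_linear_comp:
  fixes L :: "'a::euclidean_space \<Rightarrow> 'b::euclidean_space"
  assumes "linear L" "smooth f" shows "smooth (\<lambda>x. f (L x))"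
proof (rule smooth_compose[OF assms(2)])
  fix c :: 'b
  have "bounded_linear L" using assms linear_conv_bounded_linear by blast
  then have "bounded_linear (\<lambda>x. L x \<bullet> c)"
    by (rule bounded_linear_compose[OF bounded_linear_inner_left])
  then show "smooth (\<lambda>x. L x \<bullet> c)" by (rule smooth_linear)
qed

lemma smooth_inner[intro]: "smooth (\<lambda>x. x \<bullet> c)"
  by (rule smooth_linear) (rule bounded_linear_inner_left)

lemma smooth_fst[intro]: "smooth (\<lambda>x::real\<times>'a::euclidean_space. fst x)"
  by (rule smooth_linear) (rule bounded_linear_fst)
lemma smooth_snd[intro]: "smooth (\<lambda>x::real\<times>'a::euclidean_space. snd x \<bullet> c)"
  by (rule smooth_linear) (rule bounded_linear_compose[OF bounded_linear_inner_left bounded_linear_snd])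

lemma Dk_real_derivI:
  fixes f f' :: "real \<Rightarrow> real"
  assumes "\<And>x. (f has_real_derivative f' x) (at x)" "Dk k UNIV f'"
  shows "Dk (Suc k) UNIV f"
proof -
  have "dpartial 1 f x = f' x" for x
    using dpartial_eqI[OF assms(1)[unfolded has_field_derivative_def], of 1] by simp
  then have "dpartial 1 f = f'" by blast
  then show ?thesis using assms by (auto simp: real_differentiable_def)
qed

lemma smooth_exp: "smooth (exp :: real \<Rightarrow> real)"
proof -
  have "Dk k UNIV (exp :: real\<Rightarrow>real)" for k
    by (induction k) (auto intro!: Dk_real_derivI[of exp exp] DERIV_exp simp del: Dk.simps(2))
  then show ?thesis by (auto intro: smooth_onI)
qed

lemma smooth_sin_cos: "smooth (sin :: real \<Rightarrow> real)" "smooth (cos :: real \<Rightarrow> real)"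
proof -
  have "Dk k UNIV (sin :: real\<Rightarrow>real) \<and> Dk k UNIV (\<lambda>x::real. - sin x) \<and> Dk k UNIV (cos :: real\<Rightarrow>real) \<and> Dk k UNIV (\<lambda>x::real. - cos x)" for k
  proof (induction k)
    case (Suc k)
    then show ?case
      by (intro conjI Dk_real_derivI[of sin cos] Dk_real_derivI[of cos "\<lambda>x. - sin x"]
         Dk_real_derivI[of "\<lambda>x. - sin x" "\<lambda>x. - cos x"] Dk_real_derivI[of "\<lambda>x. - cos x" sin])
         (auto intro!: derivative_eq_intros)
  qed auto
  then show "smooth (sin :: real \<Rightarrow> real)" "smooth (cos :: real \<Rightarrow> real)" by (auto intro: smooth_onI)
qed

lemma smooth_on_inverse:
  fixes f :: "'a::euclidean_space \<Rightarrow> real"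
  assumes "smooth f" "\<And>x. f x \<noteq> 0" shows "smooth (\<lambda>x. inverse (f x))"
proof -
  have d: "((\<lambda>x. inverse (f x)) has_derivative (\<lambda>h. - (inverse (f x) * frechet_derivative f (at x) h * inverse (f x)))) (at x)" for x
    by (rule Deriv.has_derivative_inverse) (use assms smooth_has_derivative in auto)
  have "Dk k UNIV (\<lambda>x. inverse (f x))" for k
  proof (induction k)
    case (Suc k)
    have "Dk k UNIV (dpartial b (\<lambda>x. inverse (f x)))" if "b \<in> Basis" for b
    proof -
      have e: "dpartial b (\<lambda>x. inverse (f x)) = (\<lambda>x. (-1) * (inverse (f x) * dpartial b f x * inverse (f x)))"
        using dpartial_eqI[OF d] by (auto simp: dpartial_def)
      show ?thesis unfolding e using Suc that smooth_dpartial[OF assms(1) that]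
        by (intro Dk_mult Dk_const) (auto intro: smooth_onD)
    qed
    then show ?case using d by (auto simp: differentiable_def)
  qed auto
  then show ?thesis by (auto intro: smooth_onI)
qed

section \<open>Vector fields as derivations\<close>

lemma vf_apply_expand:
  fixes f :: "'a::euclidean_space \<Rightarrow> real"
  assumes "f differentiable at x"
  shows "vf_apply X f x = (\<Sum>b\<in>Basis. (X x \<bullet> b) * dpartial b f x)"
  unfolding vf_apply_def using frechet_derivative_expand[OF assms] .

lemma smooth_vf_apply:
  fixes f :: "'a::euclidean_space \<Rightarrow> real"
  assumes "linear X" "smooth f" shows "smooth (vf_apply X f)"
proof -
  have "vf_apply X f = (\<lambda>x. \<Sum>b\<in>Basis. (X x \<bullet> b) * dpartial b f x)"
    using assms(2) by (intro ext vf_apply_expand smooth_differentiable)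
  moreover have "smooth (\<lambda>x. X x \<bullet> b)" for b by (rule smooth_linear_comp[OF assms(1) smooth_inner])
  ultimately show ?thesis
    using smooth_dpartial[OF assms(2)] by (simp add: smooth_on_sum smooth_on_mult)
qed

lemma vf_apply_add:
  assumes "f differentiable at p" "g differentiable at p"
  shows "vf_apply X (\<lambda>x. f x + g x) p = vf_apply X f p + vf_apply X g p"
  using assms unfolding vf_apply_def by (simp add: frechet_derivative_add)

lemma vf_apply_diff:
  fixes f g :: "'a::euclidean_space \<Rightarrow> real"
  assumes "f differentiable at p" "g differentiable at p"
  shows "vf_apply X (\<lambda>x. f x - g x) p = vf_apply X f p - vf_apply X g p"
  by (rule vf_apply_eqI[THEN trans])
     (auto intro!: has_derivative_diff assms simp: frechet_derivative_works[symmetric] vf_apply_def)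

lemma vf_apply_mult:
  fixes f g :: "'a::euclidean_space \<Rightarrow> real"
  assumes "f differentiable at p" "g differentiable at p"
  shows "vf_apply X (\<lambda>x. f x * g x) p = vf_apply X f p * g p + f p * vf_apply X g p"
  by (simp add: vf_apply_expand assms dpartial_mult algebra_simps sum.distrib sum_distrib_left)

lemma vf_apply_const [simp]: "vf_apply X (\<lambda>_. c) p = 0"
  by (simp add: vf_apply_def)

lemma vf_apply_sum:
  fixes f :: "'i \<Rightarrow> 'a::euclidean_space \<Rightarrow> real"
  assumes "finite I" "\<And>i. i \<in> I \<Longrightarrow> f i differentiable at p"
  shows "vf_apply X (\<lambda>x. \<Sum>i\<in>I. f i x) p = (\<Sum>i\<in>I. vf_apply X (f i) p)"
  using assms by (induction I rule: finite_induct) (auto simp: vf_apply_add)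

text \<open>A linear map commuting with the field carries it to itself. The maps inserted for
  \<open>M\<close> are dilations, hyperbolic flows and rotations.\<close>

lemma vf_apply_linear_comp:
  fixes f :: "'a::euclidean_space \<Rightarrow> real" and M :: "'a \<Rightarrow> 'a"
  assumes "linear M" "f differentiable at (M p)" "L (M p) = M (L p)"
  shows "vf_apply L (\<lambda>x. f (M x)) p = vf_apply L f (M p)"
proof -
  have "(M has_derivative M) (at p)"
    using assms(1) linear_conv_bounded_linear bounded_linear_imp_has_derivative by blast
  from has_derivative_compose[OF this, of f] assms(2)
  have "((\<lambda>x. f (M x)) has_derivative (\<lambda>h. frechet_derivative f (at (M p)) (M h))) (at p)"
    using frechet_derivative_works by blast
  from vf_apply_eqI[OF this, of L] show ?thesis by (simp add: vf_apply_def assms(3))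
qed

lemma vf_apply_real_comp:
  fixes f :: "'a::euclidean_space \<Rightarrow> real" and u :: "real \<Rightarrow> real"
  assumes "f differentiable at p" "(u has_real_derivative u') (at (f p))"
  shows "vf_apply L (\<lambda>x. u (f x)) p = u' * vf_apply L f p"
proof -
  have "((\<lambda>x. u (f x)) has_derivative (\<lambda>h. u' * frechet_derivative f (at p) h)) (at p)"
    using has_derivative_compose[of f "frechet_derivative f (at p)" p UNIV u "(*) u'"] assms
      frechet_derivative_works by (auto simp: has_field_derivative_def)
  from vf_apply_eqI[OF this, of L] show ?thesis by (simp add: vf_apply_def)
qed

lemmas smooth_intros = smooth_on_const[OF open_UNIV] smooth_on_add[OF open_UNIV] smooth_on_diff[OF open_UNIV]
  smooth_on_mult[OF open_UNIV] smooth_on_sum[OF open_UNIV] smooth_inner smooth_fst smooth_snd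

text \<open>The standard building block \<open>exp (- 1 / x)\<close> is treated together with its multiples by \<open>x\<close> to the
  power \<open>- m\<close>: this family is closed under differentiation.\<close>

lemma bump_exists:
  obtains c :: "real \<Rightarrow> real" where "smooth c" "\<And>u. u \<le> 1/2 \<Longrightarrow> c u = 1" "\<And>u. u \<ge> 1 \<Longrightarrow> c u = 0"
proof -
  define h :: "nat \<Rightarrow> real \<Rightarrow> real" where "h m x = (if x > 0 then inverse x ^ m * exp (- inverse x) else 0)" for m x
  have lim: "((\<lambda>x. inverse x ^ m * exp (- inverse x)) \<longlongrightarrow> 0) (at_right (0::real))" for m
  proof -
    have "((\<lambda>y. y ^ m / exp y) \<longlongrightarrow> 0) (at_top::real filter)" by (rule tendsto_power_div_exp_0)
    from filterlim_compose[OF this filterlim_inverse_at_top_right]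
    show ?thesis by (simp add: exp_minus divide_inverse)
  qed
  have D: "(h m has_real_derivative (- real m * h (Suc m) x + h (Suc (Suc m)) x)) (at x)" for m x
  proof -
    consider "x > 0" | "x < 0" | "x = 0" by linarith
    then show ?thesis
    proof cases
      case 1
      have "((\<lambda>x. inverse x ^ m * exp (- inverse x)) has_real_derivative (- real m * h (Suc m) x + h (Suc (Suc m)) x)) (at x)"
        using 1 by (auto intro!: derivative_eq_intros simp: h_def field_simps power2_eq_square)
           (cases m; simp add: field_simps)
      then show ?thesis
        by (rule has_field_derivative_transform_within_open[where S="{0<..}"]) (use 1 in \<open>auto simp: h_def\<close>)
    next
      case 2
      have "((\<lambda>x. 0) has_real_derivative (- real m * h (Suc m) x + h (Suc (Suc m)) x)) (at x)"
        using 2 by (auto simp: h_def)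
      then show ?thesis
        by (rule has_field_derivative_transform_within_open[where S="{..<0}"]) (use 2 in \<open>auto simp: h_def\<close>)
    next
      case 3
      \<comment> \<open>For \<open>y > 0\<close> the difference quotient of \<open>h m\<close> at 0
        is \<open>h (Suc m) y\<close>, so the limit \<open>lim\<close> for \<open>Suc m\<close>
        applies.\<close>
      have r: "((\<lambda>y. (h m y - h m 0) / (y - 0)) \<longlongrightarrow> 0) (at_right 0)"
        by (rule Lim_transform_eventually[OF lim[of "Suc m"]])
           (auto simp: eventually_at_filter h_def field_simps)
      have l: "((\<lambda>y. (h m y - h m 0) / (y - 0)) \<longlongrightarrow> 0) (at_left 0)"
        by (rule Lim_transform_eventually[OF tendsto_const])
           (auto simp: eventually_at_filter h_def)
      have "((\<lambda>y. (h m y - h m 0) / (y - 0)) \<longlongrightarrow> 0) (at 0)"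
        using l r by (simp add: filterlim_split_at)
      then show ?thesis using 3 by (simp add: has_field_derivative_iff h_def)
    qed
  qed
  have "Dk k UNIV (h m)" for k m
  proof (induction k arbitrary: m)
    case (Suc k)
    show ?case
      by (rule Dk_real_derivI[OF D]) (intro Dk_add Dk_mult Dk_const Suc; simp)
  qed auto
  then have hs: "smooth (h m)" for m by (auto intro: smooth_onI)
  have id: "smooth (\<lambda>u::real. u)" using smooth_inner[of "1::real"] by simp
  \<comment> \<open>\<open>a\<close> is positive exactly for \<open>u < 1\<close> and
    \<open>b\<close> exactly for \<open>u > 1/2\<close>; so \<open>a + b\<close> never vanishes, and
    \<open>a / (a + b)\<close> is 1 up to 1/2 and 0 from 1 on.\<close>
  define a where "a u = h 0 (1 - u)" for u
  define b where "b u = h 0 (u - 1/2)" for u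
  have "smooth (\<lambda>x::real. 1 - x)" by (rule smooth_on_diff[OF open_UNIV smooth_on_const[OF open_UNIV] id])
  moreover have "smooth (\<lambda>x::real. x - 1/2)" by (rule smooth_on_diff[OF open_UNIV id smooth_on_const[OF open_UNIV]])
  ultimately have ab: "smooth a" "smooth b"
    unfolding a_def b_def using smooth_compose_real[OF hs] by blast+
  have hp: "h 0 x \<ge> 0" "x > 0 \<Longrightarrow> h 0 x > 0" "x \<le> 0 \<Longrightarrow> h 0 x = 0" for x by (auto simp: h_def)
  have nz: "a u + b u \<noteq> 0" for u
    using hp(1)[of "1-u"] hp(1)[of "u-1/2"] hp(2)[of "1-u"] hp(2)[of "u-1/2"]
    unfolding a_def b_def by (cases "u < 1") auto
  define c where "c u = a u * inverse (a u + b u)" for u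
  show thesis
  proof (rule that[of c])
    have "smooth (\<lambda>u. inverse (a u + b u))" using ab nz by (intro smooth_on_inverse) auto
    then show "smooth c" unfolding c_def using ab by auto
    show "c u = 1" if "u \<le> 1/2" for u
      using nz[of u] that by (simp add: c_def b_def hp)
    show "c u = 0" if "u \<ge> 1" for u using that by (simp add: c_def a_def hp)
  qed
qed

section \<open>Integrals depending on a parameter\<close>

lemma smooth_linear': "linear l \<Longrightarrow> smooth (l :: 'a::euclidean_space \<Rightarrow> real)"
  using smooth_linear linear_conv_bounded_linear by blast

lemma section_has_derivative:
  fixes \<Phi> :: "real \<times> 'a::euclidean_space \<Rightarrow> real"
  assumes "smooth \<Phi>"
  shows "((\<lambda>q. \<Phi> (t, q)) has_derivative (\<lambda>h. frechet_derivative \<Phi> (at (t, p)) (0, h))) (at p)"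
proof -
  have "((\<lambda>q. (t, q)) has_derivative (\<lambda>h. (0, h))) (at p)" by (auto intro!: derivative_eq_intros)
  from has_derivative_compose[OF this smooth_has_derivative[OF assms]] show ?thesis .
qed

lemma dpartial_section:
  fixes \<Phi> :: "real \<times> 'a::euclidean_space \<Rightarrow> real"
  assumes "smooth \<Phi>"
  shows "dpartial b (\<lambda>q. \<Phi> (t, q)) p = dpartial (0, b) \<Phi> (t, p)"
  using dpartial_eqI[OF section_has_derivative[OF assms]] by (simp add: dpartial_def)

lemma vf_apply_section:
  fixes \<Phi> :: "real \<times> 'a::euclidean_space \<Rightarrow> real"
  assumes "smooth \<Phi>"
  shows "vf_apply L (\<lambda>q. \<Phi> (t, q)) p = (\<Sum>b\<in>Basis. (L p \<bullet> b) * dpartial (0, b) \<Phi> (t, p))"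
proof -
  have "(\<lambda>q. \<Phi> (t, q)) differentiable at p"
    using section_has_derivative[OF assms] unfolding differentiable_def by blast
  from vf_apply_expand[OF this] show ?thesis by (simp add: dpartial_section[OF assms])
qed

lemma smooth_section:
  fixes \<Phi> :: "real \<times> 'a::euclidean_space \<Rightarrow> real"
  assumes "smooth \<Phi>" shows "smooth (\<lambda>q. \<Phi> (t, q))"
proof (rule smooth_compose[OF assms])
  fix c :: "real \<times> 'a"
  have "smooth (\<lambda>q. t * fst c + q \<bullet> snd c)" by (intro smooth_on_add smooth_inner) auto
  then show "smooth (\<lambda>x. (t, x) \<bullet> c)" by (simp add: inner_prod_def)
qed

lemma section_has_real_derivative:
  fixes \<Phi> :: "real \<times> 'a::euclidean_space \<Rightarrow> real"
  assumes "smooth \<Phi>"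
  shows "((\<lambda>t. \<Phi> (t, p)) has_real_derivative dpartial (1, 0) \<Phi> (t, p)) (at t)"
proof -
  have l: "linear (frechet_derivative \<Phi> (at (t, p)))"
    using linear_frechet_derivative smooth_differentiable[OF assms] by blast
  have "((\<lambda>q. (q, p)) has_derivative (\<lambda>h. (h, 0))) (at t)" by (auto intro!: derivative_eq_intros)
  from has_derivative_compose[OF this smooth_has_derivative[OF assms]]
  have "((\<lambda>q. \<Phi> (q, p)) has_derivative (\<lambda>h. frechet_derivative \<Phi> (at (t, p)) (h, 0))) (at t)" .
  moreover have "frechet_derivative \<Phi> (at (t, p)) (h, 0) = dpartial (1, 0) \<Phi> (t, p) * h" for h
    using linear_scale[OF l, of h "(1, 0)"] by (simp add: dpartial_def)
  ultimately show ?thesis unfolding has_field_derivative_def by simp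
qed

lemma pair_Basis: "b \<in> Basis \<Longrightarrow> (0, b) \<in> Basis" "(1::real, 0) \<in> Basis"
  by (auto simp: Basis_prod_def)

lemma section_continuous:
  fixes \<Phi> :: "real \<times> 'a::euclidean_space \<Rightarrow> real"
  assumes "smooth \<Phi>" shows "continuous_on S (\<lambda>t. \<Phi> (t, p))"
  using section_has_real_derivative[OF assms] by (meson DERIV_continuous_on DERIV_subset UNIV_I subset_UNIV)

lemma integral_param_has_derivative:
  fixes \<Phi> :: "real \<times> 'a::euclidean_space \<Rightarrow> real"
  assumes "smooth \<Phi>"
  shows "((\<lambda>p. integral {0..1} (\<lambda>t. \<Phi> (t, p))) has_derivative
     (\<lambda>h. integral {0..1} (\<lambda>t. \<Sum>b\<in>Basis. (h \<bullet> b) * dpartial (0, b) \<Phi> (t, p)))) (at p)"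
proof -
  \<comment> \<open>\<open>leibniz_rule\<close> asks for the derivative as a jointly continuous
    \<open>blinfun\<close>; assembling it from the partials reduces this to continuity of real
    functions.\<close>
  define fx where "fx q t = (\<Sum>b\<in>Basis. dpartial (0, b) \<Phi> (t, q) *\<^sub>R blinfun_inner_left b)" for q t
  have fx: "blinfun_apply (fx q t) h = (\<Sum>b\<in>Basis. (h \<bullet> b) * dpartial (0, b) \<Phi> (t, q))" for q t h
    unfolding fx_def by (simp add: blinfun.sum_left blinfun.scaleR_left mult.commute inner_commute)
  have d: "((\<lambda>q. \<Phi> (t, q)) has_derivative blinfun_apply (fx q t)) (at q within UNIV)" for q t
  proof -
    have "(\<lambda>h. frechet_derivative \<Phi> (at (t, q)) (0, h)) = blinfun_apply (fx q t)"
    proof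
      fix h :: 'a
      have l: "linear (frechet_derivative \<Phi> (at (t, q)))"
        using linear_frechet_derivative smooth_differentiable[OF assms] by blast
      have "(0::real, h) = (\<Sum>b\<in>Basis. (h \<bullet> b) *\<^sub>R (0, b))"
        by (rule prod_eqI) (simp_all add: fst_sum snd_sum euclidean_representation)
      then have "frechet_derivative \<Phi> (at (t, q)) (0, h) = frechet_derivative \<Phi> (at (t, q)) (\<Sum>b\<in>Basis. (h \<bullet> b) *\<^sub>R (0, b))"
        by simp
      also have "\<dots> = blinfun_apply (fx q t) h"
        by (simp only: linear_sum[OF l] linear_scale[OF l] fx dpartial_def real_scaleR_def)
      finally show "frechet_derivative \<Phi> (at (t, q)) (0, h) = blinfun_apply (fx q t) h" .
    qed
    then show ?thesis using section_has_derivative[OF assms, of t q] by simp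
  qed
  have c: "continuous_on (UNIV \<times> cbox 0 1) (\<lambda>(q, t). fx q t)"
  proof -
    have "continuous_on (UNIV \<times> cbox 0 1) (\<lambda>z. dpartial (0, b) \<Phi> (snd z, fst z))" if "b \<in> Basis" for b
    proof -
      have "continuous_on UNIV (dpartial (0, b) \<Phi>)"
        using smooth_continuous_on[OF smooth_dpartial[OF assms pair_Basis(1)[OF that]]] .
      then show ?thesis by (rule continuous_on_compose2) (auto intro!: continuous_intros)
    qed
    then show ?thesis unfolding fx_def case_prod_unfold by (intro continuous_intros) auto
  qed
  have "((\<lambda>p. integral (cbox 0 1) (\<lambda>t. \<Phi> (t, p))) has_derivative integral (cbox 0 1) (fx p)) (at p within UNIV)"
    by (rule leibniz_rule[OF d _ c]) (auto intro!: integrable_continuous_real section_continuous[OF assms])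
  moreover have "blinfun_apply (integral (cbox 0 1) (fx p)) h = integral {0..1} (\<lambda>t. \<Sum>b\<in>Basis. (h \<bullet> b) * dpartial (0, b) \<Phi> (t, p))" for h
  proof -
    have "fx p integrable_on cbox 0 1"
    proof (rule integrable_continuous)
      show "continuous_on (cbox 0 1) (fx p)"
      proof -
        have "continuous_on (cbox 0 1) (\<lambda>t::real. (p, t))" by (intro continuous_intros)
        from continuous_on_compose2[OF c this] show ?thesis by auto
      qed
    qed
    then show ?thesis by (subst blinfun_apply_integral) (auto simp: fx)
  qed
  then have "blinfun_apply (integral (cbox 0 1) (fx p)) = (\<lambda>h. integral {0..1} (\<lambda>t. \<Sum>b\<in>Basis. (h \<bullet> b) * dpartial (0, b) \<Phi> (t, p)))"
    by blast
  ultimately show ?thesis by simp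
qed

lemma dpartial_integral:
  fixes \<Phi> :: "real \<times> 'a::euclidean_space \<Rightarrow> real"
  assumes "smooth \<Phi>" "b \<in> Basis"
  shows "dpartial b (\<lambda>p. integral {0..1} (\<lambda>t. \<Phi> (t, p))) = (\<lambda>p. integral {0..1} (\<lambda>t. dpartial (0, b) \<Phi> (t, p)))"
proof
  fix p
  show "dpartial b (\<lambda>p. integral {0..1} (\<lambda>t. \<Phi> (t, p))) p = integral {0..1} (\<lambda>t. dpartial (0, b) \<Phi> (t, p))"
    using dpartial_eqI[OF integral_param_has_derivative[OF assms(1)], of b p] assms(2)
    by (simp add: inner_Basis if_distrib if_distribR sum.delta' cong: if_cong)
qed

lemma smooth_integral:
  fixes \<Phi> :: "real \<times> 'a::euclidean_space \<Rightarrow> real"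
  assumes "smooth \<Phi>"
  shows "smooth (\<lambda>p. integral {0..1} (\<lambda>t. \<Phi> (t, p)))"
proof (rule smooth_onI)
  fix k show "Dk k UNIV (\<lambda>p. integral {0..1} (\<lambda>t. \<Phi> (t, p)))" using assms
  proof (induction k arbitrary: \<Phi>)
    case (Suc k)
    have "(\<lambda>p. integral {0..1} (\<lambda>t. \<Phi> (t, p))) differentiable at p" for p
      using integral_param_has_derivative[OF Suc.prems] unfolding differentiable_def by blast
    moreover have "Dk k UNIV (dpartial b (\<lambda>p. integral {0..1} (\<lambda>t. \<Phi> (t, p))))" if "b \<in> Basis" for b
      unfolding dpartial_integral[OF Suc.prems that]
      using Suc.IH[OF smooth_dpartial[OF Suc.prems pair_Basis(1)[OF that]]] .
    ultimately show ?case by simp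
  qed simp
qed simp

lemma vf_apply_integral:
  fixes \<Phi> :: "real \<times> 'a::euclidean_space \<Rightarrow> real"
  assumes "smooth \<Phi>"
  shows "vf_apply L (\<lambda>p. integral {0..1} (\<lambda>t. \<Phi> (t, p))) p = integral {0..1} (\<lambda>t. vf_apply L (\<lambda>q. \<Phi> (t, q)) p)"
  using vf_apply_eqI[OF integral_param_has_derivative[OF assms], of L p]
  by (simp add: vf_apply_section[OF assms])

text \<open>The quotient in Hadamard's lemma \<open>\<Phi> (t, p) = \<Phi> (0, p) + t * hadamard \<Phi> (t, p)\<close>; being an
  integral it is smooth also at \<open>t = 0\<close>, and iterating it yields Taylor expansions in \<open>t\<close>.\<close>

definition hadamard :: "(real \<times> 'a::euclidean_space \<Rightarrow> real) \<Rightarrow> real \<times> 'a \<Rightarrow> real" where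
  "hadamard \<Phi> z = integral {0..1} (\<lambda>v. dpartial (1, 0) \<Phi> (v * fst z, snd z))"

lemma smooth_hadamard:
  assumes "smooth \<Phi>" shows "smooth (hadamard \<Phi>)"
proof -
  have "smooth (\<lambda>w::real \<times> (real \<times> 'a). dpartial (1, 0) \<Phi> (fst w * fst (snd w), snd (snd w)))"
  proof (rule smooth_compose[OF smooth_dpartial[OF assms pair_Basis(2)]])
    fix c :: "real \<times> 'a"
    have "smooth (\<lambda>w::real \<times> (real \<times> 'a). fst (snd w))" "smooth (\<lambda>w::real \<times> (real \<times> 'a). snd (snd w) \<bullet> snd c)"
      using smooth_linear'[of "\<lambda>w::real \<times> (real \<times> 'a). fst (snd w)"]
        smooth_linear'[of "\<lambda>w::real \<times> (real \<times> 'a). snd (snd w) \<bullet> snd c"]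
      by (auto simp: linear_iff inner_add_left)
    then have "smooth (\<lambda>w::real \<times> (real \<times> 'a). fst w * fst (snd w) * fst c + snd (snd w) \<bullet> snd c)"
      by (intro smooth_on_add smooth_on_mult smooth_fst) auto
    then show "smooth (\<lambda>w::real \<times> (real \<times> 'a). (fst w * fst (snd w), snd (snd w)) \<bullet> c)"
      by (simp add: inner_prod_def)
  qed
  from smooth_integral[OF this] show ?thesis unfolding hadamard_def by simp
qed

lemma hadamard_expand:
  assumes "smooth \<Phi>" shows "\<Phi> (t, p) = \<Phi> (0, p) + t * hadamard \<Phi> (t, p)"
proof -
  have "((\<lambda>v. \<Phi> (v * t, p)) has_vector_derivative t * dpartial (1, 0) \<Phi> (v * t, p)) (at v within {0..1})" for v
  proof -
    have "((\<lambda>v. \<Phi> (v * t, p)) has_real_derivative dpartial (1, 0) \<Phi> (v * t, p) * t) (at v)"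
      by (rule DERIV_chain2[OF section_has_real_derivative[OF assms]]) (auto intro!: derivative_eq_intros)
    then show ?thesis
      by (simp add: has_real_derivative_iff_has_vector_derivative mult.commute has_vector_derivative_at_within)
  qed
  then have "((\<lambda>v. t * dpartial (1, 0) \<Phi> (v * t, p)) has_integral (\<Phi> (1 * t, p) - \<Phi> (0 * t, p))) {0..1}"
    by (intro fundamental_theorem_of_calculus) auto
  from integral_unique[OF this]
  have "integral {0..1} (\<lambda>v. t * dpartial (1, 0) \<Phi> (v * t, p)) = \<Phi> (t, p) - \<Phi> (0, p)" by simp
  then show ?thesis unfolding hadamard_def by simp
qed

lemma hadamard_0: assumes "smooth \<Phi>" shows "hadamard \<Phi> (0, p) = dpartial (1, 0) \<Phi> (0, p)"
  by (simp add: hadamard_def)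

text \<open>Expand \<open>f (p + t v)\<close> by Hadamard's lemma, differentiate along \<open>w\<close> and then in \<open>t\<close> at \<open>0\<close>.\<close>

lemma const_dir_commute:
  fixes f :: "'a::euclidean_space \<Rightarrow> real"
  assumes f: "smooth f" and v: "v \<in> Basis" and w: "w \<in> Basis"
  shows "dpartial v (dpartial w f) p = dpartial w (dpartial v f) p"
proof -
  define \<Phi> where "\<Phi> z = f (snd z + fst z *\<^sub>R v)" for z :: "real \<times> 'a"
  have \<Phi>s: "smooth \<Phi>" unfolding \<Phi>_def
    by (rule smooth_linear_comp[OF _ f]) (auto simp: linear_iff algebra_simps)
  have wf: "smooth (dpartial w f)" using smooth_dpartial[OF f w] .
  have shift: "dpartial w (\<lambda>q. g (q + a)) p = dpartial w g (p + a)" if "smooth g" for g :: "'a \<Rightarrow> real" and a p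
  proof -
    have "((\<lambda>q. q + a) has_derivative (\<lambda>h. h)) (at p)" by (auto intro!: derivative_eq_intros)
    from dpartial_eqI[OF has_derivative_compose[OF this smooth_has_derivative[OF that]], of w]
    show ?thesis by (simp add: dpartial_def)
  qed
  have line: "((\<lambda>t. g (p + t *\<^sub>R v)) has_real_derivative dpartial v g p) (at 0)" if "smooth g" for g p
  proof -
    have "((\<lambda>t. p + t *\<^sub>R v) has_derivative (\<lambda>h. h *\<^sub>R v)) (at 0)" by (auto intro!: derivative_eq_intros)
    moreover have "(g has_derivative frechet_derivative g (at p)) (at (p + 0 *\<^sub>R v))"
      using smooth_has_derivative[OF that] by simp
    ultimately have "((\<lambda>t. g (p + t *\<^sub>R v)) has_derivative (\<lambda>h. frechet_derivative g (at p) (h *\<^sub>R v))) (at 0)"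
      using has_derivative_compose by blast
    moreover have "frechet_derivative g (at p) (h *\<^sub>R v) = dpartial v g p * h" for h
      using linear_scale[OF linear_frechet_derivative[OF smooth_differentiable[OF that]]]
      by (simp add: dpartial_def)
    ultimately show ?thesis unfolding has_field_derivative_def by simp
  qed
  have H: "smooth (hadamard \<Phi>)" by (rule smooth_hadamard[OF \<Phi>s])
  define K where "K = dpartial (0, w) (hadamard \<Phi>)"
  have K: "smooth K" unfolding K_def using smooth_dpartial[OF H pair_Basis(1)[OF w]] .
  have "dpartial w f (p + t *\<^sub>R v) = dpartial w f p + t * K (t, p)" for t p
  proof -
    have e: "(\<lambda>q. f (q + t *\<^sub>R v)) = (\<lambda>q. f q + t * hadamard \<Phi> (t, q))"
      using hadamard_expand[OF \<Phi>s, of t] by (auto simp: \<Phi>_def)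
    have sd: "(\<lambda>q. hadamard \<Phi> (t, q)) differentiable at p"
      using smooth_differentiable[OF smooth_section[OF H]] .
    have "dpartial w (\<lambda>q. f q + t * hadamard \<Phi> (t, q)) p = dpartial w f p + dpartial w (\<lambda>q. t * hadamard \<Phi> (t, q)) p"
      using sd by (intro dpartial_add smooth_differentiable[OF f]) auto
    also have "dpartial w (\<lambda>q. t * hadamard \<Phi> (t, q)) p = t * K (t, p)"
      using dpartial_mult[of "\<lambda>_. t" p "\<lambda>q. hadamard \<Phi> (t, q)" w] sd dpartial_section[OF H]
      by (simp add: K_def dpartial_def)
    finally show ?thesis using shift[OF f, of "t *\<^sub>R v" p] e by simp
  qed
  then have "((\<lambda>t. dpartial w f p + t * K (t, p)) has_real_derivative dpartial v (dpartial w f) p) (at 0)"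
    using line[OF wf, of p] by simp
  moreover have "((\<lambda>t. dpartial w f p + t * K (t, p)) has_real_derivative K (0, p)) (at 0)"
    by (rule derivative_eq_intros section_has_real_derivative[OF K] refl | simp)+
  ultimately have "dpartial v (dpartial w f) p = K (0, p)" by (rule DERIV_unique)
  also have "\<dots> = dpartial w (\<lambda>q. hadamard \<Phi> (0, q)) p"
    using dpartial_section[OF H] by (simp add: K_def)
  also have "(\<lambda>q. hadamard \<Phi> (0, q)) = dpartial v f"
  proof
    fix q
    have "((\<lambda>t. \<Phi> (t, q)) has_real_derivative dpartial (1, 0) \<Phi> (0, q)) (at 0)"
      by (rule section_has_real_derivative[OF \<Phi>s])
    then show "hadamard \<Phi> (0, q) = dpartial v f q"
      using line[OF f, of q] DERIV_unique by (auto simp: hadamard_0[OF \<Phi>s] \<Phi>_def)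
  qed
  finally show ?thesis .
qed

text \<open>For linear fields the first-order part comes from the composed linear map, and the
  second-order part is symmetric in \<open>L\<close> and \<open>M\<close> once second partials
  commute. Hence commuting linear maps give commuting derivations.\<close>

lemma vf_apply_vf_apply:
  fixes f :: "'a::euclidean_space \<Rightarrow> real"
  assumes "linear L" "linear M" "smooth f"
  shows "vf_apply L (vf_apply M f) p = frechet_derivative f (at p) (M (L p)) +
     (\<Sum>a\<in>Basis. \<Sum>b\<in>Basis. (L p \<bullet> a) * (M p \<bullet> b) * dpartial a (dpartial b f) p)"
proof -
  have e: "vf_apply M f = (\<lambda>x. \<Sum>b\<in>Basis. (M x \<bullet> b) * dpartial b f x)"
    using assms by (intro ext vf_apply_expand smooth_differentiable)
  have sm: "smooth (\<lambda>x. M x \<bullet> b)" for b by (rule smooth_linear_comp[OF assms(2) smooth_inner])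
  have lm: "vf_apply L (\<lambda>x. M x \<bullet> b) p = M (L p) \<bullet> b" for b
  proof (rule vf_apply_eqI)
    have "bounded_linear M" using assms(2) linear_conv_bounded_linear by blast
    then show "((\<lambda>x. M x \<bullet> b) has_derivative (\<lambda>h. M h \<bullet> b)) (at p)"
      by (intro bounded_linear_imp_has_derivative bounded_linear_compose[OF bounded_linear_inner_left])
  qed
  have "vf_apply L (vf_apply M f) p = (\<Sum>b\<in>Basis. vf_apply L (\<lambda>x. (M x \<bullet> b) * dpartial b f x) p)"
    unfolding e using sm smooth_dpartial[OF assms(3)]
    by (intro vf_apply_sum) (auto intro!: smooth_differentiable smooth_on_mult)
  also have "\<dots> = (\<Sum>b\<in>Basis. (M (L p) \<bullet> b) * dpartial b f p + (M p \<bullet> b) * vf_apply L (dpartial b f) p)"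
    by (intro sum.cong refl, subst vf_apply_mult) (auto simp: lm intro!: smooth_differentiable sm smooth_dpartial[OF assms(3)])
  also have "\<dots> = frechet_derivative f (at p) (M (L p)) + (\<Sum>b\<in>Basis. (M p \<bullet> b) * vf_apply L (dpartial b f) p)"
    by (simp add: sum.distrib frechet_derivative_expand[OF smooth_differentiable[OF assms(3)]])
  also have "(\<Sum>b\<in>Basis. (M p \<bullet> b) * vf_apply L (dpartial b f) p) =
      (\<Sum>b\<in>Basis. \<Sum>a\<in>Basis. (L p \<bullet> a) * (M p \<bullet> b) * dpartial a (dpartial b f) p)"
    by (intro sum.cong refl, subst vf_apply_expand)
       (auto intro!: smooth_differentiable smooth_dpartial[OF assms(3)] simp: sum_distrib_left algebra_simps)
  also have "\<dots> = (\<Sum>a\<in>Basis. \<Sum>b\<in>Basis. (L p \<bullet> a) * (M p \<bullet> b) * dpartial a (dpartial b f) p)"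
    by (rule sum.swap)
  finally show ?thesis .
qed

lemma vf_apply_commute:
  fixes f :: "'a::euclidean_space \<Rightarrow> real"
  assumes "linear L" "linear M" "smooth f" "\<And>p. L (M p) = M (L p)"
  shows "vf_apply L (vf_apply M f) p = vf_apply M (vf_apply L f) p"
proof -
  have "(\<Sum>a\<in>Basis. \<Sum>b\<in>Basis. (L p \<bullet> a) * (M p \<bullet> b) * dpartial a (dpartial b f) p) =
     (\<Sum>a\<in>Basis. \<Sum>b\<in>Basis. (M p \<bullet> a) * (L p \<bullet> b) * dpartial a (dpartial b f) p)"
    by (subst sum.swap) (intro sum.cong refl, simp add: const_dir_commute[OF assms(3)] mult.commute)
  then show ?thesis by (simp add: vf_apply_vf_apply assms)
qed

section \<open>Partial scalings and partial Taylor coefficients\<close>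

definition cproj :: "'a::euclidean_space set \<Rightarrow> 'a \<Rightarrow> 'a" where
  "cproj B p = (\<Sum>b\<in>Basis. (if b \<in> B then p \<bullet> b else 0) *\<^sub>R b)"

text \<open>The dilation by \<open>t\<close> of the coordinates in \<open>B\<close>. The affine form
  makes sense at \<open>t = 0\<close>, where Taylor coefficients are read off, and its
  \<open>t\<close>-derivative is \<open>cproj B p\<close>, the Euler field of
  \<open>B\<close>.\<close>

definition cscale :: "'a::euclidean_space set \<Rightarrow> real \<Rightarrow> 'a \<Rightarrow> 'a" where
  "cscale B t p = p + (t - 1) *\<^sub>R cproj B p"

lemma cproj_inner: "c \<in> Basis \<Longrightarrow> cproj B p \<bullet> c = (if c \<in> B then p \<bullet> c else 0)"
  by (simp add: cproj_def)

lemma cscale_inner: "c \<in> Basis \<Longrightarrow> cscale B t p \<bullet> c = (if c \<in> B then t else 1) * (p \<bullet> c)"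
  by (simp add: cscale_def inner_add_left cproj_inner algebra_simps)

lemma linear_cproj: "linear (cproj B)"
  by (rule linearI) (auto simp: euclidean_eq_iff[where 'a='a] cproj_inner inner_add_left)

lemma linear_cscale: "linear (cscale B t)"
  by (rule linearI) (auto simp: euclidean_eq_iff[where 'a='a] cscale_inner inner_add_left algebra_simps)

lemma cscale_cscale: "cscale B t (cscale B s p) = cscale B (t * s) p"
  by (auto simp: euclidean_eq_iff[where 'a='a] cscale_inner)

lemma cscale_commute: "cscale B t (cscale C s p) = cscale C s (cscale B t p)"
  by (auto simp: euclidean_eq_iff[where 'a='a] cscale_inner)

lemma cproj_cscale_commute: "cproj C (cscale B t p) = cscale B t (cproj C p)"
  by (auto simp: euclidean_eq_iff[where 'a='a] cscale_inner cproj_inner)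

lemma cscale_1 [simp]: "cscale B 1 p = p" by (simp add: cscale_def)

lemma norm_le_componentwise_abs:
  assumes "\<And>b. b \<in> Basis \<Longrightarrow> \<bar>p \<bullet> b\<bar> \<le> \<bar>q \<bullet> b\<bar>" shows "norm (p::'a::euclidean_space) \<le> norm q"
  using assms by (intro norm_le_componentwise) auto

lemma norm_cscale_le: "\<bar>t\<bar> \<le> 1 \<Longrightarrow> norm (cscale B t p) \<le> norm p"
  by (rule norm_le_componentwise_abs) (auto simp: cscale_inner abs_mult mult_left_le_one_le)

lemma smooth_cscale: "smooth h \<Longrightarrow> smooth (\<lambda>p. h (cscale B t p))"
  by (rule smooth_linear_comp[OF linear_cscale])

lemma smooth_cscale_prod:
  fixes h :: "'a::euclidean_space \<Rightarrow> real"
  assumes "smooth h" shows "smooth (\<lambda>z. h (cscale B (fst z) (snd z)))"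
proof (rule smooth_compose[OF assms])
  fix c :: 'a assume c: "c \<in> Basis"
  have "smooth (\<lambda>z. (if c \<in> B then fst z else 1) * (snd z \<bullet> c))"
    by (cases "c \<in> B") (simp_all add: smooth_on_mult smooth_fst smooth_snd)
  then show "smooth (\<lambda>z. cscale B (fst z) (snd z) \<bullet> c)" by (simp add: cscale_inner[OF c])
qed

text \<open>The \<open>N\<close>-th Taylor remainder of \<open>h (cscale B t p)\<close> in
  \<open>t\<close>, already divided by \<open>t ^ N\<close>. Iterating \<open>hadamard\<close> makes
  it jointly smooth in \<open>t\<close> and \<open>p\<close>, also at \<open>t = 0\<close>.\<close>

definition trem :: "'a::euclidean_space set \<Rightarrow> nat \<Rightarrow> ('a \<Rightarrow> real) \<Rightarrow> real \<times> 'a \<Rightarrow> real" where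
  "trem B N h = (hadamard ^^ N) (\<lambda>z. h (cscale B (fst z) (snd z)))"

text \<open>The component of \<open>h\<close> of degree \<open>j\<close> in the coordinates
  \<open>B\<close>, with the factorial already divided out; it is a function of all coordinates, not
  a number.\<close>

definition tcoeff :: "'a::euclidean_space set \<Rightarrow> nat \<Rightarrow> ('a \<Rightarrow> real) \<Rightarrow> 'a \<Rightarrow> real" where
  "tcoeff B j h p = trem B j h (0, p)"

lemma smooth_trem: "smooth h \<Longrightarrow> smooth (trem B N h)"
  unfolding trem_def by (induction N) (auto intro: smooth_hadamard smooth_cscale_prod)

lemma smooth_tcoeff: "smooth h \<Longrightarrow> smooth (tcoeff B j h)"
  unfolding tcoeff_def by (rule smooth_section[OF smooth_trem])

lemma tcoeff_expand:
  assumes "smooth h"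
  shows "h (cscale B t p) = (\<Sum>j<N. tcoeff B j h p * t ^ j) + t ^ N * trem B N h (t, p)"
proof (induction N)
  case 0 then show ?case by (simp add: trem_def)
next
  case (Suc N)
  have "trem B N h (t, p) = tcoeff B N h p + t * trem B (Suc N) h (t, p)"
    using hadamard_expand[OF smooth_trem[OF assms], of B N t p] by (simp add: tcoeff_def trem_def)
  then show ?case using Suc by (simp add: algebra_simps)
qed

lemma smooth_section_bounded:
  fixes \<Psi> :: "real \<times> 'a::euclidean_space \<Rightarrow> real"
  assumes "smooth \<Psi>" obtains K where "K \<ge> 0" "\<And>t. t \<in> {a..b} \<Longrightarrow> \<bar>\<Psi> (t, p)\<bar> \<le> K"
proof -
  have "compact ((\<lambda>t. \<Psi> (t, p)) ` {a..b})"
    by (intro compact_continuous_image section_continuous[OF assms]) auto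
  then obtain K where "\<forall>x\<in>(\<lambda>t. \<Psi> (t, p)) ` {a..b}. norm x \<le> K"
    using compact_imp_bounded bounded_iff by metis
  then have "\<bar>\<Psi> (t, p)\<bar> \<le> max K 0" if "t \<in> {a..b}" for t using that by (auto simp: le_max_iff_disj)
  then show thesis using that[of "max K 0"] by auto
qed

text \<open>Letting \<open>t\<close> tend to 0 kills the lowest coefficient; dividing by
  \<open>t\<close> then lowers the order by one.\<close>

lemma power_sum_coeff_zero:
  fixes d :: "nat \<Rightarrow> real"
  assumes "0 < \<delta>" "\<And>t. 0 < t \<Longrightarrow> t \<le> \<delta> \<Longrightarrow> \<bar>\<Sum>j<N. d j * t ^ j\<bar> \<le> K * t ^ N" "j < N"
  shows "d j = 0"
  using assms
proof (induction N arbitrary: d j)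
  case (Suc N)
  have ev: "\<forall>\<^sub>F t in at_right 0. \<bar>\<Sum>j<Suc N. d j * t ^ j\<bar> \<le> K * t ^ Suc N"
    unfolding eventually_at_right_field using Suc.prems(1,2) by (intro exI[of _ \<delta>]) auto
  have "((\<lambda>t. \<Sum>j<Suc N. d j * t ^ j) \<longlongrightarrow> (\<Sum>j<Suc N. d j * 0 ^ j)) (at_right 0)"
    by (intro tendsto_intros)
  moreover have "(\<Sum>j<Suc N. d j * 0 ^ j) = d 0"
    by (subst sum.lessThan_Suc_shift) simp
  ultimately have "((\<lambda>t. \<bar>\<Sum>j<Suc N. d j * t ^ j\<bar>) \<longlongrightarrow> \<bar>d 0\<bar>) (at_right 0)"
    by (intro tendsto_rabs) simp
  moreover have "((\<lambda>t. K * t ^ Suc N) \<longlongrightarrow> K * 0 ^ Suc N) (at_right 0)" by (intro tendsto_intros)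
  ultimately have "\<bar>d 0\<bar> \<le> K * 0 ^ Suc N"
    using tendsto_le[OF trivial_limit_at_right_real _ _ ev] by blast
  then have d0: "d 0 = 0" by simp
  have "\<bar>\<Sum>j<N. d (Suc j) * t ^ j\<bar> \<le> K * t ^ N" if "0 < t" "t \<le> \<delta>" for t
  proof -
    have "(\<Sum>j<Suc N. d j * t ^ j) = t * (\<Sum>j<N. d (Suc j) * t ^ j)"
      by (subst sum.lessThan_Suc_shift) (simp add: d0 sum_distrib_left mult_ac)
    then have "t * \<bar>\<Sum>j<N. d (Suc j) * t ^ j\<bar> \<le> t * (K * t ^ N)"
      using Suc.prems(2)[OF that] that by (simp add: abs_mult mult_ac)
    then show ?thesis using that by simp
  qed
  then have "d (Suc i) = 0" if "i < N" for i using Suc.IH[OF Suc.prems(1), of "\<lambda>i. d (Suc i)" i] that by blast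
  then show ?case using d0 Suc.prems(3) by (cases j) auto
qed simp

text \<open>Coefficients are recognised pointwise, from an estimate along a single ray whose
  constants may depend on \<open>p\<close>. This is how the coefficients of series and of flow
  integrals are found.\<close>

lemma tcoeff_unique:
  assumes h: "smooth h" and \<delta>: "0 < \<delta>"
    and b: "\<And>t. 0 < t \<Longrightarrow> t \<le> \<delta> \<Longrightarrow> \<bar>h (cscale B t p) - (\<Sum>j<N. c j * t ^ j)\<bar> \<le> K * t ^ N" and "j < N"
  shows "tcoeff B j h p = c j"
proof -
  obtain K' where K': "\<And>t. t \<in> {0..\<delta>} \<Longrightarrow> \<bar>trem B N h (t, p)\<bar> \<le> K'"
    using smooth_section_bounded[OF smooth_trem[OF h]] by metis
  have "\<bar>\<Sum>j<N. (tcoeff B j h p - c j) * t ^ j\<bar> \<le> (K + K') * t ^ N" if t: "0 < t" "t \<le> \<delta>" for t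
  proof -
    have "(\<Sum>j<N. (tcoeff B j h p - c j) * t ^ j) = (h (cscale B t p) - (\<Sum>j<N. c j * t ^ j)) - t ^ N * trem B N h (t, p)"
      using tcoeff_expand[OF h, of B t p N] by (simp add: sum_subtractf algebra_simps)
    moreover have "\<bar>t ^ N * trem B N h (t, p)\<bar> \<le> K' * t ^ N"
      using K'[of t] t by (simp add: abs_mult mult.commute)
    ultimately show ?thesis using b[OF t] by (simp add: algebra_simps)
  qed
  from power_sum_coeff_zero[OF \<delta> this \<open>j < N\<close>] show ?thesis by simp
qed

text \<open>A smooth remainder is bounded on a compact interval, which supplies the constant. The
  factor \<open>s\<close> serves the rescaled ray in \<open>tcoeff_homog\<close>; elsewhere
  \<open>s = 1\<close>.\<close>

lemma tcoeff_unique':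
  assumes h: "smooth h" and \<Psi>: "smooth \<Psi>"
    and b: "\<And>t. 0 < t \<Longrightarrow> t \<le> 1 \<Longrightarrow> h (cscale B t p) = (\<Sum>j<N. c j * t ^ j) + t ^ N * \<Psi> (s * t, q)" and "j < N"
  shows "tcoeff B j h p = c j"
proof -
  obtain K where K: "\<And>t. t \<in> {-\<bar>s\<bar>..\<bar>s\<bar>} \<Longrightarrow> \<bar>\<Psi> (t, q)\<bar> \<le> K"
    using smooth_section_bounded[OF \<Psi>] by metis
  have "\<bar>h (cscale B t p) - (\<Sum>j<N. c j * t ^ j)\<bar> \<le> K * t ^ N" if t: "0 < t" "t \<le> 1" for t
  proof -
    have "\<bar>s * t\<bar> \<le> \<bar>s\<bar>" using t by (simp add: abs_mult mult_left_le)
    then have "\<bar>\<Psi> (s * t, q)\<bar> \<le> K" by (intro K) (auto simp: abs_le_iff)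
    then show ?thesis using t b[OF t] by (simp add: abs_mult mult.commute)
  qed
  from tcoeff_unique[OF h zero_less_one this \<open>j < N\<close>] show ?thesis .
qed

lemma tcoeff_homog:
  assumes h: "smooth h" shows "tcoeff B j h (cscale B s p) = s ^ j * tcoeff B j h p"
proof (rule tcoeff_unique'[OF h, where N = "Suc j" and s = s and q = p])
  show "smooth (\<lambda>z. s ^ Suc j * trem B (Suc j) h z)"
    using smooth_trem[OF h] by (intro smooth_on_mult smooth_on_const) auto
  show "h (cscale B t (cscale B s p)) = (\<Sum>j<Suc j. (s ^ j * tcoeff B j h p) * t ^ j) + t ^ Suc j * (s ^ Suc j * trem B (Suc j) h (s * t, p))" for t
    using tcoeff_expand[OF h, of B "t * s" p "Suc j"]
    by (simp add: cscale_cscale power_mult_distrib mult_ac del: sum.lessThan_Suc)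
qed simp

lemma tcoeff_linear_comp:
  assumes h: "smooth h" and M: "linear M" "\<And>t q. M (cscale B t q) = cscale B t (M q)"
  shows "tcoeff B j (\<lambda>q. h (M q)) p = tcoeff B j h (M p)"
  by (rule tcoeff_unique'[OF smooth_linear_comp[OF M(1) h] smooth_trem[OF h], where N = "Suc j" and s = 1 and q = "M p"])
     (simp_all add: M(2) tcoeff_expand[OF h, where N="Suc j"] del: sum.lessThan_Suc)

text \<open>Partial contractions map a ball about 0 into itself, so a coefficient at
  \<open>p\<close> sees only values on that ball. This makes Taylor coefficients usable for
  germs.\<close>

lemma tcoeff_cong:
  assumes h: "smooth h" "smooth k" and e: "\<And>q. q \<in> ball 0 \<epsilon> \<Longrightarrow> h q = k q" and p: "p \<in> ball 0 \<epsilon>"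
  shows "tcoeff B j h p = tcoeff B j k p"
proof (rule tcoeff_unique'[OF h(1) smooth_trem[OF h(2)], where N = "Suc j" and s = 1 and q = p])
  fix t :: real assume t: "0 < t" "t \<le> 1"
  have "cscale B t p \<in> ball 0 \<epsilon>" using norm_cscale_le[of t B p] t p by auto
  then show "h (cscale B t p) = (\<Sum>j<Suc j. tcoeff B j k p * t ^ j) + t ^ Suc j * trem B (Suc j) k (1 * t, p)"
    using e tcoeff_expand[OF h(2), where N="Suc j"] by simp
qed simp

lemma tcoeff_add:
  assumes h: "smooth h" "smooth k" shows "tcoeff B j (\<lambda>q. h q + k q) p = tcoeff B j h p + tcoeff B j k p"
proof (rule tcoeff_unique'[where N = "Suc j" and s = 1 and q = p and \<Psi> = "\<lambda>z. trem B (Suc j) h z + trem B (Suc j) k z"])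
  fix t :: real assume t: "0 < t" "t \<le> 1"
  show "h (cscale B t p) + k (cscale B t p) = (\<Sum>j<Suc j. (tcoeff B j h p + tcoeff B j k p) * t ^ j) + 
     t ^ Suc j * (trem B (Suc j) h (1 * t, p) + trem B (Suc j) k (1 * t, p))"
    using tcoeff_expand[OF h(1), where N="Suc j"] tcoeff_expand[OF h(2), where N="Suc j"]
    by (simp add: algebra_simps sum.distrib del: sum.lessThan_Suc)
qed (intro smooth_intros smooth_trem h | simp)+

lemma tcoeff_cmult:
  assumes h: "smooth h" shows "tcoeff B j (\<lambda>q. c * h q) p = c * tcoeff B j h p"
proof (rule tcoeff_unique'[where N = "Suc j" and s = 1 and q = p and \<Psi> = "\<lambda>z. c * trem B (Suc j) h z"])
  fix t :: real assume t: "0 < t" "t \<le> 1"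
  show "c * h (cscale B t p) = (\<Sum>j<Suc j. (c * tcoeff B j h p) * t ^ j) + t ^ Suc j * (c * trem B (Suc j) h (1 * t, p))"
    using tcoeff_expand[OF h, where N="Suc j"]
    by (simp add: algebra_simps sum_distrib_left del: sum.lessThan_Suc)
qed (intro smooth_intros smooth_trem h | simp)+

lemma tcoeff_diff:
  assumes h: "smooth h" "smooth k" shows "tcoeff B j (\<lambda>q. h q - k q) p = tcoeff B j h p - tcoeff B j k p"
proof -
  have "smooth (\<lambda>q. (-1) * k q)" using h(2) by (intro smooth_on_mult smooth_on_const) auto
  from tcoeff_add[OF h(1) this, of B j p] tcoeff_cmult[OF h(2), of B j "-1" p] show ?thesis by simp
qed

lemma tcoeff_zero: "tcoeff B j (\<lambda>_. 0) p = 0"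
proof -
  have "smooth (\<lambda>_::'a. 0)" by auto
  from tcoeff_cmult[OF this, of B j 0 p] show ?thesis by simp
qed

text \<open>Since \<open>L\<close> commutes with the dilations, it may be applied to the expansion
  term by term, and the derivative of the remainder is again smooth in \<open>t\<close>.\<close>

lemma tcoeff_vf:
  assumes h: "smooth h" and L: "linear L" "\<And>t q. L (cscale B t q) = cscale B t (L q)"
  shows "tcoeff B j (vf_apply L h) p = vf_apply L (tcoeff B j h) p"
proof (rule tcoeff_unique'[OF smooth_vf_apply[OF L(1) h], where N = "Suc j" and s = 1 and q = p])
  let ?\<Psi> = "trem B (Suc j) h"
  show "smooth (\<lambda>z. \<Sum>b\<in>Basis. (L p \<bullet> b) * dpartial (0, b) ?\<Psi> z)"
    using smooth_dpartial[OF smooth_trem[OF h] pair_Basis(1)]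
    by (intro smooth_on_sum smooth_on_mult smooth_on_const) auto
  fix t :: real
  have s: "smooth (\<lambda>q. tcoeff B j h q * t ^ j)" for j
    using smooth_tcoeff[OF h] by (intro smooth_on_mult smooth_on_const) auto
  have s2: "smooth (\<lambda>q. t ^ Suc j * ?\<Psi> (t, q))"
    using smooth_section[OF smooth_trem[OF h]] by (intro smooth_on_mult smooth_on_const) auto
  have "vf_apply L h (cscale B t p) = vf_apply L (\<lambda>q. h (cscale B t q)) p"
    using vf_apply_linear_comp[of "cscale B t" h p L, OF linear_cscale smooth_differentiable[OF h] L(2)] by simp
  also have "(\<lambda>q. h (cscale B t q)) = (\<lambda>q. (\<Sum>j<Suc j. tcoeff B j h q * t ^ j) + t ^ Suc j * ?\<Psi> (t, q))"
    using tcoeff_expand[OF h, where N = "Suc j"] by blast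
  also have "vf_apply L \<dots> p = vf_apply L (\<lambda>q. \<Sum>j<Suc j. tcoeff B j h q * t ^ j) p + vf_apply L (\<lambda>q. t ^ Suc j * ?\<Psi> (t, q)) p"
    using s s2 by (intro vf_apply_add smooth_differentiable) (auto simp del: sum.lessThan_Suc)
  also have "vf_apply L (\<lambda>q. \<Sum>j<Suc j. tcoeff B j h q * t ^ j) p = (\<Sum>j<Suc j. vf_apply L (\<lambda>q. tcoeff B j h q * t ^ j) p)"
    using s by (intro vf_apply_sum smooth_differentiable) auto
  also have "\<dots> = (\<Sum>j<Suc j. vf_apply L (tcoeff B j h) p * t ^ j)"
    by (intro sum.cong refl, subst vf_apply_mult) (auto intro!: smooth_differentiable smooth_tcoeff[OF h])
  also have "vf_apply L (\<lambda>q. t ^ Suc j * ?\<Psi> (t, q)) p = t ^ Suc j * (\<Sum>b\<in>Basis. (L p \<bullet> b) * dpartial (0, b) ?\<Psi> (t, p))"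
    using vf_apply_section[OF smooth_trem[OF h], of L B "Suc j" t p]
    by (subst vf_apply_mult) (auto intro!: smooth_differentiable smooth_section[OF smooth_trem[OF h]])
  finally show "vf_apply L h (cscale B t p) = (\<Sum>j<Suc j. vf_apply L (tcoeff B j h) p * t ^ j) + 
     t ^ Suc j * (\<Sum>b\<in>Basis. (L p \<bullet> b) * dpartial (0, b) ?\<Psi> (1 * t, p))"
    by simp
qed simp

lemma cscale_curve: "((\<lambda>t. cscale B t p) has_derivative (\<lambda>s. s *\<^sub>R cproj B p)) (at t)"
  unfolding cscale_def by (auto intro!: derivative_eq_intros)

lemma curve_derivative:
  fixes h :: "'a::euclidean_space \<Rightarrow> real"
  assumes "smooth h" "(\<gamma> has_derivative (\<lambda>s. s *\<^sub>R v)) (at t)" "v = L (\<gamma> t)"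
  shows "((\<lambda>t. h (\<gamma> t)) has_real_derivative vf_apply L h (\<gamma> t)) (at t)"
proof -
  have l: "linear (frechet_derivative h (at (\<gamma> t)))"
    using linear_frechet_derivative smooth_differentiable[OF assms(1)] by blast
  from has_derivative_compose[OF assms(2) smooth_has_derivative[OF assms(1)]]
  have "((\<lambda>t. h (\<gamma> t)) has_derivative (\<lambda>s. frechet_derivative h (at (\<gamma> t)) (s *\<^sub>R v))) (at t)" .
  then show ?thesis unfolding has_field_derivative_def
    by (simp add: linear_scale[OF l] vf_apply_def assms(3) mult_commute_abs)
qed

text \<open>Euler's identity: differentiate the homogeneity relation at
  \<open>t = 1\<close>.\<close>

lemma euler_homog:
  fixes h :: "'a::euclidean_space \<Rightarrow> real"
  assumes h: "smooth h" "\<And>t. h (cscale B t p) = t ^ l * h p"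
  shows "vf_apply (cproj B) h p = real l * h p"
proof -
  have "((\<lambda>t. h (cscale B t p)) has_real_derivative vf_apply (cproj B) h (cscale B 1 p)) (at 1)"
    by (rule curve_derivative[OF h(1) cscale_curve]) simp
  moreover have "((\<lambda>t. t ^ l * h p) has_real_derivative real l * h p) (at 1)"
    by (auto intro!: derivative_eq_intros)
  ultimately show ?thesis using h(2) DERIV_unique by fastforce
qed

text \<open>Away from \<open>s = 0\<close> the remainder is an explicit quotient and inherits every
  symmetry of \<open>h\<close>. In the integrals over \<open>s\<close> below, the point 0 is a null
  set.\<close>

lemma trem_eq:
  assumes "smooth h" "s \<noteq> 0"
  shows "trem B N h (s, p) = (h (cscale B s p) - (\<Sum>j<N. tcoeff B j h p * s ^ j)) / s ^ N"
  using tcoeff_expand[OF assms(1), of B s p N] assms(2) by (simp add: field_simps)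

lemma trem_homog:
  assumes "smooth h" "s \<noteq> 0" "u \<noteq> 0"
  shows "trem B N h (s, cscale B u p) = u ^ N * trem B N h (s * u, p)"
  using assms by (simp add: trem_eq cscale_cscale tcoeff_homog power_mult_distrib mult_ac)

lemma trem_linear_comp:
  assumes h: "smooth h" and M: "linear M" "\<And>t q. M (cscale B t q) = cscale B t (M q)" and s: "s \<noteq> 0"
    and c: "\<And>q. h (M q) = c * h q"
  shows "tcoeff B j h (M p) = c * tcoeff B j h p" "trem B N h (s, M p) = c * trem B N h (s, p)"
proof -
  show t: "tcoeff B j h (M p) = c * tcoeff B j h p" for j
    using tcoeff_linear_comp[OF h M, of j p] tcoeff_cmult[OF h, of B j c p] by (simp add: c)
  show "trem B N h (s, M p) = c * trem B N h (s, p)"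
    using h s by (simp add: trem_eq t M(2)[symmetric] c right_diff_distrib sum_distrib_left mult_ac)
qed

lemma trem_vf_zero:
  assumes h: "smooth h" and L: "linear L" "\<And>t q. L (cscale B t q) = cscale B t (L q)" and s: "s \<noteq> 0" "\<bar>s\<bar> \<le> 1"
    and z: "\<And>q. q \<in> ball 0 \<epsilon> \<Longrightarrow> vf_apply L h q = 0" and p: "p \<in> ball 0 \<epsilon>"
  shows "vf_apply L (tcoeff B j h) p = 0" "vf_apply L (\<lambda>q. trem B N h (s, q)) p = 0"
proof -
  have "tcoeff B j (vf_apply L h) p = tcoeff B j (\<lambda>_. 0) p" for j
    by (rule tcoeff_cong[OF smooth_vf_apply[OF L(1) h] smooth_on_const[OF open_UNIV] _ p]) (use z in auto)
  then show t: "vf_apply L (tcoeff B j h) p = 0" for j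
    by (simp add: tcoeff_vf[OF h L] tcoeff_zero)
  have "cscale B s p \<in> ball 0 \<epsilon>" using norm_cscale_le[OF s(2)] p by (auto intro: le_less_trans)
  then have hz: "vf_apply L (\<lambda>q. h (cscale B s q)) p = 0"
    using vf_apply_linear_comp[of "cscale B s" h p L, OF linear_cscale smooth_differentiable[OF h] L(2)] z by simp
  have tz: "vf_apply L (\<lambda>q. \<Sum>j<N. tcoeff B j h q * s ^ j) p = 0"
    by (subst vf_apply_sum) (auto intro!: smooth_differentiable smooth_on_mult smooth_tcoeff[OF h] simp: vf_apply_mult t smooth_differentiable[OF smooth_tcoeff[OF h]])
  have e: "(\<lambda>q. trem B N h (s, q)) = (\<lambda>q. (1 / s ^ N) * (h (cscale B s q) - (\<Sum>j<N. tcoeff B j h q * s ^ j)))"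
    using trem_eq[OF h s(1)] by auto
  have d: "(\<lambda>q. h (cscale B s q)) differentiable at p" "(\<lambda>q. \<Sum>j<N. tcoeff B j h q * s ^ j) differentiable at p"
    using smooth_cscale[OF h] smooth_tcoeff[OF h] by (auto intro!: smooth_differentiable smooth_on_sum smooth_on_mult)
  show "vf_apply L (\<lambda>q. trem B N h (s, q)) p = 0"
    unfolding e using d by (subst vf_apply_mult) (auto simp: vf_apply_diff hz tz)
qed

text \<open>With \<open>E\<close> the Euler field of the coordinates in \<open>B\<close>, a solution of \<open>l u - E u = h - tcoeff B l h\<close>:
  a term of degree \<open>k < l\<close> is divided by \<open>l - k\<close>, and on the terms of degree \<open>k > l\<close> the integral of
  \<open>s\<close> to the power \<open>k - l - 1\<close> supplies the divisor.\<close>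

definition euler_inv :: "'a::euclidean_space set \<Rightarrow> nat \<Rightarrow> ('a \<Rightarrow> real) \<Rightarrow> 'a \<Rightarrow> real" where
  "euler_inv B l h p = (\<Sum>k<l. tcoeff B k h p * (1 / (real l - real k))) - integral {0..1} (\<lambda>s. trem B (Suc l) h (s, p))"

lemma smooth_euler_inv: "smooth h \<Longrightarrow> smooth (euler_inv B l h)"
  unfolding euler_inv_def
  by (intro smooth_on_diff smooth_on_sum smooth_on_mult smooth_integral) (auto intro: smooth_tcoeff smooth_trem)

lemma euler_inv_eq:
  assumes h: "smooth h"
  shows "vf_apply (cproj B) (euler_inv B l h) p = real l * euler_inv B l h p - (h p - tcoeff B l h p)"
proof -
  let ?\<Psi> = "trem B (Suc l) h"
  let ?I = "\<lambda>p. integral {0..1} (\<lambda>s. ?\<Psi> (s, p))"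
  have \<Psi>: "smooth ?\<Psi>" using smooth_trem[OF h] .
  have eu: "vf_apply (cproj B) (tcoeff B k h) p = real k * tcoeff B k h p" for k
    by (rule euler_homog[OF smooth_tcoeff[OF h] tcoeff_homog[OF h]])
  define w where "w s = vf_apply (cproj B) (\<lambda>q. ?\<Psi> (s, q)) p" for s
  have wI: "w integrable_on {0..1}"
  proof -
    have "smooth (\<lambda>z. \<Sum>b\<in>Basis. (cproj B p \<bullet> b) * dpartial (0, b) ?\<Psi> z)"
      using smooth_dpartial[OF \<Psi> pair_Basis(1)] by (intro smooth_on_sum smooth_on_mult smooth_on_const) auto
    from section_continuous[OF this, of "{0..1}" p] show ?thesis
      unfolding w_def vf_apply_section[OF \<Psi>] by (intro integrable_continuous_real)
  qed
  have \<Psi>I: "(\<lambda>s. ?\<Psi> (s, p)) integrable_on {0..1}"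
    using section_continuous[OF \<Psi>] by (intro integrable_continuous_real)
  \<comment> \<open>Differentiating the homogeneity of the remainder at \<open>u = 1\<close> shows
    that the Euler field acts on it as \<open>l + 1 + s d/ds\<close>, that is, as \<open>l\<close>
    plus the \<open>s\<close>-derivative of \<open>s\<close> times the remainder. The latter
    integrates to the boundary value at \<open>s = 1\<close>.\<close>
  have w: "w s = real l * ?\<Psi> (s, p) + (?\<Psi> (s, p) + s * dpartial (1, 0) ?\<Psi> (s, p))" if "0 < s" for s
  proof -
    have "((\<lambda>u. ?\<Psi> (s, cscale B u p)) has_real_derivative vf_apply (cproj B) (\<lambda>q. ?\<Psi> (s, q)) (cscale B 1 p)) (at 1)"
      by (rule curve_derivative[OF smooth_section[OF \<Psi>] cscale_curve]) simp
    then have "((\<lambda>u. u ^ Suc l * ?\<Psi> (s * u, p)) has_real_derivative w s) (at 1)"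
      unfolding w_def cscale_1
      by (rule has_field_derivative_transform_within_open[where S="{0<..}"])
         (use that trem_homog[OF h] in auto)
    moreover have "((\<lambda>u. u ^ Suc l * ?\<Psi> (s * u, p)) has_real_derivative
       real (Suc l) * ?\<Psi> (s, p) + dpartial (1, 0) ?\<Psi> (s * 1, p) * s) (at 1)"
    proof -
      have c: "((\<lambda>u. ?\<Psi> (s * u, p)) has_real_derivative dpartial (1, 0) ?\<Psi> (s * 1, p) * s) (at 1)"
        by (rule DERIV_chain2[OF section_has_real_derivative[OF \<Psi>]]) (auto intro!: derivative_eq_intros)
      show ?thesis by (rule derivative_eq_intros c refl | simp)+
    qed
    ultimately have "w s = real (Suc l) * ?\<Psi> (s, p) + dpartial (1, 0) ?\<Psi> (s * 1, p) * s"
      by (rule DERIV_unique)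
    then show ?thesis by (simp add: algebra_simps)
  qed
  have "((\<lambda>s. w s - real l * ?\<Psi> (s, p)) has_integral (1 * ?\<Psi> (1, p) - 0 * ?\<Psi> (0, p))) {0..1}"
  proof (rule fundamental_theorem_of_calculus_interior)
    show "continuous_on {0..1} (\<lambda>s. s * ?\<Psi> (s, p))"
      by (intro continuous_intros section_continuous[OF \<Psi>])
    fix s :: real assume s: "s \<in> {0<..<1}"
    have "((\<lambda>s. s * ?\<Psi> (s, p)) has_real_derivative ?\<Psi> (s, p) + s * dpartial (1, 0) ?\<Psi> (s, p)) (at s)"
      by (rule derivative_eq_intros section_has_real_derivative[OF \<Psi>] refl | simp)+
    then show "((\<lambda>s. s * ?\<Psi> (s, p)) has_vector_derivative w s - real l * ?\<Psi> (s, p)) (at s)"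
      using w[of s] s by (simp add: has_real_derivative_iff_has_vector_derivative)
  qed simp
  from integral_unique[OF this] have "integral {0..1} w - real l * ?I p = ?\<Psi> (1, p)"
    using integral_diff[OF wI integrable_on_mult_right[OF \<Psi>I, of "real l"]] by simp
  moreover have "vf_apply (cproj B) ?I p = integral {0..1} w"
    unfolding w_def by (rule vf_apply_integral[OF \<Psi>])
  moreover have "?\<Psi> (1, p) = h p - (\<Sum>j<Suc l. tcoeff B j h p)"
    using trem_eq[OF h, of 1 B "Suc l" p] by simp
  ultimately have I: "vf_apply (cproj B) ?I p = real l * ?I p + h p - (\<Sum>j<Suc l. tcoeff B j h p)" by linarith
  have d: "(\<lambda>p. tcoeff B k h p * (1 / (real l - real k))) differentiable at p" for k
    by (intro smooth_differentiable smooth_on_mult smooth_tcoeff[OF h] smooth_on_const) auto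
  have "vf_apply (cproj B) (\<lambda>p. \<Sum>k<l. tcoeff B k h p * (1 / (real l - real k))) p =
      (\<Sum>k<l. vf_apply (cproj B) (\<lambda>p. tcoeff B k h p * (1 / (real l - real k))) p)"
    by (rule vf_apply_sum) (use d in auto)
  also have "\<dots> = (\<Sum>k<l. real k * tcoeff B k h p * (1 / (real l - real k)))"
    by (intro sum.cong refl, subst vf_apply_mult) (auto intro!: smooth_differentiable smooth_tcoeff[OF h] simp: eu)
  \<comment> \<open>This is \<open>k / (l - k) = l / (l - k) - 1\<close>.\<close>
  also have "\<dots> = (\<Sum>k<l. real l * (tcoeff B k h p * (1 / (real l - real k))) - tcoeff B k h p)"
    by (intro sum.cong refl) (simp add: field_simps)
  finally have S: "vf_apply (cproj B) (\<lambda>p. \<Sum>k<l. tcoeff B k h p * (1 / (real l - real k))) p =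
      real l * (\<Sum>k<l. tcoeff B k h p * (1 / (real l - real k))) - (\<Sum>k<l. tcoeff B k h p)"
    by (simp add: sum_subtractf sum_distrib_left)
  have "vf_apply (cproj B) (euler_inv B l h) p = vf_apply (cproj B) (\<lambda>p. \<Sum>k<l. tcoeff B k h p * (1 / (real l - real k))) p - vf_apply (cproj B) ?I p"
    unfolding euler_inv_def
    by (rule vf_apply_diff; intro smooth_differentiable smooth_integral \<Psi> smooth_intros smooth_tcoeff[OF h])
  then show ?thesis unfolding S I by (simp add: euler_inv_def algebra_simps)
qed

text \<open>With \<open>M\<close> a dilation in the other block of coordinates, this shows that
  solving in one block preserves homogeneity in the other.\<close>

lemma euler_inv_linear_comp:
  assumes h: "smooth h" and M: "linear M" "\<And>t q. M (cscale B t q) = cscale B t (M q)"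
    and c: "\<And>q. h (M q) = c * h q"
  shows "euler_inv B l h (M p) = c * euler_inv B l h p"
proof -
  have "integral {0..1} (\<lambda>s. trem B (Suc l) h (s, M p)) = integral {0..1} (\<lambda>s. c * trem B (Suc l) h (s, p))"
    by (rule integral_spike[of "{0}"]) (auto simp: trem_linear_comp(2)[OF h M _ c])
  then show ?thesis
    by (simp add: euler_inv_def trem_linear_comp(1)[OF h M _ c, of 1] right_diff_distrib sum_distrib_left mult_ac)
qed

lemma euler_inv_vf_zero:
  assumes h: "smooth h" and L: "linear L" "\<And>t q. L (cscale B t q) = cscale B t (L q)"
    and z: "\<And>q. q \<in> ball 0 \<epsilon> \<Longrightarrow> vf_apply L h q = 0" and p: "p \<in> ball 0 \<epsilon>"
  shows "vf_apply L (euler_inv B l h) p = 0"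
proof -
  note T = trem_vf_zero[OF h L _ _ z p]
  have "vf_apply L (\<lambda>p. integral {0..1} (\<lambda>s. trem B (Suc l) h (s, p))) p = integral {0..1} (\<lambda>s. vf_apply L (\<lambda>q. trem B (Suc l) h (s, q)) p)"
    by (rule vf_apply_integral[OF smooth_trem[OF h]])
  also have "\<dots> = integral {0..1} (\<lambda>s::real. 0::real)"
    by (rule integral_spike[of "{0}"]) (use T(2) in auto)
  finally have I: "vf_apply L (\<lambda>p. integral {0..1} (\<lambda>s. trem B (Suc l) h (s, p))) p = 0" by simp
  have "vf_apply L (\<lambda>p. tcoeff B k h p * c) p = 0" for k c
    using T(1)[of 1 k] vf_apply_mult[OF smooth_differentiable[OF smooth_tcoeff[OF h]], of "\<lambda>_. c" p L B k] by simp
  then have S: "vf_apply L (\<lambda>p. \<Sum>k<l. tcoeff B k h p * (1 / (real l - real k))) p = 0"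
    using vf_apply_sum[of "{..<l}" "\<lambda>k p. tcoeff B k h p * (1 / (real l - real k))" p L]
    by (simp add: smooth_differentiable smooth_on_mult smooth_tcoeff[OF h] smooth_on_const del: times_divide_eq_right)
  have "vf_apply L (euler_inv B l h) p = vf_apply L (\<lambda>p. \<Sum>k<l. tcoeff B k h p * (1 / (real l - real k))) p
      - vf_apply L (\<lambda>p. integral {0..1} (\<lambda>s. trem B (Suc l) h (s, p))) p"
    unfolding euler_inv_def
    by (rule vf_apply_diff; intro smooth_differentiable smooth_integral smooth_trem smooth_intros smooth_tcoeff h)
  then show ?thesis using S I by simp
qed

section \<open>Smooth series\<close>

lemma smooth_foldr: "smooth u \<Longrightarrow> set bs \<subseteq> Basis \<Longrightarrow> smooth (iter_dpartial bs u)"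
  by (induction bs) (auto intro: smooth_dpartial)

lemma iter_dpartial_cong:
  assumes "open S" "\<And>y. y \<in> S \<Longrightarrow> f y = g y"
  shows "x \<in> S \<Longrightarrow> iter_dpartial bs f x = iter_dpartial bs g x"
proof (induction bs arbitrary: x)
  case (Cons b bs)
  then show ?case using dpartial_cong[OF assms(1), of x "iter_dpartial bs f" "iter_dpartial bs g" b] by simp
qed (use assms in simp)

lemma iter_dpartial_zero: "iter_dpartial bs (\<lambda>_. 0) = (\<lambda>_. 0)"
  by (induction bs) (auto simp: dpartial_def)

lemma iter_dpartial_eq_0:
  assumes "open S" "\<And>y. y \<in> S \<Longrightarrow> f y = 0" "x \<in> S"
  shows "iter_dpartial bs f x = 0"
  using iter_dpartial_cong[of S f "\<lambda>_. 0" x bs] assms by (simp add: iter_dpartial_zero)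

lemma dpartial_cmult:
  fixes f :: "'a::euclidean_space \<Rightarrow> real"
  assumes "smooth f" shows "dpartial b (\<lambda>x. c * f x) p = c * dpartial b f p"
  using dpartial_mult[of "\<lambda>_. c" p f b] smooth_differentiable[OF assms, of p] by (simp add: dpartial_def)

lemma iter_dpartial_cmult:
  fixes f :: "'a::euclidean_space \<Rightarrow> real"
  assumes "smooth f" "set bs \<subseteq> Basis"
  shows "iter_dpartial bs (\<lambda>x. c * f x) = (\<lambda>p. c * iter_dpartial bs f p)"
  using assms(2)
proof (induction bs)
  case (Cons b bs)
  have "smooth (iter_dpartial bs f)" using smooth_foldr[OF assms(1)] Cons.prems by simp
  moreover have IH: "iter_dpartial bs (\<lambda>x. c * f x) = (\<lambda>p. c * iter_dpartial bs f p)" using Cons by simp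
  ultimately show ?case by (intro ext) (simp add: IH dpartial_cmult)
qed simp

lemma cscale_Basis: "b \<in> Basis \<Longrightarrow> cscale B t b = (if b \<in> B then t else 1) *\<^sub>R b"
  by (subst euclidean_eq_iff) (simp add: cscale_inner inner_Basis)

lemma dpartial_cscale:
  fixes f :: "'a::euclidean_space \<Rightarrow> real"
  assumes "smooth f" "b \<in> Basis"
  shows "dpartial b (\<lambda>x. f (cscale B t x)) p = (if b \<in> B then t else 1) * dpartial b f (cscale B t p)"
proof -
  have l: "linear (frechet_derivative f (at (cscale B t p)))"
    using linear_frechet_derivative smooth_differentiable[OF assms(1)] by blast
  have "(cscale B t has_derivative cscale B t) (at p)"
    using linear_cscale linear_conv_bounded_linear bounded_linear_imp_has_derivative by blast
  from dpartial_eqI[OF has_derivative_compose[OF this smooth_has_derivative[OF assms(1)]], of b]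
  show ?thesis by (simp only: cscale_Basis[OF assms(2)] linear_scale[OF l] dpartial_def real_scaleR_def)
qed

text \<open>Each derivative along \<open>B\<close> costs one factor \<open>t\<close>. These powers
  are weighed against homogeneity in Borel summation and against flatness along the flow.\<close>

lemma iter_dpartial_cscale:
  fixes f :: "'a::euclidean_space \<Rightarrow> real"
  assumes "smooth f" "set bs \<subseteq> Basis"
  shows "iter_dpartial bs (\<lambda>x. f (cscale B t x)) =
    (\<lambda>p. t ^ length (filter (\<lambda>b. b \<in> B) bs) * iter_dpartial bs f (cscale B t p))"
  using assms(2)
proof (induction bs)
  case (Cons b bs)
  have s: "smooth (iter_dpartial bs f)" using smooth_foldr[OF assms(1)] Cons.prems by simp
  have IH: "iter_dpartial bs (\<lambda>x. f (cscale B t x)) =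
    (\<lambda>p. t ^ length (filter (\<lambda>b. b \<in> B) bs) * iter_dpartial bs f (cscale B t p))" using Cons by simp
  have "b \<in> Basis" using Cons.prems by simp
  then show ?case
    by (intro ext) (simp add: IH dpartial_cmult[OF smooth_cscale[OF s]] dpartial_cscale[OF s])
qed simp

lemma iter_dpartial_section:
  fixes \<Phi> :: "real \<times> 'a::euclidean_space \<Rightarrow> real"
  assumes "smooth \<Phi>" "set bs \<subseteq> Basis"
  shows "iter_dpartial bs (\<lambda>q. \<Phi> (t, q)) = (\<lambda>p. iter_dpartial (map (Pair 0) bs) \<Phi> (t, p))"
  using assms(2)
proof (induction bs)
  case (Cons b bs)
  have "smooth (iter_dpartial (map (Pair 0) bs) \<Phi>)"
    using Cons.prems pair_Basis(1) by (intro smooth_foldr[OF assms(1)]) auto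
  moreover have IH: "iter_dpartial bs (\<lambda>q. \<Phi> (t, q)) = (\<lambda>p. iter_dpartial (map (Pair 0) bs) \<Phi> (t, p))"
    using Cons by simp
  ultimately show ?case by (intro ext) (simp add: IH dpartial_section)
qed simp

text \<open>The Weierstrass test for every iterated partial on every ball. The bound may start at an
  index depending on both, because a Borel series is controlled only once \<open>m\<close> exceeds
  the number of derivatives and the radius.\<close>

definition smooth_summable :: "(nat \<Rightarrow> 'a::euclidean_space \<Rightarrow> real) \<Rightarrow> bool" where
  "smooth_summable u \<longleftrightarrow> (\<forall>n. smooth (u n)) \<and> (\<forall>bs R. set bs \<subseteq> Basis \<longrightarrow>
     (\<exists>M N. summable M \<and> (\<forall>n\<ge>N. \<forall>p\<in>ball 0 R. \<bar>iter_dpartial bs (u n) p\<bar> \<le> M n)))"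

lemma smooth_summable_dpartial: "smooth_summable u \<Longrightarrow> b \<in> Basis \<Longrightarrow> smooth_summable (\<lambda>n. dpartial b (u n))"
  unfolding smooth_summable_def
proof (intro conjI allI impI)
  fix bs :: "'a list" and R
  assume S: "(\<forall>n. smooth (u n)) \<and> (\<forall>bs R. set bs \<subseteq> Basis \<longrightarrow>
     (\<exists>M N. summable M \<and> (\<forall>n\<ge>N. \<forall>p\<in>ball 0 R. \<bar>iter_dpartial bs (u n) p\<bar> \<le> M n)))"
    and b: "b \<in> Basis"
  show "smooth (dpartial b (u n))" for n using S b smooth_dpartial by blast
  assume "set bs \<subseteq> Basis"
  then have "set (bs @ [b]) \<subseteq> Basis" using b by simp
  then have "\<exists>M N. summable M \<and> (\<forall>n\<ge>N. \<forall>p\<in>ball 0 R. \<bar>iter_dpartial (bs @ [b]) (u n) p\<bar> \<le> M n)"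
    using S by blast
  then show "\<exists>M N. summable M \<and> (\<forall>n\<ge>N. \<forall>p\<in>ball 0 R. \<bar>iter_dpartial bs (dpartial b (u n)) p\<bar> \<le> M n)"
    by simp
qed

lemma smooth_summable_uniform:
  assumes "smooth_summable u"
  shows "uniform_limit (ball 0 R) (\<lambda>n x. \<Sum>i<n. u i x) (\<lambda>x. \<Sum>i. u i x) sequentially"
    and "summable (\<lambda>n. u n p)"
proof -
  have ex: "\<exists>M N. summable M \<and> (\<forall>n\<ge>N. \<forall>p\<in>ball 0 R. \<bar>u n p\<bar> \<le> M n)" for R
    using assms[unfolded smooth_summable_def, THEN conjunct2, rule_format, of "[]" R] by simp
  show "uniform_limit (ball 0 R) (\<lambda>n x. \<Sum>i<n. u i x) (\<lambda>x. \<Sum>i. u i x) sequentially"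
  proof -
    obtain M N where M: "summable M" "\<forall>n\<ge>N. \<forall>p\<in>ball 0 R. \<bar>u n p\<bar> \<le> M n" using ex by blast
    show ?thesis
      by (rule Weierstrass_m_test_ev[OF _ M(1)]) (use M(2) in \<open>auto simp: eventually_sequentially\<close>)
  qed
  obtain M N where M: "summable M" "\<forall>n\<ge>N. \<forall>p\<in>ball 0 (norm p + 1). \<bar>u n p\<bar> \<le> M n"
    using ex[of "norm p + 1"] by blast
  have "p \<in> ball 0 (norm p + 1)" by simp
  then have "\<forall>n\<ge>N. norm (u n p) \<le> M n" using M(2) by (metis real_norm_def)
  then show "summable (\<lambda>n. u n p)" using M(1) by (intro summable_comparison_test[of "\<lambda>n. u n p" M]) auto
qed

lemma smooth_summable_has_derivative:
  fixes u :: "nat \<Rightarrow> 'a::euclidean_space \<Rightarrow> real"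
  assumes "smooth_summable u"
  shows "((\<lambda>p. \<Sum>n. u n p) has_derivative (\<lambda>h. \<Sum>b\<in>Basis. (h \<bullet> b) * (\<Sum>n. dpartial b (u n) p))) (at p)"
proof -
  define R where "R = norm p + 1"
  have p: "p \<in> ball 0 R" by (simp add: R_def)
  define f' where "f' n x h = (\<Sum>b\<in>Basis. (h \<bullet> b) * dpartial b (u n) x)" for n and x h :: 'a
  define g' where "g' x h = (\<Sum>b\<in>Basis. (h \<bullet> b) * (\<Sum>n. dpartial b (u n) x))" for x h :: 'a
  have us: "smooth (u n)" for n using assms unfolding smooth_summable_def by blast
  have "\<exists>g. \<forall>x\<in>ball 0 R. (\<lambda>n. u n x) sums g x \<and> (g has_derivative g' x) (at x within ball 0 R)"
  proof (rule has_derivative_series)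
    show "(u n has_derivative f' n x) (at x within ball 0 R)" for n x
    proof -
      have "frechet_derivative (u n) (at x) = f' n x"
        unfolding f'_def by (intro ext frechet_derivative_expand smooth_differentiable us)
      then show ?thesis using smooth_has_derivative[OF us, of n x] by (simp add: has_derivative_at_withinI)
    qed
    show "(\<lambda>n. u n p) sums (\<Sum>n. u n p)" using smooth_summable_uniform(2)[OF assms] by (rule summable_sums)
    fix e :: real assume e: "e > 0"
    \<comment> \<open>The error is shared equally among the coordinate directions.\<close>
    define e' where "e' = e / real DIM('a)"
    have e': "e' > 0" "real DIM('a) * e' = e" using e by (auto simp: e'_def)
    have "\<forall>\<^sub>F n in sequentially. \<forall>b\<in>Basis. \<forall>x\<in>ball 0 R. dist (\<Sum>i<n. dpartial b (u i) x) (\<Sum>i. dpartial b (u i) x) < e'"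
      using smooth_summable_uniform(1)[OF smooth_summable_dpartial[OF assms], of _ R] e'(1)
      by (intro eventually_ball_finite) (auto simp: uniform_limit_iff)
    then show "\<forall>\<^sub>F n in sequentially. \<forall>x\<in>ball 0 R. \<forall>h. norm ((\<Sum>i<n. f' i x h) - g' x h) \<le> e * norm h"
    proof (eventually_elim, intro ballI allI)
      fix n and x h :: 'a
      assume n: "\<forall>b\<in>Basis. \<forall>x\<in>ball 0 R. dist (\<Sum>i<n. dpartial b (u i) x) (\<Sum>i. dpartial b (u i) x) < e'"
        and x: "x \<in> ball 0 R"
      have "(\<Sum>i<n. f' i x h) = (\<Sum>b\<in>Basis. (h \<bullet> b) * (\<Sum>i<n. dpartial b (u i) x))"
        unfolding f'_def by (subst sum.swap) (simp add: sum_distrib_left)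
      then have "(\<Sum>i<n. f' i x h) - g' x h =
          (\<Sum>b\<in>Basis. (h \<bullet> b) * ((\<Sum>i<n. dpartial b (u i) x) - (\<Sum>i. dpartial b (u i) x)))"
        unfolding g'_def by (simp add: sum_subtractf[symmetric] right_diff_distrib)
      also have "norm \<dots> \<le> (\<Sum>b\<in>(Basis::'a set). norm h * e')"
      proof (rule sum_norm_le)
        fix b :: 'a assume b: "b \<in> Basis"
        have "\<bar>h \<bullet> b\<bar> \<le> norm h" using Basis_le_norm[OF b] .
        moreover have "\<bar>(\<Sum>i<n. dpartial b (u i) x) - (\<Sum>i. dpartial b (u i) x)\<bar> \<le> e'"
          using n b x by (fastforce simp: dist_real_def)
        ultimately show "norm ((h \<bullet> b) * ((\<Sum>i<n. dpartial b (u i) x) - (\<Sum>i. dpartial b (u i) x))) \<le> norm h * e'"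
          by (simp add: abs_mult mult_mono)
      qed
      also have "\<dots> = e * norm h" using e'(2) by (simp add: mult.commute mult.assoc)
      finally show "norm ((\<Sum>i<n. f' i x h) - g' x h) \<le> e * norm h" .
    qed
  qed (use p in auto)
  then obtain g where g: "\<And>x. x \<in> ball 0 R \<Longrightarrow> (\<lambda>n. u n x) sums g x"
    "\<And>x. x \<in> ball 0 R \<Longrightarrow> (g has_derivative g' x) (at x within ball 0 R)" by blast
  have "(g has_derivative g' p) (at p)" using g(2)[OF p] unfolding at_within_open[OF p open_ball] .
  then have "((\<lambda>p. \<Sum>n. u n p) has_derivative g' p) (at p)"
  proof (rule has_derivative_transform_within_open)
    show "open (ball (0::'a) R)" "p \<in> ball 0 R" using p by auto
    show "g x = (\<Sum>n. u n x)" if "x \<in> ball 0 R" for x using sums_unique[OF g(1)[OF that]] .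
  qed
  then show ?thesis unfolding g'_def .
qed

lemma smooth_summable_dpartial_suminf:
  assumes "smooth_summable u" "b \<in> Basis"
  shows "dpartial b (\<lambda>p. \<Sum>n. u n p) = (\<lambda>p. \<Sum>n. dpartial b (u n) p)"
proof
  fix p
  have "(\<Sum>c\<in>Basis. (b \<bullet> c) * (\<Sum>n. dpartial c (u n) p)) = (\<Sum>c\<in>Basis. if c = b then (\<Sum>n. dpartial c (u n) p) else 0)"
    using assms(2) by (intro sum.cong) (auto simp: inner_Basis)
  then show "dpartial b (\<lambda>p. \<Sum>n. u n p) p = (\<Sum>n. dpartial b (u n) p)"
    using dpartial_eqI[OF smooth_summable_has_derivative[OF assms(1)], of b p] assms(2) by simp
qed

lemma smooth_suminf:
  assumes "smooth_summable u" shows "smooth (\<lambda>p. \<Sum>n. u n p)"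
proof (rule smooth_onI)
  fix k show "Dk k UNIV (\<lambda>p. \<Sum>n. u n p)" using assms
  proof (induction k arbitrary: u)
    case (Suc k)
    have "(\<lambda>p. \<Sum>n. u n p) differentiable at p" for p
      using smooth_summable_has_derivative[OF Suc.prems] unfolding differentiable_def by blast
    moreover have "Dk k UNIV (dpartial b (\<lambda>p. \<Sum>n. u n p))" if "b \<in> Basis" for b
      unfolding smooth_summable_dpartial_suminf[OF Suc.prems that] using Suc.IH[OF smooth_summable_dpartial[OF Suc.prems that]] .
    ultimately show ?case by simp
  qed simp
qed simp

lemma vf_apply_suminf:
  assumes "smooth_summable u"
  shows "(\<lambda>n. vf_apply L (u n) p) sums vf_apply L (\<lambda>p. \<Sum>n. u n p) p"
proof -
  have us: "smooth (u n)" for n using assms unfolding smooth_summable_def by blast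
  have "(\<lambda>n. \<Sum>b\<in>Basis. (L p \<bullet> b) * dpartial b (u n) p) sums (\<Sum>b\<in>Basis. (L p \<bullet> b) * (\<Sum>n. dpartial b (u n) p))"
    by (intro sums_sum sums_mult summable_sums smooth_summable_uniform(2) smooth_summable_dpartial assms)
  then show ?thesis
    using vf_apply_eqI[OF smooth_summable_has_derivative[OF assms], of L p]
    by (simp add: vf_apply_expand smooth_differentiable us)
qed

text \<open>The square of the norm of the block, rather than the norm itself, so that cutoffs
  composed with it are smooth.\<close>

definition nsq :: "'a::euclidean_space set \<Rightarrow> 'a \<Rightarrow> real" where
  "nsq B p = cproj B p \<bullet> cproj B p"

lemma nsq_nonneg: "nsq B p \<ge> 0" by (simp add: nsq_def)
lemma nsq_norm: "nsq B p = (norm (cproj B p))\<^sup>2" by (simp add: nsq_def power2_norm_eq_inner)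

lemma smooth_nsq: "smooth (nsq B)"
proof -
  have "smooth (\<lambda>p. \<Sum>b\<in>Basis. (cproj B p \<bullet> b) * (cproj B p \<bullet> b))"
    by (intro smooth_on_sum smooth_on_mult smooth_linear_comp[OF linear_cproj smooth_inner] open_UNIV)
  moreover have "nsq B = (\<lambda>p. \<Sum>b\<in>Basis. (cproj B p \<bullet> b) * (cproj B p \<bullet> b))"
    unfolding nsq_def using euclidean_inner by blast
  ultimately show ?thesis by simp
qed

lemma cproj_cscale_same: "cproj B (cscale B t p) = t *\<^sub>R cproj B p"
  by (auto simp: euclidean_eq_iff[where 'a='a] cscale_inner cproj_inner)
lemma cproj_cscale_disjoint: "B \<inter> C = {} \<Longrightarrow> cproj B (cscale C t p) = cproj B p"
  by (auto simp: euclidean_eq_iff[where 'a='a] cscale_inner cproj_inner)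
lemma nsq_cscale: "nsq B (cscale B t p) = t\<^sup>2 * nsq B p"
  by (simp add: nsq_def cproj_cscale_same power2_eq_square)
lemma nsq_cscale_disjoint: "B \<inter> C = {} \<Longrightarrow> nsq B (cscale C t p) = nsq B p"
  by (simp add: nsq_def cproj_cscale_disjoint)
lemma rest_cscale: "cscale B t p - cproj B (cscale B t p) = p - cproj B p"
  by (auto simp: euclidean_eq_iff[where 'a='a] cscale_inner cproj_inner inner_diff_left)
lemma norm_rest_le: "norm (p - cproj B p) \<le> norm p"
  by (rule norm_le_componentwise_abs) (auto simp: cproj_inner inner_diff_left)

lemma norm_le_of_parts: "norm (p - cproj B p) \<le> R \<Longrightarrow> nsq B p \<le> \<kappa> \<Longrightarrow> norm p \<le> R + sqrt \<kappa>"
proof -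
  assume a: "norm (p - cproj B p) \<le> R" "nsq B p \<le> \<kappa>"
  have "norm (cproj B p) \<le> sqrt \<kappa>" using a(2) unfolding nsq_norm by (rule real_le_rsqrt)
  moreover have "norm p \<le> norm (p - cproj B p) + norm (cproj B p)" by norm
  ultimately show ?thesis using a(1) by linarith
qed

lemma smooth_bounded_cball:
  assumes "smooth f" obtains C where "C \<ge> 0" "\<And>q. q \<in> cball 0 R \<Longrightarrow> \<bar>f q\<bar> \<le> C"
proof -
  have "compact (f ` cball 0 R)" by (intro compact_continuous_image smooth_continuous_on[OF assms]) auto
  then obtain K where "\<forall>x\<in>f ` cball 0 R. norm x \<le> K" using compact_imp_bounded bounded_iff by metis
  then show thesis using that[of "max K 0"] by (auto simp: le_max_iff_disj)
qed

text \<open>Where \<open>nsq B q > \<kappa>\<close> all derivatives vanish, and the rest of the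
  region lies in a compact ball. The bound is uniform in the \<open>B\<close> coordinates, as needed
  when dilations move points far out in \<open>B\<close>.\<close>

lemma supp_bound:
  assumes f: "smooth f" and z: "\<And>q. nsq B q > \<kappa> \<Longrightarrow> f q = 0" and bs: "set bs \<subseteq> Basis"
  obtains C where "C \<ge> 0" "\<And>q. norm (q - cproj B q) \<le> R \<Longrightarrow> \<bar>iter_dpartial bs f q\<bar> \<le> C"
proof -
  obtain C where C: "C \<ge> 0" "\<And>q. q \<in> cball 0 (R + sqrt \<kappa>) \<Longrightarrow> \<bar>iter_dpartial bs f q\<bar> \<le> C"
    using smooth_bounded_cball[OF smooth_foldr[OF f bs]] by metis
  have o: "open {q. nsq B q > \<kappa>}"
    by (intro open_Collect_less continuous_on_const smooth_continuous_on smooth_nsq)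
  have "\<bar>iter_dpartial bs f q\<bar> \<le> C" if "norm (q - cproj B q) \<le> R" for q
  proof (cases "nsq B q > \<kappa>")
    case True
    then show ?thesis using iter_dpartial_eq_0[OF o, of f q bs] z C(1) by simp
  next
    case False
    then show ?thesis using norm_le_of_parts[OF that, of \<kappa>] C(2)[of q] by simp
  qed
  then show thesis using that C(1) by blast
qed

section \<open>Borel summation\<close>

lemma tcoeff_cutoff:
  fixes a :: "'a::euclidean_space \<Rightarrow> real"
  assumes \<theta>: "smooth \<theta>" "\<And>u. u \<le> 1/2 \<Longrightarrow> \<theta> u = (1::real)"
    and a: "smooth a" "\<And>t p. a (cscale B t p) = t ^ m * a p"
  shows "tcoeff B j (\<lambda>p. a p * \<theta> (c * nsq B p)) p = (if j = m then a p else 0)"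
proof -
  \<comment> \<open>For \<open>t \<le> \<delta>\<close> the argument of the cutoff is at most 1/2,
    so along this part of the ray the cutoff is 1 and only \<open>a p * t ^ m\<close> remains. The
    summand 1 avoids division by zero and keeps \<open>\<delta> \<le> 1\<close>, whence
    \<open>t * t \<le> t\<close>.\<close>
  define \<delta> where "\<delta> = 1 / (2 * (\<bar>c\<bar> * nsq B p + 1))"
  have pos: "2 * (\<bar>c\<bar> * nsq B p + 1) \<ge> 2" using nsq_nonneg[of B p] by simp
  then have \<delta>: "0 < \<delta>" "\<delta> \<le> 1" unfolding \<delta>_def by (simp_all only: zero_less_divide_iff divide_le_eq_1) linarith+
  have sm: "smooth (\<lambda>p. a p * \<theta> (c * nsq B p))"
    by (intro smooth_intros a smooth_compose_real[OF \<theta>(1)] smooth_nsq)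
  have "a (cscale B t p) * \<theta> (c * nsq B (cscale B t p)) = (\<Sum>k<Suc (j + m). (if k = m then a p else 0) * t ^ k)"
    if t: "0 < t" "t \<le> \<delta>" for t
  proof -
    have "t\<^sup>2 \<le> t" using t \<delta> by (simp add: power2_eq_square mult_left_le)
    have "c * nsq B (cscale B t p) \<le> \<bar>c\<bar> * nsq B p * t\<^sup>2"
      using nsq_nonneg[of B p] by (simp add: nsq_cscale mult_ac mult_left_mono mult_right_mono)
    also have "\<dots> \<le> \<bar>c\<bar> * nsq B p * \<delta>" using \<open>t\<^sup>2 \<le> t\<close> t nsq_nonneg[of B p] by (intro mult_left_mono) auto
    also have "\<dots> \<le> 1/2" using pos by (simp add: \<delta>_def field_simps)
    finally have "\<theta> (c * nsq B (cscale B t p)) = 1" by (rule \<theta>(2))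
    then show ?thesis
      by (simp add: a(2) if_distrib if_distribR sum.delta mult.commute cong: if_cong del: sum.lessThan_Suc)
  qed
  then show ?thesis
    by (intro tcoeff_unique[OF sm \<delta>(1), where N = "Suc (j + m)" and K = 0]) auto
qed

text \<open>One constant serves all of the finitely many words of partials of length at most
  \<open>m\<close> and also all decay rates \<open>s ^ j\<close> with \<open>j \<le> m\<close>; the
  scales in \<open>borel_sum\<close> can then be chosen from it.\<close>

lemma borel_bound:
  fixes a :: "'a::euclidean_space \<Rightarrow> real"
  assumes \<theta>: "smooth \<theta>" "\<And>u. u \<ge> (1::real) \<Longrightarrow> \<theta> u = 0"
    and a: "smooth a" "\<And>t p. a (cscale B t p) = t ^ m * a p"
  obtains C where "C \<ge> 0"
    "\<And>bs q. set bs \<subseteq> Basis \<Longrightarrow> length bs \<le> m \<Longrightarrow> norm (q - cproj B q) \<le> R \<Longrightarrow> \<bar>iter_dpartial bs (\<lambda>p. a p * \<theta> (nsq B p)) q\<bar> \<le> C"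
    "\<And>p s j. norm p \<le> R \<Longrightarrow> 0 < s \<Longrightarrow> j \<le> m \<Longrightarrow> \<bar>a (cscale B s p) * \<theta> (nsq B (cscale B s p))\<bar> \<le> C * s ^ j"
proof -
  define w where "w p = a p * \<theta> (nsq B p)" for p
  have w: "smooth w" unfolding w_def by (intro smooth_intros a smooth_compose_real[OF \<theta>(1)] smooth_nsq)
  have z: "w q = 0" if "nsq B q > 1" for q using that \<theta>(2) by (simp add: w_def)
  define LL where "LL = {bs :: 'a list. set bs \<subseteq> Basis \<and> length bs \<le> m}"
  have fin: "finite LL" unfolding LL_def by (intro finite_lists_length_le) simp
  have "\<exists>C\<ge>0. \<forall>q. norm (q - cproj B q) \<le> R \<longrightarrow> \<bar>iter_dpartial bs w q\<bar> \<le> C" if "bs \<in> LL" for bs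
    proof -
    have "set bs \<subseteq> Basis" using that by (simp add: LL_def)
    from supp_bound[where f = w and \<kappa> = 1 and B = B and bs = bs and R = R, OF w z this] show ?thesis by metis
  qed
  then obtain C where C: "\<And>bs. bs \<in> LL \<Longrightarrow> C bs \<ge> 0"
    "\<And>bs q. bs \<in> LL \<Longrightarrow> norm (q - cproj B q) \<le> R \<Longrightarrow> \<bar>iter_dpartial bs w q\<bar> \<le> C bs"
    by metis
  obtain C1 where C1: "C1 \<ge> 0" "\<And>q. q \<in> cball 0 R \<Longrightarrow> \<bar>a q\<bar> \<le> C1" using smooth_bounded_cball[OF a(1)] by metis
  obtain C2 where C2: "C2 \<ge> 0" "\<And>u. u \<ge> 0 \<Longrightarrow> \<bar>\<theta> u\<bar> \<le> C2"
  proof -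
    obtain C2 where "C2 \<ge> 0" "\<And>q. q \<in> cball 0 1 \<Longrightarrow> \<bar>\<theta> q\<bar> \<le> C2" using smooth_bounded_cball[OF \<theta>(1)] by metis
    moreover have "\<bar>\<theta> u\<bar> \<le> C2" if "u \<ge> 0" for u
      using calculation(1) calculation(2)[of u] \<theta>(2)[of u] that by (cases "u \<le> 1") auto
    ultimately show thesis using that by blast
  qed
  define K where "K = sum C LL + C1 * C2"
  have Kbs: "\<bar>iter_dpartial bs w q\<bar> \<le> sum C LL" if "bs \<in> LL" "norm (q - cproj B q) \<le> R" for bs q
    using C(2)[OF that] member_le_sum[of bs LL C, OF that(1) _ fin] C(1) by auto
  have K1: "sum C LL \<ge> 0" using C(1) by (rule sum_nonneg)
  show thesis
  proof (rule that[of K])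
    show "K \<ge> 0" using K1 C1(1) C2(1) by (simp add: K_def)
    fix bs :: "'a list" and q :: 'a assume "set bs \<subseteq> Basis" "length bs \<le> m" "norm (q - cproj B q) \<le> R"
    then have "\<bar>iter_dpartial bs w q\<bar> \<le> sum C LL" by (intro Kbs) (auto simp: LL_def)
    then show "\<bar>iter_dpartial bs (\<lambda>p. a p * \<theta> (nsq B p)) q\<bar> \<le> K" 
      using C1(1) C2(1) unfolding K_def w_def[abs_def, symmetric] by (simp add: add_increasing2)
  next
    fix p :: 'a and s :: real and j assume p: "norm p \<le> R" and s: "0 < s" and j: "j \<le> m"
    \<comment> \<open>For \<open>s \<le> 1\<close> homogeneity gives
      \<open>s ^ m \<le> s ^ j\<close>; for \<open>s > 1\<close> the compact support in
      \<open>B\<close> bounds the left side and \<open>s ^ j \<ge> 1\<close>.\<close>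
    have "\<bar>w (cscale B s p)\<bar> \<le> K * s ^ j"
    proof (cases "s \<le> 1")
      case True
      have "\<bar>w (cscale B s p)\<bar> = s ^ m * (\<bar>a p\<bar> * \<bar>\<theta> (nsq B (cscale B s p))\<bar>)"
        using s by (simp add: w_def a(2) abs_mult)
      also have "\<dots> \<le> s ^ m * (C1 * C2)"
        using s p C1 C2 nsq_nonneg by (intro mult_left_mono mult_mono) auto
      also have "\<dots> \<le> s ^ j * (C1 * C2)"
        using s True j C1 C2 by (intro mult_right_mono power_decreasing) auto
      also have "\<dots> \<le> K * s ^ j" using K1 s by (simp add: K_def mult.commute)
      finally show ?thesis .
    next
      case False
      have "norm (cscale B s p - cproj B (cscale B s p)) \<le> R" using norm_rest_le[of p B] p by (simp add: rest_cscale)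
      then have "\<bar>w (cscale B s p)\<bar> \<le> sum C LL" using Kbs[of "[]"] by (auto simp: LL_def)
      also have "\<dots> \<le> K * 1" using C1(1) C2(1) by (simp add: K_def)
      also have "\<dots> \<le> K * s ^ j" using False K1 C1(1) C2(1) by (intro mult_left_mono one_le_power) (auto simp: K_def)
      finally show ?thesis .
    qed
    then show "\<bar>a (cscale B s p) * \<theta> (nsq B (cscale B s p))\<bar> \<le> K * s ^ j" by (simp add: w_def)
  qed
qed

lemma smooth_summable_suminf_split:
  assumes "smooth_summable u" shows "(\<Sum>n. u n p) = (\<Sum>n. u (n + M) p) + (\<Sum>n<M. u n p)"
  using suminf_split_initial_segment[OF smooth_summable_uniform(2)[OF assms]] .

text \<open>Borel's theorem with homogeneous functions in place of monomials. The series is kept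
  explicit, not just asserted to exist, so that fields killing all \<open>a m\<close> and the
  cutoffs can be seen to kill the sum.\<close>

theorem borel_sum:
  fixes a :: "nat \<Rightarrow> 'a::euclidean_space \<Rightarrow> real"
  assumes \<theta>: "smooth \<theta>" "\<And>u. u \<le> 1/2 \<Longrightarrow> \<theta> u = 1" "\<And>u. u \<ge> (1::real) \<Longrightarrow> \<theta> u = 0"
    and a: "\<And>m. smooth (a m)" "\<And>m t p. a m (cscale B t p) = t ^ m * a m p"
  shows "\<exists>c. smooth_summable (\<lambda>m p. a m p * \<theta> (c m * nsq B p)) \<and>
    (\<forall>l p. tcoeff B l (\<lambda>p. \<Sum>m. a m p * \<theta> (c m * nsq B p)) p = a l p)"
proof -
  define w where "w m p = a m p * \<theta> (nsq B p)" for m p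
  have "\<exists>C\<ge>0. (\<forall>bs q. set bs \<subseteq> Basis \<longrightarrow> length bs \<le> m \<longrightarrow> norm (q - cproj B q) \<le> real m \<longrightarrow> \<bar>iter_dpartial bs (w m) q\<bar> \<le> C) \<and>
    (\<forall>p s j. norm p \<le> real m \<longrightarrow> 0 < s \<longrightarrow> j \<le> m \<longrightarrow> \<bar>w m (cscale B s p)\<bar> \<le> C * s ^ j)" for m
    unfolding w_def using borel_bound[OF \<theta>(1,3) a(1) a(2), of m "real m"] by (metis (no_types, lifting))
  then obtain C where C0: "\<And>m. C m \<ge> 0"
    and C1: "\<And>m bs q. set bs \<subseteq> Basis \<Longrightarrow> length bs \<le> m \<Longrightarrow> norm (q - cproj B q) \<le> real m \<Longrightarrow> \<bar>iter_dpartial bs (w m) q\<bar> \<le> C m"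
    and C2: "\<And>m p s j. norm p \<le> real m \<Longrightarrow> 0 < s \<Longrightarrow> j \<le> m \<Longrightarrow> \<bar>w m (cscale B s p)\<bar> \<le> C m * s ^ j"
    by metis
  \<comment> \<open>A word with \<open>k\<close> derivatives along \<open>B\<close> costs
    \<open>\<mu> m ^ k\<close>, while homogeneity provides \<open>1 / \<mu> m ^ m\<close>. For
    \<open>k < m\<close> a factor \<open>1 / \<mu> m\<close> is left over, and this choice lets it
    absorb \<open>C m\<close> and leave \<open>(1/2) ^ m\<close>.\<close>
  define \<mu> where "\<mu> m = max 1 (2 ^ m * C m)" for m
  have \<mu>1: "\<mu> m \<ge> 1" for m by (simp add: \<mu>_def)
  have small: "C m / \<mu> m \<le> (1/2) ^ m" for m
  proof -
    have "2 ^ m * C m \<le> \<mu> m" by (simp add: \<mu>_def)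
    then show ?thesis using \<mu>1[of m] by (simp add: field_simps power_divide)
  qed
  have small': "C m * \<mu> m ^ k / \<mu> m ^ m \<le> (1/2) ^ m" if "k < m" for k m
  proof -
    have "\<mu> m ^ k * \<mu> m \<le> \<mu> m ^ m" using power_increasing[of "Suc k" m "\<mu> m"] that \<mu>1[of m] by (simp add: mult.commute)
    then have "\<mu> m ^ k / \<mu> m ^ m \<le> 1 / \<mu> m" using \<mu>1[of m] by (simp add: field_simps)
    from mult_left_mono[OF this C0[of m]] show ?thesis using small[of m] by simp
  qed
  define u where "u m p = a m p * \<theta> ((\<mu> m)\<^sup>2 * nsq B p)" for m p
  have us: "smooth (u m)" for m
    unfolding u_def by (intro smooth_intros a smooth_compose_real[OF \<theta>(1)] smooth_nsq)
  have ws: "smooth (w m)" for m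
    unfolding w_def by (intro smooth_intros a smooth_compose_real[OF \<theta>(1)] smooth_nsq)
  \<comment> \<open>By homogeneity the dilated cutoff is a rescaling of a fixed function, so no Leibniz rule is needed.\<close>
  have uw: "u m = (\<lambda>p. (1 / \<mu> m ^ m) * w m (cscale B (\<mu> m) p))" for m
  proof
    fix p show "u m p = (1 / \<mu> m ^ m) * w m (cscale B (\<mu> m) p)"
      using \<mu>1[of m] by (simp add: u_def w_def a(2) nsq_cscale)
  qed
  have bnd: "\<bar>iter_dpartial bs (u m) p\<bar> \<le> (1/2) ^ m" if bs: "set bs \<subseteq> Basis" "length bs < m" and p: "norm p \<le> real m" for bs m and p :: 'a
  proof -
    define k where "k = length (filter (\<lambda>b. b \<in> B) bs)"
    have k: "k < m" using bs(2) length_filter_le[of "\<lambda>b. b \<in> B" bs] unfolding k_def by linarith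
    have "norm (cscale B (\<mu> m) p - cproj B (cscale B (\<mu> m) p)) \<le> real m" using norm_rest_le[of p B] p by (simp add: rest_cscale)
    then have "\<bar>iter_dpartial bs (w m) (cscale B (\<mu> m) p)\<bar> \<le> C m" using C1 bs by simp
    then have "\<bar>iter_dpartial bs (u m) p\<bar> \<le> (1 / \<mu> m ^ m) * (\<mu> m ^ k * C m)"
      unfolding uw iter_dpartial_cmult[OF smooth_cscale[OF ws] bs(1)] iter_dpartial_cscale[OF ws bs(1)] k_def[symmetric]
      using \<mu>1[of m] by (auto simp: abs_mult intro!: divide_right_mono mult_left_mono)
    then show ?thesis using small'[OF k] by (simp add: mult.commute)
  qed
  have SSu: "smooth_summable u" unfolding smooth_summable_def
  proof (intro conjI allI impI)
    show "smooth (u n)" for n by (rule us)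
    fix bs :: "'a list" and R :: real assume bs: "set bs \<subseteq> Basis"
    show "\<exists>M N. summable M \<and> (\<forall>n\<ge>N. \<forall>p\<in>ball 0 R. \<bar>iter_dpartial bs (u n) p\<bar> \<le> M n)"
    proof (intro exI conjI allI impI ballI)
      show "summable (\<lambda>n. (1/2::real) ^ n)" by (rule summable_geometric) simp
      fix n and p :: 'a assume n: "max (Suc (length bs)) (nat \<lceil>R\<rceil>) \<le> n" and p: "p \<in> ball 0 R"
      have "R \<le> real n" using n by linarith
      then show "\<bar>iter_dpartial bs (u n) p\<bar> \<le> (1/2) ^ n" using bnd[OF bs, of n p] n p by simp
    qed
  qed
  have "tcoeff B l (\<lambda>p. \<Sum>m. u m p) p = a l p" for l p
  proof -
    \<comment> \<open>From index \<open>M\<close> on, both \<open>l + 1 < m\<close> and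
      \<open>norm p \<le> m\<close> hold, so the tail is of order \<open>t ^ Suc l\<close> and has
      no coefficient of degree \<open>l\<close>; the finite part, which contains the index
      \<open>l\<close>, is computed term by term.\<close>
    define M where "M = max (l + 2) (nat \<lceil>norm p\<rceil>)"
    define V where "V q = (\<Sum>n. u (n + M) q)" for q
    have F: "(\<Sum>m. u m q) = V q + (\<Sum>m<M. u m q)" for q
      unfolding V_def by (rule smooth_summable_suminf_split[OF SSu])
    have Vs: "smooth V"
    proof -
      have "smooth (\<lambda>q. (\<Sum>m. u m q) - (\<Sum>m<M. u m q))" by (intro smooth_intros smooth_suminf SSu us)
      then show ?thesis by (simp add: F)
    qed
    have tV: "tcoeff B l V p = 0"
    proof (rule tcoeff_unique[OF Vs zero_less_one, where N = "Suc l" and K = "\<Sum>n. (1/2) ^ (n + M)"])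
      fix t :: real assume t: "0 < t" "t \<le> 1"
      have e: "\<bar>u (n + M) (cscale B t p)\<bar> \<le> (1/2) ^ (n + M) * t ^ Suc l" for n
      proof -
        let ?m = "n + M"
        have m: "Suc l < ?m" "norm p \<le> real ?m" unfolding M_def by linarith+
        have "\<bar>w ?m (cscale B (\<mu> ?m * t) p)\<bar> \<le> C ?m * (\<mu> ?m * t) ^ Suc l"
          using C2[OF m(2), of "\<mu> ?m * t" "Suc l"] m(1) t \<mu>1[of ?m] by (simp del: power_Suc)
        then have "\<bar>u ?m (cscale B t p)\<bar> \<le> (1 / \<mu> ?m ^ ?m) * (C ?m * (\<mu> ?m * t) ^ Suc l)"
          using \<mu>1[of ?m] by (simp add: uw cscale_cscale abs_mult divide_right_mono del: power_Suc)
        also have "\<dots> = (C ?m * \<mu> ?m ^ Suc l / \<mu> ?m ^ ?m) * t ^ Suc l" by (simp add: power_mult_distrib del: power_Suc)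
        also have "\<dots> \<le> (1/2) ^ ?m * t ^ Suc l" using t by (intro mult_right_mono small' m) auto
        finally show ?thesis .
      qed
      have s: "summable (\<lambda>n. (1/2::real) ^ (n + M))" by (intro summable_ignore_initial_segment summable_geometric) simp
      have "\<bar>V (cscale B t p)\<bar> \<le> (\<Sum>n. (1/2) ^ (n + M) * t ^ Suc l)"
        unfolding V_def real_norm_def[symmetric]
        by (rule norm_suminf_le) (use e summable_mult2[OF s] in auto)
      also have "\<dots> = (\<Sum>n. (1/2) ^ (n + M)) * t ^ Suc l" by (rule suminf_mult2[OF s, symmetric])
      finally show "\<bar>V (cscale B t p) - (\<Sum>j<Suc l. 0 * t ^ j)\<bar> \<le> (\<Sum>n. (1/2) ^ (n + M)) * t ^ Suc l" by simp
    qed simp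
    have tu: "tcoeff B l (u m) p = (if l = m then a m p else 0)" for m
      unfolding u_def by (rule tcoeff_cutoff[OF \<theta>(1,2) a])
    have "tcoeff B l (\<lambda>q. \<Sum>m<M'. u m q) p = (\<Sum>m<M'. tcoeff B l (u m) p)" for M'
    proof (induction M')
      case (Suc M')
      have "smooth (\<lambda>q. \<Sum>m<M'. u m q)" by (intro smooth_intros us)
      from tcoeff_add[OF this us, of B l M' p] Suc show ?case by simp
    qed (simp add: tcoeff_zero)
    moreover have "tcoeff B l (\<lambda>p. \<Sum>m. u m p) p = tcoeff B l V p + tcoeff B l (\<lambda>q. \<Sum>m<M. u m q) p"
      unfolding F by (rule tcoeff_add[OF Vs]) (intro smooth_intros us)
    ultimately show ?thesis using tV by (simp add: tu M_def)
  qed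
  then show ?thesis using SSu unfolding u_def[abs_def] by (intro exI[of _ "\<lambda>m. (\<mu> m)\<^sup>2"]) simp
qed

section \<open>The hyperbolic flow\<close>

definition hflow :: "'a::euclidean_space set \<Rightarrow> 'a set \<Rightarrow> real \<Rightarrow> 'a \<Rightarrow> 'a" where
  "hflow X Y t p = cscale X (exp t) (cscale Y (exp (- t)) p)"

lemma linear_hflow: "linear (hflow X Y t)"
  unfolding hflow_def using linear_compose[OF linear_cscale linear_cscale] by (simp add: o_def)

lemma hflow_add: "hflow X Y s (hflow X Y t p) = hflow X Y (s + t) p"
proof -
  have "cscale X (exp s) (cscale Y (exp (- s)) (cscale X (exp t) (cscale Y (exp (- t)) p))) =
     cscale X (exp s * exp t) (cscale Y (exp (- s) * exp (- t)) p)"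
    by (subst cscale_commute[of Y]) (simp add: cscale_cscale)
  then show ?thesis by (simp add: hflow_def exp_add[symmetric] add.commute)
qed

lemma summable_exp_neg: "summable (\<lambda>n. exp (- real n))"
proof -
  have "summable (\<lambda>n. exp (-1::real) ^ n)" by (rule summable_geometric) simp
  then show ?thesis by (simp add: exp_of_nat_mult[symmetric])
qed

text \<open>Flatness in \<open>Y\<close> gives arbitrarily high powers of \<open>exp (- n)\<close>, which beat the powers of \<open>exp n\<close> that
  the derivatives along \<open>X\<close> produce; the support condition in \<open>X\<close> makes the constants uniform.\<close>

lemma flow_terms:
  fixes u :: "'a::euclidean_space \<Rightarrow> real"
  assumes dis: "X \<inter> Y = {}" and u: "smooth u" and flat: "\<And>p j. tcoeff Y j u p = 0"
    and z: "\<And>p. nsq X p > \<kappa> \<Longrightarrow> u p = 0"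
  shows "smooth_summable (\<lambda>n p. u (hflow X Y (real n) p))"
    and "\<exists>K\<ge>0. \<forall>n t. 0 < t \<longrightarrow> t \<le> 1 \<longrightarrow> \<bar>u (hflow X Y (real n) (cscale Y t p))\<bar> \<le> K * t ^ l * exp (- real n)"
proof -
  define \<Psi> where "\<Psi> N = trem Y N u" for N
  have \<Psi>s: "smooth (\<Psi> N)" for N unfolding \<Psi>_def by (rule smooth_trem[OF u])
  have u\<Psi>: "u (cscale Y s q) = s ^ N * \<Psi> N (s, q)" for s N and q :: 'a
    using tcoeff_expand[OF u, of Y s q N] by (simp add: flat \<Psi>_def)
  have \<Psi>0: "\<Psi> N (s, q) = 0" if "s \<noteq> 0" "nsq X q > \<kappa>" for s N and q :: 'a
    using u\<Psi>[of s q N] z[of "cscale Y s q"] that by (simp add: nsq_cscale_disjoint[OF dis])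
  have bound: "\<exists>C\<ge>0. \<forall>s q. 0 < s \<longrightarrow> s \<le> 1 \<longrightarrow> norm (q - cproj X q) \<le> R \<longrightarrow> \<bar>iter_dpartial bs (\<lambda>q. \<Psi> N (s, q)) q\<bar> \<le> C"
    if bs: "set bs \<subseteq> Basis" for bs :: "'a list" and N and R :: real
  proof -
    have bs': "set (map (Pair (0::real)) bs) \<subseteq> Basis" using bs pair_Basis(1) by auto
    obtain C where C: "C \<ge> 0" "\<And>q. q \<in> cball 0 (1 + (R + sqrt \<kappa>)) \<Longrightarrow> \<bar>iter_dpartial (map (Pair 0) bs) (\<Psi> N) q\<bar> \<le> C"
      using smooth_bounded_cball[OF smooth_foldr[OF \<Psi>s bs']] by metis
    have o: "open {q. nsq X q > \<kappa>}"
      by (intro open_Collect_less continuous_on_const smooth_continuous_on smooth_nsq)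
    have "\<bar>iter_dpartial bs (\<lambda>q. \<Psi> N (s, q)) q\<bar> \<le> C" if s: "0 < s" "s \<le> 1" and q: "norm (q - cproj X q) \<le> R" for s and q :: 'a
    proof (cases "nsq X q > \<kappa>")
      case True
      then show ?thesis using iter_dpartial_eq_0[OF o, of "\<lambda>q. \<Psi> N (s, q)" q bs] \<Psi>0 C(1) s by simp
    next
      case False
      then have "norm q \<le> R + sqrt \<kappa>" using norm_le_of_parts[OF q, of \<kappa>] by simp
      then have "norm (s, q) \<le> 1 + (R + sqrt \<kappa>)" using norm_Pair_le[of s q] s by simp
      then show ?thesis using C(2)[of "(s, q)"] by (simp add: iter_dpartial_section[OF \<Psi>s bs])
    qed
    then show ?thesis using C(1) by blast
  qed
  have rest: "norm (cscale X s p - cproj X (cscale X s p)) \<le> norm p" for s and p :: 'a by (simp add: rest_cscale norm_rest_le)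
  \<comment> \<open>At time \<open>n\<close> the flow contracts \<open>Y\<close> by
    \<open>s = exp (- n)\<close> and expands \<open>X\<close> by \<open>1 / s\<close>. Flatness
    turns the contraction into the factor \<open>s ^ N\<close>; the expansion moves into the
    argument of the remainder.\<close>
  have e1: "u (hflow X Y (real n) p) = s ^ N * \<Psi> N (s, cscale X (1 / s) p)" if "s = exp (- real n)" for n s N and p :: 'a
    unfolding hflow_def that by (subst cscale_commute) (simp add: u\<Psi>[of _ _ N] exp_minus field_simps)
  have e2: "u (hflow X Y (real n) (cscale Y t p)) = (t * s) ^ N * \<Psi> N (t * s, cscale X (1 / s) p)" if "s = exp (- real n)" for n s t N and p :: 'a
    unfolding hflow_def that by (subst cscale_commute) (simp add: u\<Psi>[of _ _ N] exp_minus field_simps cscale_cscale cscale_commute[of X _ Y])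
  show "smooth_summable (\<lambda>n p. u (hflow X Y (real n) p))" unfolding smooth_summable_def
  proof (intro conjI allI impI)
    show "smooth (\<lambda>p. u (hflow X Y (real n) p))" for n by (rule smooth_linear_comp[OF linear_hflow u])
    fix bs :: "'a list" and R :: real assume bs: "set bs \<subseteq> Basis"
    \<comment> \<open>At most \<open>length bs\<close> factors \<open>1 / s\<close> arise from
      derivatives along \<open>X\<close>, so one more power of \<open>s\<close> leaves a summable
      factor \<open>exp (- n)\<close>.\<close>
    define N where "N = Suc (length bs)"
    obtain C where C: "C \<ge> 0" "\<And>s q. 0 < s \<Longrightarrow> s \<le> 1 \<Longrightarrow> norm (q - cproj X q) \<le> R \<Longrightarrow> \<bar>iter_dpartial bs (\<lambda>q. \<Psi> N (s, q)) q\<bar> \<le> C"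
      using bound[OF bs, of R N] by blast
    show "\<exists>M N. summable M \<and> (\<forall>n\<ge>N. \<forall>p\<in>ball 0 R. \<bar>iter_dpartial bs (\<lambda>p. u (hflow X Y (real n) p)) p\<bar> \<le> M n)"
    proof (intro exI conjI allI impI ballI)
      show "summable (\<lambda>n. C * exp (- real n))" by (intro summable_mult summable_exp_neg)
      fix n and p :: 'a assume p: "p \<in> ball 0 R"
      define s where "s = exp (- real n)"
      have s: "0 < s" "s \<le> 1" by (auto simp: s_def)
      define k where "k = length (filter (\<lambda>b. b \<in> X) bs)"
      have k: "Suc k \<le> N" using length_filter_le[of "\<lambda>b. b \<in> X" bs] unfolding k_def N_def by simp
      have "norm (cscale X (1/s) p - cproj X (cscale X (1/s) p)) \<le> R" using rest[of "1/s" p] p by simp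
      then have "\<bar>iter_dpartial bs (\<lambda>q. \<Psi> N (s, q)) (cscale X (1/s) p)\<bar> \<le> C" using C(2) s by blast
      then have "\<bar>iter_dpartial bs (\<lambda>p. u (hflow X Y (real n) p)) p\<bar> \<le> s ^ N * ((1/s) ^ k * C)"
        unfolding e1[OF s_def, of _ N] iter_dpartial_cmult[OF smooth_cscale[OF smooth_section[OF \<Psi>s]] bs]
          iter_dpartial_cscale[OF smooth_section[OF \<Psi>s] bs] k_def[symmetric]
        using s by (auto simp: abs_mult intro!: mult_left_mono divide_right_mono)
      also have "\<dots> = s ^ (N - k) * C" using k s by (simp add: power_diff power_divide)
      also have "\<dots> \<le> s ^ 1 * C" using k s C(1) by (intro mult_right_mono power_decreasing) auto
      finally show "\<bar>iter_dpartial bs (\<lambda>p. u (hflow X Y (real n) p)) p\<bar> \<le> C * exp (- real n)"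
        by (simp add: s_def mult.commute)
    qed
  qed
  \<comment> \<open>Order \<open>l + 1\<close> rather than \<open>l\<close>: as \<open>t\<close> and
    \<open>s\<close> are at most 1, \<open>(t * s) ^ (l + 1) \<le> t ^ l * s\<close>, which keeps
    the Taylor order and a summable factor.\<close>
  obtain C where C: "C \<ge> 0" "\<And>s q. 0 < s \<Longrightarrow> s \<le> 1 \<Longrightarrow> norm (q - cproj X q) \<le> norm p \<Longrightarrow> \<bar>\<Psi> (Suc l) (s, q)\<bar> \<le> C"
    using bound[of "[]" "norm p" "Suc l"] by auto
  have "\<bar>u (hflow X Y (real n) (cscale Y t p))\<bar> \<le> C * t ^ l * exp (- real n)" if t: "0 < t" "t \<le> 1" for n t
  proof -
    define s where "s = exp (- real n)"
    have s: "0 < s" "s \<le> 1" by (auto simp: s_def)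
    have "\<bar>\<Psi> (Suc l) (t * s, cscale X (1 / s) p)\<bar> \<le> C" using t s rest by (intro C(2)) (auto simp: mult_le_one)
    then have "\<bar>u (hflow X Y (real n) (cscale Y t p))\<bar> \<le> (t * s) ^ Suc l * C"
      unfolding e2[OF s_def, of _ _ "Suc l"] using t s by (simp add: abs_mult mult_left_mono)
    also have "\<dots> = C * t ^ l * s * (t * s ^ l)" by (simp add: power_mult_distrib mult_ac)
    also have "\<dots> \<le> C * t ^ l * s * 1" using t s C(1) by (intro mult_left_mono mult_le_one) (auto simp: power_le_one)
    finally show ?thesis by (simp add: s_def)
  qed
  then show "\<exists>K\<ge>0. \<forall>n t. 0 < t \<longrightarrow> t \<le> 1 \<longrightarrow> \<bar>u (hflow X Y (real n) (cscale Y t p))\<bar> \<le> K * t ^ l * exp (- real n)"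
    using C(1) by blast
qed

section \<open>Flat functions along a hyperbolic field\<close>

text \<open>The model field \<open>- x \<partial>x + y \<partial>y\<close>, with \<open>x\<close>
  the coordinates in \<open>X\<close> and \<open>y\<close> those in \<open>Y\<close>: one of each
  for a hyperbolic field, two of each for the first field of a focus-focus pair.\<close>

definition hyp :: "'a::euclidean_space set \<Rightarrow> 'a set \<Rightarrow> 'a \<Rightarrow> 'a" where
  "hyp X Y p = cproj Y p - cproj X p"

lemma linear_hyp: "linear (hyp X Y)"
  unfolding hyp_def by (intro linear_compose_sub linear_cproj)

lemma hyp_cscale_commute: "hyp X Y (cscale B t p) = cscale B t (hyp X Y p)"
  by (simp add: hyp_def cproj_cscale_commute linear_diff[OF linear_cscale])

lemma hflow_inner: "c \<in> Basis \<Longrightarrow> hflow X Y t p \<bullet> c = (if c \<in> X then exp t else 1) * ((if c \<in> Y then exp (- t) else 1) * (p \<bullet> c))"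
  by (simp add: hflow_def cscale_inner)

lemma hflow_0 [simp]: "hflow X Y 0 p = p"
  by (simp add: hflow_def)

lemma hflow_commute_linear:
  assumes "\<And>t q. L (cscale X t q) = cscale X t (L q)" "\<And>t q. L (cscale Y t q) = cscale Y t (L q)"
  shows "L (hflow X Y t q) = hflow X Y t (L q)"
  by (simp add: hflow_def assms)

lemma hflow_cscale_commute: "hflow X Y t (cscale B s p) = cscale B s (hflow X Y t p)"
  by (simp add: hflow_def cscale_commute)

lemma smooth_hflow_prod:
  fixes h :: "'a::euclidean_space \<Rightarrow> real"
  assumes "smooth h" shows "smooth (\<lambda>z. h (hflow X Y (fst z) (snd z)))"
proof (rule smooth_compose[OF assms])
  fix c :: 'a assume c: "c \<in> Basis"
  have neg: "smooth (\<lambda>z::real \<times> 'a. - fst z)"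
    using smooth_linear'[of "\<lambda>z::real \<times> 'a. - fst z"] by (simp add: linear_iff)
  have "smooth (\<lambda>z::real \<times> 'a. if c \<in> X then exp (fst z) else 1)"
    by (cases "c \<in> X") (simp_all add: smooth_on_const smooth_compose_real[OF smooth_exp smooth_fst])
  moreover have "smooth (\<lambda>z::real \<times> 'a. if c \<in> Y then exp (- fst z) else 1)"
    by (cases "c \<in> Y") (simp_all add: smooth_on_const smooth_compose_real[OF smooth_exp neg])
  ultimately show "smooth (\<lambda>z. hflow X Y (fst z) (snd z) \<bullet> c)"
    unfolding hflow_inner[OF c] by (intro smooth_on_mult smooth_snd open_UNIV)
qed

text \<open>For positive times only the \<open>X\<close> coordinates grow, and these are controlled
  by the cutoff; all others stay within their initial bounds.\<close>

lemma rest_hflow_le: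
  assumes "t \<ge> 0" shows "norm (hflow X Y t p - cproj X (hflow X Y t p)) \<le> norm (p - cproj X p)"
proof (rule norm_le_componentwise_abs)
  fix b :: 'a assume b: "b \<in> Basis"
  show "\<bar>(hflow X Y t p - cproj X (hflow X Y t p)) \<bullet> b\<bar> \<le> \<bar>(p - cproj X p) \<bullet> b\<bar>"
    using assms by (simp add: inner_diff_left cproj_inner b hflow_inner abs_mult mult_left_le_one_le)
qed

text \<open>\<open>hflow\<close> runs against \<open>hyp\<close>: the direction in which
  \<open>Y\<close> contracts is the one along which functions flat in \<open>Y\<close> can be
  integrated.\<close>

lemma hflow_curve:
  assumes "X \<inter> Y = {}"
  shows "((\<lambda>t. hflow X Y t p) has_derivative (\<lambda>s. s *\<^sub>R (- hyp X Y (hflow X Y t p)))) (at t)"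
proof -
  have e: "hflow X Y t p = p + (exp t - 1) *\<^sub>R cproj X p + (exp (- t) - 1) *\<^sub>R cproj Y p" for t
    using assms by (subst euclidean_eq_iff) (auto simp: hflow_inner inner_add_left cproj_inner algebra_simps)
  have h: "- hyp X Y (hflow X Y t p) = exp t *\<^sub>R cproj X p - exp (- t) *\<^sub>R cproj Y p"
    using assms by (subst euclidean_eq_iff) (auto simp: hflow_inner inner_diff_left cproj_inner hyp_def)
  have "((\<lambda>t. p + (exp t - 1) *\<^sub>R cproj X p + (exp (- t) - 1) *\<^sub>R cproj Y p) has_derivative
    (\<lambda>s. s *\<^sub>R (exp t *\<^sub>R cproj X p - exp (- t) *\<^sub>R cproj Y p))) (at t)"
    by (auto intro!: derivative_eq_intros simp: algebra_simps)
  then show ?thesis unfolding h unfolding e .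
qed

lemma vf_apply_uminus:
  fixes f :: "'a::euclidean_space \<Rightarrow> real"
  assumes "f differentiable at p" shows "vf_apply (\<lambda>q. - L q) f p = - vf_apply L f p"
  by (simp add: vf_apply_expand[OF assms] sum_negf)

lemma vf_apply_hyp:
  fixes f :: "'a::euclidean_space \<Rightarrow> real"
  assumes "f differentiable at p" shows "vf_apply (hyp X Y) f p = vf_apply (cproj Y) f p - vf_apply (cproj X) f p"
  by (simp add: vf_apply_expand[OF assms] hyp_def inner_diff_left left_diff_distrib sum_subtractf)

text \<open>The fundamental theorem of calculus along an orbit, as \<open>hyp\<close> commutes with
  the flow. Integrals over unit intervals, later summed by telescoping, replace the improper
  integral over all positive times.\<close>

lemma hflow_integral_derivative:
  fixes A :: "'a::euclidean_space \<Rightarrow> real"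
  assumes dis: "X \<inter> Y = {}" and A: "smooth A"
  shows "vf_apply (hyp X Y) (\<lambda>p. integral {0..1} (\<lambda>t. A (hflow X Y t p))) p = A p - A (hflow X Y 1 p)"
proof -
  have sm: "smooth (\<lambda>z. A (hflow X Y (fst z) (snd z)))" by (rule smooth_hflow_prod[OF A])
  have c: "vf_apply (hyp X Y) (\<lambda>q. A (hflow X Y t q)) p = vf_apply (hyp X Y) A (hflow X Y t p)" for t
    by (rule vf_apply_linear_comp[OF linear_hflow smooth_differentiable[OF A]]) (simp add: hflow_commute_linear hyp_cscale_commute)
  have "((\<lambda>t. A (hflow X Y t p)) has_real_derivative vf_apply (\<lambda>q. - hyp X Y q) A (hflow X Y t p)) (at t)" for t
    by (rule curve_derivative[OF A hflow_curve[OF dis]]) simp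
  then have "((\<lambda>t. A (hflow X Y t p)) has_vector_derivative - vf_apply (hyp X Y) A (hflow X Y t p)) (at t within {0..1})" for t
    by (simp add: has_real_derivative_iff_has_vector_derivative vf_apply_uminus[OF smooth_differentiable[OF A]] has_vector_derivative_at_within)
  then have "((\<lambda>t. - vf_apply (hyp X Y) A (hflow X Y t p)) has_integral (A (hflow X Y 1 p) - A (hflow X Y 0 p))) {0..1}"
    by (intro fundamental_theorem_of_calculus) auto
  from integral_unique[OF this] have "integral {0..1} (\<lambda>t. vf_apply (hyp X Y) A (hflow X Y t p)) = A p - A (hflow X Y 1 p)"
    by simp
  then show ?thesis using vf_apply_integral[OF sm, of "hyp X Y" p] by (simp add: c)
qed

text \<open>The flow commutes with dilations in \<open>Y\<close>, and for times in
  \<open>[0, 1]\<close> it keeps \<open>p\<close> in a ball of radius \<open>exp 1 * norm p\<close>,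
  where the remainder is bounded uniformly in time.\<close>

lemma hflow_integral_flat:
  fixes A :: "'a::euclidean_space \<Rightarrow> real"
  assumes A: "smooth A" and flat: "\<And>p j. tcoeff Y j A p = 0"
  shows "tcoeff Y j (\<lambda>p. integral {0..1} (\<lambda>t. A (hflow X Y t p))) p = 0"
proof -
  have sm: "smooth (\<lambda>z. A (hflow X Y (fst z) (snd z)))" by (rule smooth_hflow_prod[OF A])
  define \<Psi> where "\<Psi> = trem Y (Suc j) A"
  have \<Psi>: "smooth \<Psi>" unfolding \<Psi>_def by (rule smooth_trem[OF A])
  obtain C where C: "C \<ge> 0" "\<And>z. z \<in> cball 0 (1 + exp 1 * norm p) \<Longrightarrow> \<bar>\<Psi> z\<bar> \<le> C"
    using smooth_bounded_cball[OF \<Psi>] by metis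
  have fle: "norm (hflow X Y t p) \<le> exp 1 * norm p" if t: "0 \<le> t" "t \<le> 1" for t
  proof -
    have "norm (hflow X Y t p) \<le> norm (exp 1 *\<^sub>R p)"
    proof (rule norm_le_componentwise_abs)
      fix b :: 'a assume b: "b \<in> Basis"
      have e: "exp t \<le> exp 1" "1 \<le> exp (1::real)" "exp (- t) \<le> 1" "0 < exp (- t)" using t by auto
      have "(if b \<in> X then exp t else 1) * (if b \<in> Y then exp (- t) else 1) \<le> exp 1 * 1"
        using e by (intro mult_mono) auto
      then have "(if b \<in> X then exp t else 1) * (if b \<in> Y then exp (- t) else 1) * \<bar>p \<bullet> b\<bar> \<le> exp 1 * \<bar>p \<bullet> b\<bar>"
        by (intro mult_right_mono) auto
      then show "\<bar>hflow X Y t p \<bullet> b\<bar> \<le> \<bar>exp 1 *\<^sub>R p \<bullet> b\<bar>" by (auto simp: hflow_inner[OF b] abs_mult mult.assoc)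
    qed
    then show ?thesis by simp
  qed
  show ?thesis
  proof (rule tcoeff_unique[OF _ zero_less_one, where N = "Suc j" and K = C])
    show "smooth (\<lambda>p. integral {0..1} (\<lambda>t. A (hflow X Y t p)))" using smooth_integral[OF sm] by simp
    fix s :: real assume s: "0 < s" "s \<le> 1"
    have "norm (integral {0..1} (\<lambda>t. A (hflow X Y t (cscale Y s p)))) \<le> (C * s ^ Suc j) * (1 - 0)"
    proof (rule integral_bound)
      show "continuous_on {0..1} (\<lambda>t. A (hflow X Y t (cscale Y s p)))" using section_continuous[OF sm] by simp
      fix t :: real assume t: "t \<in> {0..1}"
      have "norm (s, hflow X Y t p) \<le> 1 + exp 1 * norm p" using norm_Pair_le[of s "hflow X Y t p"] fle[of t] t s by simp
      then have "\<bar>\<Psi> (s, hflow X Y t p)\<bar> \<le> C" using C(2) by simp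
      moreover have "A (hflow X Y t (cscale Y s p)) = s ^ Suc j * \<Psi> (s, hflow X Y t p)"
        using tcoeff_expand[OF A, of Y s "hflow X Y t p" "Suc j"] by (simp add: hflow_cscale_commute flat \<Psi>_def)
      ultimately show "norm (A (hflow X Y t (cscale Y s p))) \<le> C * s ^ Suc j"
        using s by (simp add: abs_mult mult.commute mult_left_mono del: power_Suc)
    qed simp
    then show "\<bar>integral {0..1} (\<lambda>t. A (hflow X Y t (cscale Y s p))) - (\<Sum>j<Suc j. 0 * s ^ j)\<bar> \<le> C * s ^ Suc j" by simp
  qed simp
qed

text \<open>The last two conditions say that the flow of \<open>L\<close> preserves the norms of the two block projections,
  so that \<open>L\<close> annihilates the cutoff functions used below.\<close>

definition compat :: "'a::euclidean_space set \<Rightarrow> 'a set \<Rightarrow> ('a \<Rightarrow> 'a) \<Rightarrow> bool" where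
  "compat X Y L \<longleftrightarrow> linear L \<and> (\<forall>t q. L (cscale X t q) = cscale X t (L q)) \<and> (\<forall>t q. L (cscale Y t q) = cscale Y t (L q)) \<and>
     (\<forall>q. cproj X q \<bullet> cproj X (L q) = 0) \<and> (\<forall>q. cproj Y q \<bullet> cproj Y (L q) = 0)"

text \<open>Through the dilation with \<open>t = 0\<close>, commuting with dilations entails
  commuting with the projection.\<close>

lemma cproj_eq_sc0: "cproj B q = q - cscale B 0 q" by (simp add: cscale_def)

lemma compat_cproj:
  assumes "compat X Y L"
  shows "L (cproj X q) = cproj X (L q)" "L (cproj Y q) = cproj Y (L q)"
proof -
  have *: "L (cproj B q) = cproj B (L q)" if "linear L" "L (cscale B 0 q) = cscale B 0 (L q)" for B
    unfolding cproj_eq_sc0 linear_diff[OF that(1)] that(2) ..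
  show "L (cproj X q) = cproj X (L q)" "L (cproj Y q) = cproj Y (L q)"
    using assms unfolding compat_def by (auto intro: *)
qed

lemma compat_hyp: "compat X Y L \<Longrightarrow> L (hyp X Y q) = hyp X Y (L q)"
  unfolding hyp_def using compat_cproj[of X Y L q] linear_diff[of L "cproj Y q" "cproj X q"] by (simp add: compat_def)

lemma vf_apply_nsq: "vf_apply L (nsq B) p = 2 * (cproj B p \<bullet> cproj B (L p))"
proof (rule vf_apply_eqI[THEN trans])
  have b: "bounded_linear (cproj B)" using linear_cproj linear_conv_bounded_linear by blast
  show "(nsq B has_derivative (\<lambda>h. cproj B p \<bullet> cproj B h + cproj B h \<bullet> cproj B p)) (at p)"
    unfolding nsq_def by (intro has_derivative_inner bounded_linear_imp_has_derivative b)
qed (simp add: inner_commute)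

lemma vf_apply_cutoff:
  fixes \<theta> :: "real \<Rightarrow> real"
  assumes \<theta>: "smooth \<theta>" and L: "\<And>q. cproj B q \<bullet> cproj B (L q) = 0"
  shows "vf_apply L (\<lambda>p. \<theta> (c * nsq B p)) p = 0"
proof -
  have d: "(\<theta> has_real_derivative dpartial 1 \<theta> (c * nsq B p)) (at (c * nsq B p))"
  proof -
    have l: "linear (frechet_derivative \<theta> (at (c * nsq B p)))"
      using linear_frechet_derivative smooth_differentiable[OF \<theta>] by blast
    have "frechet_derivative \<theta> (at (c * nsq B p)) = (*) (dpartial 1 \<theta> (c * nsq B p))"
    proof
      fix s :: real
      show "frechet_derivative \<theta> (at (c * nsq B p)) s = dpartial 1 \<theta> (c * nsq B p) * s"
        using linear_scale[OF l, of s 1] by (simp add: dpartial_def)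
    qed
    then show ?thesis using smooth_has_derivative[OF \<theta>, of "c * nsq B p"] by (simp add: has_field_derivative_def)
  qed
  have n: "(\<lambda>p. c * nsq B p) differentiable at p"
    by (intro smooth_differentiable smooth_intros smooth_nsq)
  have "vf_apply L (\<lambda>p. c * nsq B p) p = 0"
    using vf_apply_mult[of "\<lambda>_. c" p "nsq B" L] smooth_differentiable[OF smooth_nsq, of B p] L by (simp add: vf_apply_nsq)
  then show ?thesis using vf_apply_real_comp[OF n d, of L] by simp
qed

lemma tcoeff_mult_invariant:
  assumes m: "smooth m" "\<And>t. m (cscale B t p) = m p" and h: "smooth h"
  shows "tcoeff B j (\<lambda>q. m q * h q) p = m p * tcoeff B j h p"
proof (rule tcoeff_unique'[where N = "Suc j" and s = 1 and q = p and \<Psi> = "\<lambda>z. m p * trem B (Suc j) h z"])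
  fix t :: real
  show "m (cscale B t p) * h (cscale B t p) = (\<Sum>j<Suc j. (m p * tcoeff B j h p) * t ^ j) + t ^ Suc j * (m p * trem B (Suc j) h (1 * t, p))"
    unfolding m(2) using tcoeff_expand[OF h, of B t p "Suc j"]
    by (simp add: algebra_simps sum_distrib_left del: sum.lessThan_Suc)
qed (intro smooth_intros smooth_trem h m | simp)+

text \<open>\<open>G\<close> is the integral of a cut-off \<open>R\<close> over the whole forward
  orbit of \<open>hflow\<close>, split into unit time steps. The last clause loses half of the
  radius, because an orbit may run up to the edge of the cutoff in \<open>X\<close>.\<close>

lemma flow_solve:
  fixes R :: "'a::euclidean_space \<Rightarrow> real"
  assumes dis: "X \<inter> Y = {}" and R: "smooth R" and flat: "\<And>p j. tcoeff Y j R p = 0" and \<rho>: "\<rho> > 0"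
  obtains G where "smooth G" "\<And>p. p \<in> ball 0 (\<rho> / 4) \<Longrightarrow> vf_apply (hyp X Y) G p = R p" "\<And>p j. tcoeff Y j G p = 0"
    "\<And>L p. compat X Y L \<Longrightarrow> (\<And>q. q \<in> ball 0 \<rho> \<Longrightarrow> vf_apply L R q = 0) \<Longrightarrow> p \<in> ball 0 (\<rho> / 2) \<Longrightarrow> vf_apply L G p = 0"
proof -
  obtain \<theta> :: "real \<Rightarrow> real" where \<theta>: "smooth \<theta>" "\<And>u. u \<le> 1/2 \<Longrightarrow> \<theta> u = 1" "\<And>u. u \<ge> 1 \<Longrightarrow> \<theta> u = 0"
    using bump_exists by blast
  \<comment> \<open>The cutoff is 1 where the \<open>X\<close> part has norm at most
    \<open>\<rho> / 4\<close>, and 0 from norm \<open>\<rho> / 2\<close> on.\<close>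
  define c where "c = 4 / \<rho>\<^sup>2"
  have c: "c > 0" using \<rho> by (simp add: c_def)
  define \<kappa> where "\<kappa> = (\<rho> / 2)\<^sup>2"
  have \<kappa>: "c * \<kappa> = 1" using \<rho> by (simp add: c_def \<kappa>_def power_divide)
  define A where "A p = \<theta> (c * nsq X p) * R p" for p
  have cut: "smooth (\<lambda>p. \<theta> (c * nsq X p))" by (intro smooth_compose_real[OF \<theta>(1)] smooth_intros smooth_nsq)
  have A: "smooth A" unfolding A_def by (intro smooth_intros cut R)
  have Aflat: "tcoeff Y j A p = 0" for j p
    unfolding A_def by (subst tcoeff_mult_invariant[OF cut _ R]) (simp_all add: flat nsq_cscale_disjoint[OF dis])
  have A0: "A p = 0" if "nsq X p > \<kappa>" for p
  proof -
    have "c * nsq X p \<ge> 1" using that c \<kappa> by (metis less_imp_le mult_left_mono)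
    then show ?thesis by (simp add: A_def \<theta>(3))
  qed
  define u where "u p = integral {0..1} (\<lambda>t. A (hflow X Y t p))" for p
  have us: "smooth u" unfolding u_def using smooth_integral[OF smooth_hflow_prod[OF A]] by simp
  have uflat: "tcoeff Y j u p = 0" for j p unfolding u_def by (rule hflow_integral_flat[OF A Aflat])
  have u0: "u p = 0" if "nsq X p > \<kappa>" for p
  proof -
    have "A (hflow X Y t p) = 0" if t: "t \<in> {0..1}" for t
    proof (rule A0)
      have "1 \<le> (exp t)\<^sup>2" using t by simp
      then have "1 * nsq X p \<le> (exp t)\<^sup>2 * nsq X p" by (intro mult_right_mono nsq_nonneg)
      then show "nsq X (hflow X Y t p) > \<kappa>" using \<open>nsq X p > \<kappa>\<close> by (simp add: hflow_def nsq_cscale nsq_cscale_disjoint[OF dis])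
    qed
    then have "integral {0..1} (\<lambda>t. A (hflow X Y t p)) = integral {0..1} (\<lambda>t::real. 0::real)" by (intro integral_cong) auto
    then show ?thesis by (simp add: u_def)
  qed
  define v where "v n p = u (hflow X Y (real n) p)" for n p
  have SSv: "smooth_summable v" unfolding v_def[abs_def] by (rule flow_terms(1)[OF dis us uflat u0])
  define G where "G p = (\<Sum>n. v n p)" for p
  have Gs: "smooth G" unfolding G_def by (rule smooth_suminf[OF SSv])
  have vL: "vf_apply L (v n) p = vf_apply L u (hflow X Y (real n) p)"
    if "\<And>t q. L (cscale X t q) = cscale X t (L q)" "\<And>t q. L (cscale Y t q) = cscale Y t (L q)" for L n p
    unfolding v_def by (rule vf_apply_linear_comp[OF linear_hflow smooth_differentiable[OF us]]) (rule hflow_commute_linear[OF that])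
  have G1: "vf_apply (hyp X Y) G p = A p" for p
  proof -
    \<comment> \<open>The derivative of the \<open>n\<close>-th term is the difference of
      \<open>A\<close> at times \<open>n\<close> and \<open>n + 1\<close>. \<open>A\<close> is
      itself flat and cut off, so its values along the orbit are summable, hence tend to 0, and the
      telescoping sum is \<open>A p\<close>.\<close>
    have "(\<lambda>n. A (hflow X Y (real n) p)) \<longlonglongrightarrow> 0"
      by (rule summable_LIMSEQ_zero[OF smooth_summable_uniform(2)[OF flow_terms(1)[OF dis A Aflat A0]]])
    from telescope_sums'[OF this] have "(\<lambda>n. A (hflow X Y (real n) p) - A (hflow X Y (real (Suc n)) p)) sums A p" by simp
    moreover have "vf_apply (hyp X Y) (v n) p = A (hflow X Y (real n) p) - A (hflow X Y (real (Suc n)) p)" for n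
      using vL[of "hyp X Y" n p] hflow_integral_derivative[OF dis A, of "hflow X Y (real n) p"]
      by (simp add: hyp_cscale_commute u_def[abs_def] hflow_add)
    ultimately have "(\<lambda>n. vf_apply (hyp X Y) (v n) p) sums A p" by simp
    then show ?thesis using vf_apply_suminf[OF SSv, of "hyp X Y" p] sums_unique2 unfolding G_def by blast
  qed
  show thesis
  proof (rule that[OF Gs])
    fix p :: 'a assume p: "p \<in> ball 0 (\<rho> / 4)"
    have "norm (cproj X p) \<le> norm p" by (rule norm_le_componentwise_abs) (simp add: cproj_inner)
    then have "nsq X p \<le> (\<rho> / 4)\<^sup>2" using p unfolding nsq_norm by (intro power_mono) auto
    then have "c * nsq X p \<le> c * (\<rho> / 4)\<^sup>2" using c by simp
    also have "\<dots> \<le> 1/2" using \<rho> by (simp add: c_def power_divide)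
    finally show "vf_apply (hyp X Y) G p = R p" by (simp add: G1 A_def \<theta>(2))
  next
    fix p :: 'a and j
    obtain K where K: "K \<ge> 0" "\<And>n t. 0 < t \<Longrightarrow> t \<le> 1 \<Longrightarrow> \<bar>v n (cscale Y t p)\<bar> \<le> K * t ^ Suc j * exp (- real n)"
      using flow_terms(2)[OF dis us uflat u0, where p = p and l = "Suc j"] unfolding v_def by blast
    show "tcoeff Y j G p = 0"
    proof (rule tcoeff_unique[OF Gs zero_less_one, where N = "Suc j" and K = "K * (\<Sum>n. exp (- real n))"])
      fix t :: real assume t: "0 < t" "t \<le> 1"
      have "norm (G (cscale Y t p)) \<le> (\<Sum>n. K * t ^ Suc j * exp (- real n))"
        unfolding G_def by (rule norm_suminf_le) (use K(2)[OF t] summable_mult[OF summable_exp_neg] in auto)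
      also have "\<dots> = K * t ^ Suc j * (\<Sum>n. exp (- real n))" by (rule suminf_mult[OF summable_exp_neg])
      finally show "\<bar>G (cscale Y t p) - (\<Sum>j<Suc j. 0 * t ^ j)\<bar> \<le> K * (\<Sum>n. exp (- real n)) * t ^ Suc j"
        by (simp add: mult_ac)
    qed simp
  next
    fix L :: "'a \<Rightarrow> 'a" and p :: 'a
    assume L: "compat X Y L" and z: "\<And>q. q \<in> ball 0 \<rho> \<Longrightarrow> vf_apply L R q = 0" and p: "p \<in> ball 0 (\<rho> / 2)"
    have Lc: "\<And>t q. L (cscale X t q) = cscale X t (L q)" "\<And>t q. L (cscale Y t q) = cscale Y t (L q)" "\<And>q. cproj X q \<bullet> cproj X (L q) = 0"
      using L unfolding compat_def by auto
    \<comment> \<open>Either the cutoff vanishes at \<open>q\<close>, or the \<open>X\<close> part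
      has norm at most \<open>\<rho> / 2\<close>; together with the bound on the other coordinates
      this puts \<open>q\<close> in the ball where \<open>L\<close> kills \<open>R\<close>.\<close>
    have LA: "vf_apply L A q = 0" if q: "norm (q - cproj X q) < \<rho> / 2" for q
    proof -
      have e: "vf_apply L A q = \<theta> (c * nsq X q) * vf_apply L R q"
        unfolding A_def using vf_apply_mult[OF smooth_differentiable[OF cut] smooth_differentiable[OF R]]
        by (simp add: vf_apply_cutoff[OF \<theta>(1) Lc(3)])
      show ?thesis
      proof (cases "nsq X q \<le> \<kappa>")
        case True
        have "norm (q - cproj X q) \<le> norm (q - cproj X q)" by simp
        from norm_le_of_parts[OF this True] have "norm q \<le> norm (q - cproj X q) + \<rho> / 2"
          using \<rho> by (simp add: \<kappa>_def)
        then show ?thesis using q z[of q] e by simp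
      next
        case False
        then have "c * nsq X q \<ge> 1" using c \<kappa> by (metis less_imp_le mult_left_mono not_le)
        then show ?thesis by (simp add: e \<theta>(3))
      qed
    qed
    have Lu: "vf_apply L u q = 0" if q: "norm (q - cproj X q) < \<rho> / 2" for q
    proof -
      have "vf_apply L (\<lambda>q. A (hflow X Y t q)) q = 0" if "t \<in> {0..1}" for t
      proof -
        have "vf_apply L (\<lambda>q. A (hflow X Y t q)) q = vf_apply L A (hflow X Y t q)"
          by (rule vf_apply_linear_comp[OF linear_hflow smooth_differentiable[OF A]]) (rule hflow_commute_linear[OF Lc(1,2)])
        also have "\<dots> = 0" using rest_hflow_le[of t X Y q] that q by (intro LA) auto
        finally show ?thesis .
      qed
      then have "integral {0..1} (\<lambda>t. vf_apply L (\<lambda>q. A (hflow X Y t q)) q) = integral {0..1} (\<lambda>t::real. 0::real)"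
        by (intro integral_cong) auto
      then show ?thesis using vf_apply_integral[OF smooth_hflow_prod[OF A], of L X Y q] by (simp add: u_def[abs_def])
    qed
    have "vf_apply L (v n) p = 0" for n
    proof -
      have "norm (hflow X Y (real n) p - cproj X (hflow X Y (real n) p)) < \<rho> / 2"
        using rest_hflow_le[of "real n" X Y p] norm_rest_le[of p X] p by simp
      then show ?thesis using vL[OF Lc(1,2), of n p] Lu by simp
    qed
    then show "vf_apply L G p = 0"
      using vf_apply_suminf[OF SSv, of L p] sums_unique2[of "\<lambda>n. 0::real"] unfolding G_def by simp
  qed
qed

section \<open>Splitting for a single field\<close>

text \<open>\<open>\<delta>\<close>, \<open>f\<close> and \<open>G\<close> are chosen before
  \<open>L\<close> and \<open>k\<close>, so one decomposition serves all other fields at once.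
  Hypotheses are on the ball of radius \<open>\<epsilon>\<close> and conclusions on a smaller one,
  as is appropriate for germs.\<close>

definition splits_at :: "('a::euclidean_space \<Rightarrow> 'a) \<Rightarrow> ('a \<Rightarrow> 'a) set \<Rightarrow> real \<Rightarrow> ('a \<Rightarrow> real) \<Rightarrow> bool" where
  "splits_at X \<L> \<epsilon> h \<longleftrightarrow> (\<exists>\<delta> f G. 0 < \<delta> \<and> \<delta> \<le> \<epsilon> \<and> smooth f \<and> smooth G \<and>
     (\<forall>p\<in>ball 0 \<delta>. h p = f p + vf_apply X G p \<and> vf_apply X f p = 0) \<and>
     (\<forall>L\<in>\<L>. (\<forall>k. smooth k \<longrightarrow> (\<forall>p\<in>ball 0 \<epsilon>. vf_apply L h p = vf_apply X k p) \<longrightarrow> (\<forall>p\<in>ball 0 \<delta>. vf_apply L f p = 0)) \<and>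
        ((\<forall>p\<in>ball 0 \<epsilon>. vf_apply L h p = 0) \<longrightarrow> (\<forall>p\<in>ball 0 \<delta>. vf_apply L G p = 0))))"

definition splitting :: "('a::euclidean_space \<Rightarrow> 'a) \<Rightarrow> ('a \<Rightarrow> 'a) set \<Rightarrow> bool" where
  "splitting X \<L> \<longleftrightarrow> (\<forall>\<epsilon> h. \<epsilon> > 0 \<longrightarrow> smooth h \<longrightarrow> splits_at X \<L> \<epsilon> h)"

text \<open>\<open>L\<close> preserves the norm of the \<open>Y\<close> block and hence kills the
  cutoffs, so the series can be treated term by term.\<close>

lemma vf_apply_borel_zero:
  assumes S: "smooth_summable (\<lambda>m p. a m p * \<theta> (c m * nsq Y p))" and \<theta>: "smooth \<theta>" and a: "\<And>m. smooth (a m)"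
    and L: "\<And>q. cproj Y q \<bullet> cproj Y (L q) = 0" and z: "\<And>m. vf_apply L (a m) p = 0"
  shows "vf_apply L (\<lambda>p. \<Sum>m. a m p * \<theta> (c m * nsq Y p)) p = 0"
proof -
  have "vf_apply L (\<lambda>p. a m p * \<theta> (c m * nsq Y p)) p = 0" for m
  proof -
    have cut: "smooth (\<lambda>p. \<theta> (c m * nsq Y p))" by (intro smooth_compose_real[OF \<theta>] smooth_intros smooth_nsq)
    show ?thesis
      using vf_apply_mult[OF smooth_differentiable[OF a] smooth_differentiable[OF cut], of L m p]
      by (simp add: vf_apply_cutoff[OF \<theta> L] z)
  qed
  then show ?thesis using vf_apply_suminf[OF S, of L p] sums_unique2[of "\<lambda>n. 0::real"] by simp
qed

lemma splittingI:
  assumes "0 < \<delta>" "\<delta> \<le> \<epsilon>" "smooth f" "smooth G"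
    "\<And>p. p \<in> ball 0 \<delta> \<Longrightarrow> h p = f p + vf_apply X G p" "\<And>p. p \<in> ball 0 \<delta> \<Longrightarrow> vf_apply X f p = 0"
    "\<And>L k p. L \<in> \<L> \<Longrightarrow> smooth k \<Longrightarrow> \<forall>p\<in>ball 0 \<epsilon>. vf_apply L h p = vf_apply X k p \<Longrightarrow> p \<in> ball 0 \<delta> \<Longrightarrow> vf_apply L f p = 0"
    "\<And>L p. L \<in> \<L> \<Longrightarrow> \<forall>p\<in>ball 0 \<epsilon>. vf_apply L h p = 0 \<Longrightarrow> p \<in> ball 0 \<delta> \<Longrightarrow> vf_apply L G p = 0"
  shows "splits_at X \<L> \<epsilon> h"
  unfolding splits_at_def
  by (rule exI[of _ \<delta>], rule exI[of _ f], rule exI[of _ G], intro conjI ballI allI impI) (fact assms | rule assms; assumption)+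

theorem splitting_hyp:
  fixes X Y :: "'a::euclidean_space set"
  assumes dis: "X \<inter> Y = {}"
  shows "splitting (hyp X Y) {L. compat X Y L}"
  unfolding splitting_def
proof (intro allI impI)
  fix \<epsilon> :: real and h :: "'a \<Rightarrow> real" assume \<epsilon>: "\<epsilon> > 0" and h: "smooth h"
  have dis': "Y \<inter> X = {}" using dis by blast
  obtain \<theta> :: "real \<Rightarrow> real" where \<theta>: "smooth \<theta>" "\<And>u. u \<le> 1/2 \<Longrightarrow> \<theta> u = 1" "\<And>u. u \<ge> 1 \<Longrightarrow> \<theta> u = 0"
    using bump_exists by blast
  define b where "b l = tcoeff Y l h" for l
  define a where "a l = tcoeff X l (b l)" for l
  define B where "B l = euler_inv X l (b l)" for l
  have bs: "smooth (b l)" for l unfolding b_def by (rule smooth_tcoeff[OF h])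
  have as: "smooth (a l)" for l unfolding a_def by (rule smooth_tcoeff[OF bs])
  have Bs: "smooth (B l)" for l unfolding B_def by (rule smooth_euler_inv[OF bs])
  have bh: "b l (cscale Y t p) = t ^ l * b l p" for l t p unfolding b_def by (rule tcoeff_homog[OF h])
  have aX: "a l (cscale X t p) = t ^ l * a l p" for l t p unfolding a_def by (rule tcoeff_homog[OF bs])
  have aY: "a l (cscale Y t p) = t ^ l * a l p" for l t p
    unfolding a_def by (rule trem_linear_comp(1)[OF bs linear_cscale cscale_commute one_neq_zero bh])
  have BY: "B l (cscale Y t p) = t ^ l * B l p" for l t p
    unfolding B_def by (rule euler_inv_linear_comp[OF bs linear_cscale cscale_commute bh])
  \<comment> \<open>On \<open>B l\<close> the Euler field of \<open>Y\<close> acts as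
    \<open>l\<close>, and that of \<open>X\<close> as \<open>l\<close> up to the defect
    \<open>b l - a l\<close>; in the difference the \<open>l\<close> cancels.\<close>
  have hypB: "vf_apply (hyp X Y) (B l) p = b l p - a l p" for l p
    using euler_inv_eq[OF bs, of X l l p, folded B_def a_def] euler_homog[OF Bs BY, of l p]
    by (simp add: vf_apply_hyp[OF smooth_differentiable[OF Bs]])
  have hypa: "vf_apply (hyp X Y) (a l) p = 0" for l p
    using euler_homog[OF as aX, of l p] euler_homog[OF as aY, of l p]
    by (simp add: vf_apply_hyp[OF smooth_differentiable[OF as]])
  obtain c1 where c1: "smooth_summable (\<lambda>m p. a m p * \<theta> (c1 m * nsq Y p))"
    "\<And>l p. tcoeff Y l (\<lambda>p. \<Sum>m. a m p * \<theta> (c1 m * nsq Y p)) p = a l p"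
    using borel_sum[where a = a, OF \<theta> as aY] by auto
  obtain c2 where c2: "smooth_summable (\<lambda>m p. B m p * \<theta> (c2 m * nsq Y p))"
    "\<And>l p. tcoeff Y l (\<lambda>p. \<Sum>m. B m p * \<theta> (c2 m * nsq Y p)) p = B l p"
    using borel_sum[where a = B, OF \<theta> Bs BY] by auto
  define f0 where "f0 p = (\<Sum>m. a m p * \<theta> (c1 m * nsq Y p))" for p
  define G0 where "G0 p = (\<Sum>m. B m p * \<theta> (c2 m * nsq Y p))" for p
  have f0s: "smooth f0" unfolding f0_def by (rule smooth_suminf[OF c1(1)])
  have G0s: "smooth G0" unfolding G0_def by (rule smooth_suminf[OF c2(1)])
  have tf0: "tcoeff Y l f0 p = a l p" for l p unfolding f0_def by (rule c1(2))
  have tG0: "tcoeff Y l G0 p = B l p" for l p unfolding G0_def by (rule c2(2))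
  have thyp: "tcoeff Y l (vf_apply (hyp X Y) k) p = vf_apply (hyp X Y) (tcoeff Y l k) p" if "smooth k" for k l p
    by (rule tcoeff_vf[OF that linear_hyp hyp_cscale_commute])
  \<comment> \<open>Each \<open>a m\<close> is invariant but the cutoffs in the Borel sum are not,
    so \<open>E\<close> is only flat along \<open>y = 0\<close>. Subtracting its flow solution
    \<open>G2\<close> restores invariance near 0, and \<open>G2\<close>, being flat, leaves the
    Taylor coefficients of \<open>f0\<close> unchanged.\<close>
  define E where "E = vf_apply (hyp X Y) f0"
  have Es: "smooth E" unfolding E_def by (rule smooth_vf_apply[OF linear_hyp f0s])
  have Eflat: "tcoeff Y j E p = 0" for j p
    unfolding E_def thyp[OF f0s] using hypa by (simp add: tf0[abs_def] ext[of "tcoeff Y j f0" "a j", OF tf0])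
  obtain G2 where G2: "smooth G2" "\<And>p. p \<in> ball 0 (\<epsilon> / 4) \<Longrightarrow> vf_apply (hyp X Y) G2 p = E p" "\<And>p j. tcoeff Y j G2 p = 0"
    "\<And>L p. compat X Y L \<Longrightarrow> (\<And>q. q \<in> ball 0 \<epsilon> \<Longrightarrow> vf_apply L E q = 0) \<Longrightarrow> p \<in> ball 0 (\<epsilon> / 2) \<Longrightarrow> vf_apply L G2 p = 0"
    using flow_solve[OF dis Es Eflat \<epsilon>] by metis
  define f where "f p = f0 p - G2 p" for p
  have fs: "smooth f" unfolding f_def by (intro smooth_intros f0s G2)
  define R where "R p = h p - f p - vf_apply (hyp X Y) G0 p" for p
  have XG0s: "smooth (vf_apply (hyp X Y) G0)" by (rule smooth_vf_apply[OF linear_hyp G0s])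
  have hfs: "smooth (\<lambda>p. h p - f p)" by (intro smooth_intros h fs)
  have Rs: "smooth R" unfolding R_def by (intro smooth_intros hfs XG0s)
  have Rflat: "tcoeff Y j R p = 0" for j p
  proof -
    have "tcoeff Y j (vf_apply (hyp X Y) G0) p = b j p - a j p"
      unfolding thyp[OF G0s] by (simp add: ext[of "tcoeff Y j G0" "B j", OF tG0] hypB)
    moreover have "tcoeff Y j f p = a j p"
      unfolding f_def using tcoeff_diff[OF f0s G2(1)] by (simp add: tf0 G2(3))
    ultimately show ?thesis
      unfolding R_def using tcoeff_diff[OF hfs XG0s, of Y j p] tcoeff_diff[OF h fs, of Y j p] by (simp add: b_def)
  qed
  \<comment> \<open>Other fields are known to kill \<open>f\<close> only on the ball of radius
    \<open>\<epsilon> / 2\<close>, so the second flow solution starts from there and solves on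
    radius \<open>\<epsilon> / 8\<close>.\<close>
  have \<epsilon>2: "\<epsilon> / 2 > 0" using \<epsilon> by simp
  obtain G1 where G1: "smooth G1" "\<And>p. p \<in> ball 0 (\<epsilon> / 2 / 4) \<Longrightarrow> vf_apply (hyp X Y) G1 p = R p"
    "\<And>L p. compat X Y L \<Longrightarrow> (\<And>q. q \<in> ball 0 (\<epsilon> / 2) \<Longrightarrow> vf_apply L R q = 0) \<Longrightarrow> p \<in> ball 0 (\<epsilon> / 2 / 2) \<Longrightarrow> vf_apply L G1 p = 0"
    using flow_solve[OF dis Rs Rflat \<epsilon>2] by metis
  define G where "G p = G0 p + G1 p" for p
  have Gs: "smooth G" unfolding G_def by (intro smooth_intros G0s G1)
  have hypG: "vf_apply L G p = vf_apply L G0 p + vf_apply L G1 p" for L p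
    unfolding G_def by (intro vf_apply_add smooth_differentiable G0s G1)
  have hypf: "vf_apply L f p = vf_apply L f0 p - vf_apply L G2 p" for L p
    unfolding f_def by (intro vf_apply_diff smooth_differentiable f0s G2)
  have Lhyp: "vf_apply L (vf_apply (hyp X Y) k) p = 0"
    if L: "compat X Y L" and k: "smooth k" "\<And>q. q \<in> ball 0 \<epsilon> \<Longrightarrow> vf_apply L k q = 0" and p: "p \<in> ball 0 \<epsilon>" for L k p
  proof -
    have l: "linear L" using L by (simp add: compat_def)
    have "vf_apply L (vf_apply (hyp X Y) k) p = vf_apply (hyp X Y) (vf_apply L k) p"
      by (rule vf_apply_commute[OF l linear_hyp k(1) compat_hyp[OF L]])
    also have "\<dots> = vf_apply (hyp X Y) (\<lambda>_. 0) p"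
      by (rule vf_apply_cong[OF open_ball p]) (rule k(2))
    finally show ?thesis by simp
  qed
  have A: "vf_apply L f p = 0" if L: "compat X Y L" and k: "smooth k"
    "\<And>p. p \<in> ball 0 \<epsilon> \<Longrightarrow> vf_apply L h p = vf_apply (hyp X Y) k p" and p: "p \<in> ball 0 (\<epsilon> / 2)" for L k p
  proof -
    have l: "linear L" "\<And>t q. L (cscale X t q) = cscale X t (L q)" "\<And>t q. L (cscale Y t q) = cscale Y t (L q)" "\<And>q. cproj Y q \<bullet> cproj Y (L q) = 0"
      using L by (auto simp: compat_def)
    have Lb: "vf_apply L (b m) q = vf_apply (hyp X Y) (tcoeff Y m k) q" if q: "q \<in> ball 0 \<epsilon>" for m q
    proof -
      have "vf_apply L (b m) q = tcoeff Y m (vf_apply L h) q"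
        unfolding b_def by (rule tcoeff_vf[OF h l(1,3), symmetric])
      also have "\<dots> = tcoeff Y m (vf_apply (hyp X Y) k) q"
        by (rule tcoeff_cong[OF smooth_vf_apply[OF l(1) h] smooth_vf_apply[OF linear_hyp k(1)] k(2) q])
      finally show ?thesis by (simp add: thyp[OF k(1)])
    qed
    \<comment> \<open>\<open>L (a m)\<close> is the part of \<open>L h = X k\<close> of degree
      \<open>m\<close> in both \<open>x\<close> and \<open>y\<close>. On that bidegree
      \<open>hyp X Y\<close> acts as \<open>m - m = 0\<close>, so the part vanishes.\<close>
    have La: "vf_apply L (a m) q = 0" if q: "q \<in> ball 0 \<epsilon>" for m q
    proof -
      have ks: "smooth (tcoeff Y m k)" by (rule smooth_tcoeff[OF k(1)])
      have kks: "smooth (tcoeff X m (tcoeff Y m k))" by (rule smooth_tcoeff[OF ks])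
      have "vf_apply L (a m) q = tcoeff X m (vf_apply L (b m)) q"
        unfolding a_def by (rule tcoeff_vf[OF bs l(1,2), symmetric])
      also have "\<dots> = tcoeff X m (vf_apply (hyp X Y) (tcoeff Y m k)) q"
        by (rule tcoeff_cong[OF smooth_vf_apply[OF l(1) bs] smooth_vf_apply[OF linear_hyp ks] Lb q])
      also have "\<dots> = vf_apply (hyp X Y) (tcoeff X m (tcoeff Y m k)) q"
        by (rule tcoeff_vf[OF ks linear_hyp hyp_cscale_commute])
      also have "\<dots> = 0"
      proof -
        have y: "tcoeff X m (tcoeff Y m k) (cscale Y t p) = t ^ m * tcoeff X m (tcoeff Y m k) p" for t p
          by (rule trem_linear_comp(1)[OF ks linear_cscale cscale_commute one_neq_zero]) (rule tcoeff_homog[OF k(1)])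
        show ?thesis
          unfolding vf_apply_hyp[OF smooth_differentiable[OF kks]]
          using euler_homog[OF kks tcoeff_homog[OF ks]] euler_homog[OF kks y] by simp
      qed
      finally show ?thesis .
    qed
    have Lf0: "vf_apply L f0 q = 0" if q: "q \<in> ball 0 \<epsilon>" for q
      unfolding f0_def by (rule vf_apply_borel_zero[OF c1(1) \<theta>(1) as l(4) La[OF q]])
    have "vf_apply L G2 p = 0"
      by (rule G2(4)[OF L _ p]) (unfold E_def, rule Lhyp[OF L f0s Lf0])
    moreover have "vf_apply L f0 p = 0" using p \<epsilon> by (intro Lf0) simp
    ultimately show ?thesis by (simp add: hypf)
  qed
  show "splits_at (hyp X Y) {L. compat X Y L} \<epsilon> h"
  proof (rule splittingI[of "\<epsilon> / 8" \<epsilon> f G])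
    show "0 < \<epsilon> / 8" "\<epsilon> / 8 \<le> \<epsilon>" using \<epsilon> by auto
    show "smooth f" "smooth G" by (rule fs, rule Gs)
  next
    fix p :: 'a assume p: "p \<in> ball 0 (\<epsilon> / 8)"
    have "vf_apply (hyp X Y) G1 p = R p" using p by (intro G1(2)) simp
    then show "h p = f p + vf_apply (hyp X Y) G p" by (simp add: hypG R_def)
    have "vf_apply (hyp X Y) G2 p = E p" using p \<epsilon> by (intro G2(2)) simp
    then show "vf_apply (hyp X Y) f p = 0" by (simp add: hypf E_def)
  next
    fix L k and p :: 'a assume "L \<in> {L. compat X Y L}" "smooth k"
      "\<forall>p\<in>ball 0 \<epsilon>. vf_apply L h p = vf_apply (hyp X Y) k p" "p \<in> ball 0 (\<epsilon> / 8)"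
    then show "vf_apply L f p = 0" using \<epsilon> by (intro A[of L k]) auto
  next
    fix L and p :: 'a assume "L \<in> {L. compat X Y L}" and z: "\<forall>p\<in>ball 0 \<epsilon>. vf_apply L h p = 0" and p: "p \<in> ball 0 (\<epsilon> / 8)"
    then have L: "compat X Y L" by simp
    have l: "linear L" "\<And>t q. L (cscale X t q) = cscale X t (L q)" "\<And>t q. L (cscale Y t q) = cscale Y t (L q)" "\<And>q. cproj Y q \<bullet> cproj Y (L q) = 0"
      using L by (auto simp: compat_def)
    have Lb: "vf_apply L (b m) q = 0" if "q \<in> ball 0 \<epsilon>" for m q
      unfolding b_def using z that by (intro trem_vf_zero(1)[OF h l(1,3), of 1]) auto
    have LB: "vf_apply L (B m) q = 0" if "q \<in> ball 0 \<epsilon>" for m q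
      unfolding B_def by (rule euler_inv_vf_zero[OF bs l(1,2) Lb that])
    have LG0: "vf_apply L G0 q = 0" if q: "q \<in> ball 0 \<epsilon>" for q
      unfolding G0_def by (rule vf_apply_borel_zero[OF c2(1) \<theta>(1) Bs l(4) LB[OF q]])
    have z0: "smooth (\<lambda>_::'a. 0)" by (rule smooth_on_const[OF open_UNIV])
    have LR: "vf_apply L R q = 0" if q: "q \<in> ball 0 (\<epsilon> / 2)" for q
    proof -
      have q': "q \<in> ball 0 \<epsilon>" using q \<epsilon> by simp
      have "vf_apply L R q = vf_apply L (\<lambda>p. h p - f p) q - vf_apply L (vf_apply (hyp X Y) G0) q"
        unfolding R_def by (intro vf_apply_diff smooth_differentiable hfs XG0s)
      also have "vf_apply L (\<lambda>p. h p - f p) q = vf_apply L h q - vf_apply L f q"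
        by (intro vf_apply_diff smooth_differentiable h fs)
      \<comment> \<open>The first implication with \<open>k = 0\<close>.\<close>
      also have "vf_apply L f q = 0" by (rule A[OF L z0 _ q]) (use z in simp)
      finally show ?thesis using z q' Lhyp[OF L G0s LG0 q'] by simp
    qed
    have "vf_apply L G1 p = 0" by (rule G1(3)[OF L LR]) (use p \<epsilon> in auto)
    moreover have "vf_apply L G0 p = 0" using p \<epsilon> by (intro LG0) auto
    ultimately show "vf_apply L G p = 0" by (simp add: hypG)
  qed
qed

text \<open>Rodrigues' formula for \<open>exp (t J)\<close> when \<open>J\<close> cubed equals
  \<open>- J\<close>: a rotation on the range of \<open>J\<close>, the identity on its
  kernel.\<close>

definition rotation :: "('a::euclidean_space \<Rightarrow> 'a) \<Rightarrow> real \<Rightarrow> 'a \<Rightarrow> 'a" where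
  "rotation J t p = p + sin t *\<^sub>R J p + (1 - cos t) *\<^sub>R J (J p)"

lemma linear_rotation: "linear J \<Longrightarrow> linear (rotation J t)"
  by (rule linearI) (simp_all add: rotation_def linear_add linear_scale algebra_simps)

lemma norm_rotation:
  assumes J: "linear J" "\<And>p. J (J (J p)) = - J p" "\<And>p. p \<bullet> J p = 0"
  shows "norm (rotation J t p) = norm p"
proof -
  \<comment> \<open>Polarisation of \<open>p \<bullet> J p = 0\<close>.\<close>
  have sk: "p \<bullet> J q = - (q \<bullet> J p)" for p q
    using J(3)[of "p + q"] J(3) by (simp add: linear_add[OF J(1)] inner_add)
  have 1: "J p \<bullet> J (J p) = 0" "p \<bullet> J (J p) = - (J p \<bullet> J p)" using J(3) sk[of p "J p"] by auto
  have 2: "J (J p) \<bullet> J (J p) = J p \<bullet> J p" using sk[of "J (J p)" "J p"] J(2)[of p] by (simp add: inner_commute)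
  have "(p + s *\<^sub>R J p + (1 - c) *\<^sub>R J (J p)) \<bullet> (p + s *\<^sub>R J p + (1 - c) *\<^sub>R J (J p)) =
      p \<bullet> p + (s\<^sup>2 + c\<^sup>2 - 1) * (J p \<bullet> J p)" for s c :: real
    using J(3)[of p] 1 2 by (simp add: inner_add inner_commute algebra_simps power2_eq_square)
  from this[of "sin t" "cos t"] have "rotation J t p \<bullet> rotation J t p = p \<bullet> p" by (simp add: rotation_def)
  then show ?thesis by (simp add: norm_eq_sqrt_inner)
qed

lemma rotation_curve:
  assumes J: "linear J" "\<And>p. J (J (J p)) = - J p"
  shows "((\<lambda>t. rotation J t p) has_derivative (\<lambda>s. s *\<^sub>R J (rotation J t p))) (at t)"
proof -
  have h: "J (rotation J t p) = cos t *\<^sub>R J p + sin t *\<^sub>R J (J p)"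
    by (simp add: rotation_def linear_add[OF J(1)] linear_scale[OF J(1)] J(2)) (simp add: algebra_simps)
  show ?thesis unfolding h unfolding rotation_def
    by (auto intro!: derivative_eq_intros simp: algebra_simps)
qed

lemma smooth_rotation_prod:
  fixes h :: "'a::euclidean_space \<Rightarrow> real"
  assumes "smooth h" "linear J" shows "smooth (\<lambda>z. h (rotation J (\<omega> * fst z) (snd z)))"
proof (rule smooth_compose[OF assms(1)])
  fix c :: 'a
  have t: "smooth (\<lambda>z::real \<times> 'a. \<omega> * fst z)" by (intro smooth_intros)
  have l: "smooth (\<lambda>z::real \<times> 'a. J (snd z) \<bullet> c)" "smooth (\<lambda>z::real \<times> 'a. J (J (snd z)) \<bullet> c)"
    using smooth_linear'[of "\<lambda>z::real \<times> 'a. J (snd z) \<bullet> c"] smooth_linear'[of "\<lambda>z::real \<times> 'a. J (J (snd z)) \<bullet> c"]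
    by (auto simp: linear_iff linear_add[OF assms(2)] linear_scale[OF assms(2)] inner_add_left)
  have "smooth (\<lambda>z::real \<times> 'a. snd z \<bullet> c + sin (\<omega> * fst z) * (J (snd z) \<bullet> c) + (1 - cos (\<omega> * fst z)) * (J (J (snd z)) \<bullet> c))"
    by (intro smooth_intros l smooth_compose_real[OF smooth_sin_cos(1) t] smooth_compose_real[OF smooth_sin_cos(2) t])
  then show "smooth (\<lambda>z. rotation J (\<omega> * fst z) (snd z) \<bullet> c)" by (simp add: rotation_def inner_add_left)
qed

theorem splitting_rotation:
  fixes J :: "'a::euclidean_space \<Rightarrow> 'a"
  assumes J: "linear J" "\<And>p. J (J (J p)) = - J p" "\<And>p. p \<bullet> J p = 0" and c: "c \<noteq> 0"
  shows "splitting (\<lambda>p. c *\<^sub>R J p) {L. linear L \<and> (\<forall>p. L (J p) = J (L p))}"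
  unfolding splitting_def
proof (intro allI impI)
  fix \<epsilon> :: real and h :: "'a \<Rightarrow> real" assume \<epsilon>: "\<epsilon> > 0" and h: "smooth h"
  define \<Phi> where "\<Phi> k z = k (rotation J (2 * pi * fst z) (snd z))" for k :: "'a \<Rightarrow> real" and z
  have \<Phi>s: "smooth (\<Phi> k)" if "smooth k" for k unfolding \<Phi>_def by (rule smooth_rotation_prod[OF that J(1)])
  define f where "f p = integral {0..1} (\<lambda>t. \<Phi> h (t, p))" for p
  \<comment> \<open>Integrating \<open>t\<close> times the derivative of \<open>h\<close> along the
    orbit by parts over one period leaves the endpoint value \<open>h p\<close> minus the average
    \<open>f p\<close>. The weight undoes the speed \<open>2 * pi\<close> of the orbit and the
    factor \<open>c\<close> of the field.\<close>
  define G where "G p = integral {0..1} (\<lambda>t. (2 * pi / c * t) * \<Phi> h (t, p))" for p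
  have fs: "smooth f" unfolding f_def by (rule smooth_integral[OF \<Phi>s[OF h]])
  have \<Phi>2: "smooth (\<lambda>z. (2 * pi / c * fst z) * \<Phi> h z)" by (intro smooth_intros \<Phi>s h)
  have Gs: "smooth G" using smooth_integral[OF \<Phi>2] by (simp add: G_def[abs_def])
  have XJ: "vf_apply (\<lambda>p. c *\<^sub>R J p) k p = c * vf_apply J k p" if "smooth k" for k p
    by (simp add: vf_apply_expand[OF smooth_differentiable[OF that]] sum_distrib_left mult.assoc)
  have L\<Phi>: "vf_apply L (\<lambda>q. \<Phi> k (t, q)) p = vf_apply L k (rotation J (2 * pi * t) p)"
    if "linear L" "\<And>p. L (J p) = J (L p)" "smooth k" for L k t p
    unfolding \<Phi>_def fst_conv snd_conv
    by (rule vf_apply_linear_comp[OF linear_rotation[OF J(1)] smooth_differentiable[OF that(3)]])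
       (simp add: rotation_def linear_add[OF that(1)] linear_scale[OF that(1)] that(2))
  have J\<Phi>: "((\<lambda>t. \<Phi> k (t, p)) has_real_derivative 2 * pi * vf_apply J k (rotation J (2 * pi * t) p)) (at t)" if k: "smooth k" for k p t
  proof -
    have "((\<lambda>t. k (rotation J t p)) has_real_derivative vf_apply J k (rotation J (2 * pi * t) p)) (at (2 * pi * t))"
      by (rule curve_derivative[OF k rotation_curve[OF J(1,2)]]) simp
    moreover have "((\<lambda>t. 2 * pi * t) has_real_derivative 2 * pi) (at t)" by (auto intro!: derivative_eq_intros)
    ultimately have "((\<lambda>t. k (rotation J (2 * pi * t) p)) has_real_derivative vf_apply J k (rotation J (2 * pi * t) p) * (2 * pi)) (at t)"
      by (rule DERIV_chain2[where f = "\<lambda>t. k (rotation J t p)" and g = "\<lambda>t. 2 * pi * t"])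
    then show ?thesis by (simp add: \<Phi>_def mult.commute)
  qed
  have rot1: "\<Phi> k (1, p) = k p" "\<Phi> k (0, p) = k p" for k p by (simp_all add: \<Phi>_def rotation_def)
  \<comment> \<open>The derivative along a closed orbit has mean zero. This yields both the
    invariance of \<open>f\<close> and the first implication.\<close>
  have avg0: "integral {0..1} (\<lambda>t. vf_apply J k (rotation J (2 * pi * t) p)) = 0" if k: "smooth k" for k p
  proof -
    have "((\<lambda>t. 2 * pi * vf_apply J k (rotation J (2 * pi * t) p)) has_integral (\<Phi> k (1, p) - \<Phi> k (0, p))) {0..1}"
      using J\<Phi>[OF k] by (intro fundamental_theorem_of_calculus)
        (auto simp: has_real_derivative_iff_has_vector_derivative intro: has_vector_derivative_at_within)
    from integral_unique[OF this] show ?thesis by (simp add: rot1)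
  qed
  have Lf: "vf_apply L f p = integral {0..1} (\<lambda>t. vf_apply L h (rotation J (2 * pi * t) p))"
    if "linear L" "\<And>p. L (J p) = J (L p)" for L p
    unfolding f_def vf_apply_integral[OF \<Phi>s[OF h]] L\<Phi>[OF that h] ..
  have LG: "vf_apply L G p = integral {0..1} (\<lambda>t. (2 * pi / c * t) * vf_apply L h (rotation J (2 * pi * t) p))"
    if "linear L" "\<And>p. L (J p) = J (L p)" for L p
  proof -
    have "vf_apply L (\<lambda>q. (2 * pi / c * t) * \<Phi> h (t, q)) p = (2 * pi / c * t) * vf_apply L h (rotation J (2 * pi * t) p)" for t
      using vf_apply_mult[of "\<lambda>_. 2 * pi / c * t" p "\<lambda>q. \<Phi> h (t, q)" L] smooth_differentiable[OF smooth_section[OF \<Phi>s[OF h]]]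
      by (simp add: L\<Phi>[OF that h])
    then show ?thesis using vf_apply_integral[OF \<Phi>2, of L p] by (simp add: G_def[abs_def])
  qed
  \<comment> \<open>Rotations preserve balls about 0, so here
    \<open>\<delta> = \<epsilon>\<close>.\<close>
  have ball: "rotation J t p \<in> ball 0 \<epsilon>" if "p \<in> ball 0 \<epsilon>" for t p using that norm_rotation[OF J] by simp
  show "splits_at (\<lambda>p. c *\<^sub>R J p) {L. linear L \<and> (\<forall>p. L (J p) = J (L p))} \<epsilon> h"
  proof (rule splittingI[of "\<epsilon>" \<epsilon> f G])
    show "0 < \<epsilon>" "\<epsilon> \<le> \<epsilon>" "smooth f" "smooth G" using \<epsilon> fs Gs by auto
  next
    fix p :: 'a
    show "vf_apply (\<lambda>p. c *\<^sub>R J p) f p = 0" by (simp add: XJ[OF fs] Lf[OF J(1)] avg0[OF h])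
    have "((\<lambda>t. 1 * \<Phi> h (t, p) + t * (2 * pi * vf_apply J h (rotation J (2 * pi * t) p))) has_integral (1 * \<Phi> h (1, p) - 0 * \<Phi> h (0, p))) {0..1}"
    proof (rule fundamental_theorem_of_calculus)
      fix t :: real
      have "((\<lambda>t. t * \<Phi> h (t, p)) has_real_derivative 1 * \<Phi> h (t, p) + t * (2 * pi * vf_apply J h (rotation J (2 * pi * t) p))) (at t)"
        by (rule derivative_eq_intros J\<Phi>[OF h] refl | simp)+
      then show "((\<lambda>t. t * \<Phi> h (t, p)) has_vector_derivative 1 * \<Phi> h (t, p) + t * (2 * pi * vf_apply J h (rotation J (2 * pi * t) p))) (at t within {0..1})"
        by (simp add: has_real_derivative_iff_has_vector_derivative has_vector_derivative_at_within)
    qed simp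
    moreover have "((\<lambda>t. \<Phi> h (t, p)) has_integral f p) {0..1}"
      unfolding f_def by (intro integrable_integral integrable_continuous_real section_continuous \<Phi>s h)
    ultimately have "((\<lambda>t. (1 * \<Phi> h (t, p) + t * (2 * pi * vf_apply J h (rotation J (2 * pi * t) p))) - \<Phi> h (t, p))
        has_integral ((1 * \<Phi> h (1, p) - 0 * \<Phi> h (0, p)) - f p)) {0..1}"
      by (rule has_integral_diff)
    then have "((\<lambda>t. t * (2 * pi * vf_apply J h (rotation J (2 * pi * t) p))) has_integral (h p - f p)) {0..1}"
      by (simp add: rot1)
    from has_integral_mult_right[OF this, of "1 / c"]
    have "((\<lambda>t. (2 * pi / c * t) * vf_apply J h (rotation J (2 * pi * t) p)) has_integral (1 / c * (h p - f p))) {0..1}"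
      by (simp add: mult_ac)
    from integral_unique[OF this] have "vf_apply J G p = 1 / c * (h p - f p)" by (simp add: LG[OF J(1)])
    then show "h p = f p + vf_apply (\<lambda>p. c *\<^sub>R J p) G p" using c by (simp add: XJ[OF Gs])
  next
    fix L k and p :: 'a assume L: "L \<in> {L. linear L \<and> (\<forall>p. L (J p) = J (L p))}" and k: "smooth k"
      and e: "\<forall>p\<in>ball 0 \<epsilon>. vf_apply L h p = vf_apply (\<lambda>p. c *\<^sub>R J p) k p" and p: "p \<in> ball 0 \<epsilon>"
    have "vf_apply L f p = integral {0..1} (\<lambda>t. vf_apply L h (rotation J (2 * pi * t) p))" using L by (intro Lf) auto
    also have "\<dots> = integral {0..1} (\<lambda>t. c * vf_apply J k (rotation J (2 * pi * t) p))"
      using e ball[OF p] by (intro integral_cong) (simp add: XJ[OF k])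
    finally show "vf_apply L f p = 0" by (simp add: avg0[OF k])
  next
    fix L and p :: 'a assume L: "L \<in> {L. linear L \<and> (\<forall>p. L (J p) = J (L p))}"
      and e: "\<forall>p\<in>ball 0 \<epsilon>. vf_apply L h p = 0" and p: "p \<in> ball 0 \<epsilon>"
    have "vf_apply L G p = integral {0..1} (\<lambda>t. (2 * pi / c * t) * vf_apply L h (rotation J (2 * pi * t) p))" using L by (intro LG) auto
    also have "\<dots> = integral {0..1} (\<lambda>t::real. 0::real)" using e ball[OF p] by (intro integral_cong) simp
    finally show "vf_apply L G p = 0" by simp
  qed
qed

section \<open>Families of commuting fields\<close>

lemma splittingE:
  fixes X :: "'a::euclidean_space \<Rightarrow> 'a"
  assumes "splitting X \<L>" "\<epsilon> > 0" "smooth h"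
  obtains \<delta> f G where "0 < \<delta>" "\<delta> \<le> \<epsilon>" "smooth f" "smooth G"
    "\<And>p. p \<in> ball 0 \<delta> \<Longrightarrow> h p = f p + vf_apply X G p" "\<And>p. p \<in> ball 0 \<delta> \<Longrightarrow> vf_apply X f p = 0"
    "\<And>L k p. L \<in> \<L> \<Longrightarrow> smooth k \<Longrightarrow> (\<forall>p\<in>ball 0 \<epsilon>. vf_apply L h p = vf_apply X k p) \<Longrightarrow> p \<in> ball 0 \<delta> \<Longrightarrow> vf_apply L f p = 0"
    "\<And>L p. L \<in> \<L> \<Longrightarrow> (\<forall>p\<in>ball 0 \<epsilon>. vf_apply L h p = 0) \<Longrightarrow> p \<in> ball 0 \<delta> \<Longrightarrow> vf_apply L G p = 0"
proof -
  obtain \<delta> f G where *: "0 < \<delta>" "\<delta> \<le> \<epsilon>" "smooth f" "smooth G"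
    "\<forall>p\<in>ball 0 \<delta>. h p = f p + vf_apply X G p \<and> vf_apply X f p = 0"
    "\<forall>L\<in>\<L>. (\<forall>k. smooth k \<longrightarrow> (\<forall>p\<in>ball 0 \<epsilon>. vf_apply L h p = vf_apply X k p) \<longrightarrow> (\<forall>p\<in>ball 0 \<delta>. vf_apply L f p = 0)) \<and>
        ((\<forall>p\<in>ball 0 \<epsilon>. vf_apply L h p = 0) \<longrightarrow> (\<forall>p\<in>ball 0 \<delta>. vf_apply L G p = 0))"
    using assms unfolding splitting_def splits_at_def by (elim allE[of _ \<epsilon>] allE[of _ h] impE exE conjE)
  show thesis
  proof (rule that[OF *(1-4)])
    fix L k and p :: 'a assume "L \<in> \<L>" "smooth k" "\<forall>p\<in>ball 0 \<epsilon>. vf_apply L h p = vf_apply X k p" "p \<in> ball 0 \<delta>"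
    then show "vf_apply L f p = 0" using *(6) by blast
  next
    fix L and p :: 'a assume "L \<in> \<L>" "\<forall>p\<in>ball 0 \<epsilon>. vf_apply L h p = 0" "p \<in> ball 0 \<delta>"
    then show "vf_apply L G p = 0" using *(6) by blast
  qed (use *(5) in blast)+
qed

text \<open>Induction on the number of treated fields: the first \<open>m\<close> corrected
  functions are invariant under all \<open>r\<close> fields, including those not yet
  treated.\<close>

theorem closed_family_splits:
  fixes X :: "nat \<Rightarrow> 'a::euclidean_space \<Rightarrow> 'a"
  assumes lin: "\<And>i. i \<in> {1..r} \<Longrightarrow> linear (X i)"
    and comm: "\<And>i j p. i \<in> {1..r} \<Longrightarrow> j \<in> {1..r} \<Longrightarrow> X i (X j p) = X j (X i p)"
    and spl: "\<And>i. i \<in> {1..r} \<Longrightarrow> \<exists>\<L>. splitting (X i) \<L> \<and> (\<forall>j\<in>{1..r}. j \<noteq> i \<longrightarrow> X j \<in> \<L>)"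
    and \<epsilon>: "\<epsilon> > 0" and g: "\<And>i. i \<in> {1..r} \<Longrightarrow> smooth (g i)"
    and closed: "\<And>i j p. i \<in> {1..r} \<Longrightarrow> j \<in> {1..r} \<Longrightarrow> p \<in> ball 0 \<epsilon> \<Longrightarrow> vf_apply (X i) (g j) p = vf_apply (X j) (g i) p"
  shows "\<exists>\<delta> G. 0 < \<delta> \<and> \<delta> \<le> \<epsilon> \<and> smooth G \<and>
    (\<forall>i\<in>{1..r}. \<forall>j\<in>{1..r}. \<forall>p\<in>ball 0 \<delta>. vf_apply (X j) (\<lambda>p. g i p - vf_apply (X i) G p) p = 0)"
proof -
  have "\<exists>\<delta> G. 0 < \<delta> \<and> \<delta> \<le> \<epsilon> \<and> smooth G \<and>
    (\<forall>i\<in>{1..m}. \<forall>j\<in>{1..r}. \<forall>p\<in>ball 0 \<delta>. vf_apply (X j) (\<lambda>p. g i p - vf_apply (X i) G p) p = 0)" if "m \<le> r" for m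
    using that
  proof (induction m)
    case 0
    have "smooth (\<lambda>_::'a. 0)" by (rule smooth_on_const[OF open_UNIV])
    then show ?case using \<epsilon> by (intro exI[of _ \<epsilon>] exI[of _ "\<lambda>_. 0"]) auto
  next
    case (Suc m)
    then obtain \<delta> G where \<delta>: "0 < \<delta>" "\<delta> \<le> \<epsilon>" and G: "smooth G"
      and inv: "\<And>i j p. i \<in> {1..m} \<Longrightarrow> j \<in> {1..r} \<Longrightarrow> p \<in> ball 0 \<delta> \<Longrightarrow> vf_apply (X j) (\<lambda>p. g i p - vf_apply (X i) G p) p = 0"
      by auto
    define h where "h i p = g i p - vf_apply (X i) G p" for i p
    define i where "i = Suc m"
    have i: "i \<in> {1..r}" using Suc.prems by (simp add: i_def)
    have XG: "smooth (vf_apply (X j) G)" if "j \<in> {1..r}" for j by (rule smooth_vf_apply[OF lin[OF that] G])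
    have hs: "smooth (h j)" if "j \<in> {1..r}" for j unfolding h_def by (intro smooth_intros g XG that)
    have hX: "vf_apply L (h j) p = vf_apply L (g j) p - vf_apply L (vf_apply (X j) G) p" if "j \<in> {1..r}" for L j p
      unfolding h_def by (intro vf_apply_diff smooth_differentiable g XG that)
    \<comment> \<open>Subtracting the functions \<open>X j (G)\<close> preserves closedness because
      the fields commute.\<close>
    have hclosed: "vf_apply (X j) (h k) p = vf_apply (X k) (h j) p"
      if "j \<in> {1..r}" "k \<in> {1..r}" "p \<in> ball 0 \<delta>" for j k p
      using that \<delta>(2) closed[of j k p] vf_apply_commute[OF lin[OF that(1)] lin[OF that(2)] G comm[OF that(1,2)], of p] by (simp add: hX)
    obtain \<L> where \<L>: "splitting (X i) \<L>" "\<And>j. j \<in> {1..r} \<Longrightarrow> j \<noteq> i \<Longrightarrow> X j \<in> \<L>" using spl[OF i] by blast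
    obtain \<delta>' f G' where \<delta>': "0 < \<delta>'" "\<delta>' \<le> \<delta>" and f: "smooth f" and G': "smooth G'"
      and dec: "\<And>p. p \<in> ball 0 \<delta>' \<Longrightarrow> h i p = f p + vf_apply (X i) G' p"
      and Xf: "\<And>p. p \<in> ball 0 \<delta>' \<Longrightarrow> vf_apply (X i) f p = 0"
      and Lf: "\<And>L k p. L \<in> \<L> \<Longrightarrow> smooth k \<Longrightarrow> (\<forall>p\<in>ball 0 \<delta>. vf_apply L (h i) p = vf_apply (X i) k p) \<Longrightarrow> p \<in> ball 0 \<delta>' \<Longrightarrow> vf_apply L f p = 0"
      and LG: "\<And>L p. L \<in> \<L> \<Longrightarrow> (\<forall>p\<in>ball 0 \<delta>. vf_apply L (h i) p = 0) \<Longrightarrow> p \<in> ball 0 \<delta>' \<Longrightarrow> vf_apply L G' p = 0"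
      by (rule splittingE[OF \<L>(1) \<delta>(1) hs[OF i]]) (rule that)
    define G'' where "G'' p = G p + G' p" for p
    have G''s: "smooth G''" unfolding G''_def by (intro smooth_intros G G')
    have G''X: "g j p - vf_apply (X j) G'' p = h j p - vf_apply (X j) G' p" for j p
      unfolding G''_def h_def using vf_apply_add[OF smooth_differentiable[OF G] smooth_differentiable[OF G']] by simp
    have "vf_apply (X l) (\<lambda>p. g j p - vf_apply (X j) G'' p) p = 0"
      if j: "j \<in> {1..Suc m}" and l: "l \<in> {1..r}" and p: "p \<in> ball 0 \<delta>'" for j l p
    proof (cases "j = i")
      case True
      have "vf_apply (X l) (\<lambda>p. g j p - vf_apply (X j) G'' p) p = vf_apply (X l) f p"
        by (rule vf_apply_cong[OF open_ball p]) (simp add: G''X True dec)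
      \<comment> \<open>For \<open>l \<noteq> i\<close> closedness reads
        \<open>X l (h i) = X i (h l)\<close>, which is the first implication with
        \<open>k = h l\<close>.\<close>
      also have "\<dots> = 0"
      proof (cases "l = i")
        case True then show ?thesis using Xf p by simp
      next
        case False
        show ?thesis
          by (rule Lf[OF \<L>(2)[OF l False] hs[OF l] _ p]) (use hclosed[OF l i] in blast)
      qed
      finally show ?thesis .
    next
      case False
      then have j': "j \<in> {1..m}" "j \<in> {1..r}" using j Suc.prems by (auto simp: i_def)
      have hj: "vf_apply (X k) (h j) q = 0" if "k \<in> {1..r}" "q \<in> ball 0 \<delta>" for k q
        using inv[OF j'(1) that] by (simp add: h_def[abs_def])
      \<comment> \<open>For an earlier index closedness gives
        \<open>X j (h i) = X i (h j) = 0\<close>; the second implication then shows that the new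
        correction \<open>X j (G')\<close> vanishes, so \<open>h j\<close> stays as it was.\<close>
      have "\<forall>q\<in>ball 0 \<delta>. vf_apply (X j) (h i) q = 0"
        using hclosed[OF j'(2) i] hj[OF i] by simp
      from LG[OF \<L>(2)[OF j'(2) False] this]
      have "vf_apply (X l) (\<lambda>p. g j p - vf_apply (X j) G'' p) p = vf_apply (X l) (h j) p"
        by (intro vf_apply_cong[OF open_ball p]) (simp add: G''X)
      also have "\<dots> = 0" using p \<delta>'(2) by (intro hj[OF l]) simp
      finally show ?thesis .
    qed
    then show ?case using \<delta>' \<delta>(2) G''s by (intro exI[of _ \<delta>'] exI[of _ G'']) auto
  qed
  from this[OF order_refl] show ?thesis .
qed

section \<open>From germs to global functions\<close>

lemma smooth_on_globalize:
  fixes g :: "'a::euclidean_space \<Rightarrow> real"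
  assumes g: "smooth_on (ball 0 R) g" and R: "R > 0"
  obtains h where "smooth h" "\<And>p. p \<in> ball 0 (R / 3) \<Longrightarrow> h p = g p"
proof -
  obtain \<theta> :: "real \<Rightarrow> real" where \<theta>: "smooth \<theta>" "\<And>u. u \<le> 1/2 \<Longrightarrow> \<theta> u = 1" "\<And>u. u \<ge> 1 \<Longrightarrow> \<theta> u = 0"
    using bump_exists by blast
  \<comment> \<open>The cutoff is 1 for \<open>norm p < R / 3\<close>, as 4/9 is below 1/2, and 0
    for \<open>norm p \<ge> R / 2\<close>. The ball of radius \<open>R\<close> and the set
    \<open>norm p > 2 / 3 * R\<close> form an open cover on which smoothness is checked
    separately.\<close>
  define c where "c = 4 / R\<^sup>2"
  have c: "c > 0" using R by (simp add: c_def)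
  have cproj: "cproj UNIV p = p" for p :: 'a by (simp add: cproj_def euclidean_representation)
  have n: "nsq UNIV p = (norm p)\<^sup>2" for p :: 'a by (simp add: nsq_norm cproj)
  define h where "h p = \<theta> (c * nsq UNIV p) * g p" for p
  have cut: "smooth (\<lambda>p. \<theta> (c * nsq UNIV p))" by (intro smooth_compose_real[OF \<theta>(1)] smooth_intros smooth_nsq)
  have "smooth_on (ball 0 R) h" unfolding h_def
    by (intro smooth_on_mult open_ball g smooth_on_mono[OF cut open_UNIV open_ball]) auto
  moreover have "smooth_on {p. norm p > 2 / 3 * R} h"
  proof (rule smooth_on_cong[OF smooth_on_const[of _ 0]])
    show o: "open {p::'a. norm p > 2 / 3 * R}" by (intro open_Collect_less continuous_intros)
    then show "open {p::'a. norm p > 2 / 3 * R}" .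
    fix p :: 'a assume "p \<in> {p. norm p > 2 / 3 * R}"
    then have "(2 / 3 * R)\<^sup>2 \<le> (norm p)\<^sup>2" using R by (intro power_mono) auto
    then have "c * (2 / 3 * R)\<^sup>2 \<le> c * (norm p)\<^sup>2" using c by simp
    moreover have "c * (2 / 3 * R)\<^sup>2 \<ge> 1" using R by (simp add: c_def power_mult_distrib power_divide)
    ultimately have "\<theta> (c * (norm p)\<^sup>2) = 0" by (intro \<theta>(3)) simp
    then show "0 = h p" by (simp add: h_def n)
  qed
  moreover have "open {p::'a. norm p > 2 / 3 * R}" by (intro open_Collect_less continuous_intros)
  ultimately have "smooth_on (ball 0 R \<union> {p. norm p > 2 / 3 * R}) h" by (intro smooth_on_Un open_ball)
  moreover have "ball 0 R \<union> {p::'a. norm p > 2 / 3 * R} = UNIV" using R by auto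
  ultimately have "smooth h" by simp
  moreover have "h p = g p" if "p \<in> ball 0 (R / 3)" for p
  proof -
    have "(norm p)\<^sup>2 \<le> (R / 3)\<^sup>2" using that by (intro power_mono) auto
    then have "c * (norm p)\<^sup>2 \<le> c * (R / 3)\<^sup>2" using c by simp
    also have "\<dots> \<le> 1/2" using R by (simp add: c_def power_divide)
    finally show ?thesis by (simp add: h_def n \<theta>(2))
  qed
  ultimately show thesis using that by blast
qed

section \<open>The Williamson fields\<close>

lemma xc_inner: "xc e k p = p \<bullet> ex e k" and yc_inner: "yc e k p = p \<bullet> ey e k"
  by (simp_all add: xc_def yc_def ex_def ey_def inner_prod_def inner_axis)

lemma ex_Basis: "ex e k \<in> Basis" and ey_Basis: "ey e k \<in> Basis"
  by (auto simp: ex_def ey_def Basis_prod_def axis_in_Basis_iff)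

lemma ex_ey_neq: "ex e k \<noteq> ey e l"
  by (auto simp: ex_def ey_def)

lemma ex_ey_inner:
  assumes "inj_on e I" "k \<in> I" "l \<in> I"
  shows "ex e k \<bullet> ex e l = (if k = l then 1 else 0)" "ey e k \<bullet> ey e l = (if k = l then 1 else 0)"
    "ex e k \<bullet> ey e l = 0" "ey e k \<bullet> ex e l = 0"
  using assms by (auto simp: ex_def ey_def inner_prod_def inner_axis_axis inj_on_eq_iff)

lemma ex_eq_iff: "ex e k = ex e l \<longleftrightarrow> e k = e l" and ey_eq_iff: "ey e k = ey e l \<longleftrightarrow> e k = e l"
  by (simp_all add: ex_def ey_def axis_eq_axis)

lemma cproj_eq_sum: "B \<subseteq> Basis \<Longrightarrow> cproj B p = (\<Sum>b\<in>B. (p \<bullet> b) *\<^sub>R b)"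
  by (simp add: cproj_def if_distrib if_distribR sum.If_cases Int_absorb1 cong: if_cong)

text \<open>\<open>L\<close> writes only into the coordinate planes indexed by \<open>K\<close> and
  reads only from them. Linear fields local to disjoint index sets therefore compose to zero in
  either order.\<close>

definition local_to :: "(nat \<Rightarrow> 'n::finite) \<Rightarrow> nat set \<Rightarrow> ('n pt \<Rightarrow> 'n pt) \<Rightarrow> bool" where
  "local_to e K L \<longleftrightarrow> (\<exists>a b. \<forall>p. L p = (\<Sum>k\<in>K. a k p *\<^sub>R ex e k + b k p *\<^sub>R ey e k)) \<and>
     (\<forall>p q. (\<forall>k\<in>K. p \<bullet> ex e k = q \<bullet> ex e k \<and> p \<bullet> ey e k = q \<bullet> ey e k) \<longrightarrow> L p = L q)"

lemma local_to_inner: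
  assumes "local_to e K L" "inj_on e I" "K \<subseteq> I" "k \<in> I" "k \<notin> K"
  shows "L p \<bullet> ex e k = 0" "L p \<bullet> ey e k = 0"
proof -
  obtain a b where ab: "L p = (\<Sum>k\<in>K. a k p *\<^sub>R ex e k + b k p *\<^sub>R ey e k)"
    using assms(1) unfolding local_to_def by blast
  have "(a l p *\<^sub>R ex e l + b l p *\<^sub>R ey e l) \<bullet> ex e k = 0" "(a l p *\<^sub>R ex e l + b l p *\<^sub>R ey e l) \<bullet> ey e k = 0" if "l \<in> K" for l
    using that assms ex_ey_inner[OF assms(2), of l k] by (auto simp: inner_add_left)
  then show "L p \<bullet> ex e k = 0" "L p \<bullet> ey e k = 0" unfolding ab inner_sum_left by auto
qed

lemma local_to_disjoint:
  assumes "local_to e K' L" "inj_on e I" "K \<subseteq> I" "K' \<subseteq> I" "K \<inter> K' = {}" "k \<in> K"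
  shows "L p \<bullet> ex e k = 0 \<and> L p \<bullet> ey e k = 0"
proof -
  have "k \<in> I" "k \<notin> K'" using assms by auto
  from local_to_inner[OF assms(1,2,4) this] show ?thesis by blast
qed

lemma local_to_eq: "local_to e K L \<Longrightarrow> (\<And>k. k \<in> K \<Longrightarrow> p \<bullet> ex e k = q \<bullet> ex e k \<and> p \<bullet> ey e k = q \<bullet> ey e k) \<Longrightarrow> L p = L q"
  unfolding local_to_def by blast

lemma local_commute:
  assumes loc: "local_to e K L" "local_to e K' L'" and e: "inj_on e I" "K \<subseteq> I" "K' \<subseteq> I"
    and dis: "K \<inter> K' = {}" and lin: "linear L" "linear L'"
  shows "L (L' p) = L' (L p)"
proof -
  have dis': "K' \<inter> K = {}" using dis by blast
  have "L (L' p) = L 0"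
  proof (rule local_to_eq[OF loc(1)])
    fix k assume "k \<in> K"
    from local_to_disjoint[OF loc(2) e dis this, of p]
    show "L' p \<bullet> ex e k = 0 \<bullet> ex e k \<and> L' p \<bullet> ey e k = 0 \<bullet> ey e k" by simp
  qed
  moreover have "L' (L p) = L' 0"
  proof (rule local_to_eq[OF loc(2)])
    fix k assume "k \<in> K'"
    from local_to_disjoint[OF loc(1) e(1,3,2) dis' this, of p]
    show "L p \<bullet> ex e k = 0 \<bullet> ex e k \<and> L p \<bullet> ey e k = 0 \<bullet> ey e k" by simp
  qed
  ultimately show ?thesis using lin by (simp add: linear_0)
qed

text \<open>\<open>L\<close> neither reads nor changes the coordinates in \<open>K\<close>, so
  dilating them makes no difference and both projections of \<open>L q\<close> vanish.\<close>

lemma local_compat: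
  assumes loc: "local_to e K' L" and e: "inj_on e I" "K \<subseteq> I" "K' \<subseteq> I" and dis: "K \<inter> K' = {}" and lin: "linear L"
  shows "compat (ex e ` K) (ey e ` K) L"
proof -
  have *: "L (cscale B t q) = cscale B t (L q) \<and> cproj B (L q) = 0" if B: "B = ex e ` K \<or> B = ey e ` K" for B t q
  proof -
    have Bb: "B \<subseteq> Basis" using B ex_Basis ey_Basis by auto
    have "L q \<bullet> b = 0" if bB: "b \<in> B" for b q
    proof -
      obtain k where "k \<in> K" "b = ex e k \<or> b = ey e k" using bB B by blast
      then show ?thesis using local_to_disjoint[OF loc e dis] by metis
    qed
    then have p0: "cproj B (L q) = 0" for q unfolding cproj_eq_sum[OF Bb] by (simp add: sum.neutral)
    have nB: "ex e k \<notin> B" "ey e k \<notin> B" if "k \<in> K'" for k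
    proof -
      have "k \<in> I" "k \<notin> K" using that e dis by auto
      then have "e k \<notin> e ` K" using e(1,2) by (auto dest: inj_onD)
      then show "ex e k \<notin> B" "ey e k \<notin> B"
        using B ex_ey_neq[of e] by (auto simp: ex_eq_iff ey_eq_iff image_iff) metis+
    qed
    have "L (cscale B t q) = L q"
      by (rule local_to_eq[OF loc]) (simp add: cscale_inner ex_Basis ey_Basis nB)
    moreover have "cscale B t (L q) = L q" by (simp add: cscale_def p0)
    ultimately show ?thesis using p0 by simp
  qed
  show ?thesis unfolding compat_def using * lin by auto
qed

text \<open>The coordinate planes that the \<open>i\<close>-th field involves, with
  \<open>s = ke + kh\<close>: beyond \<open>s\<close>, an odd offset marks the first field of a
  focus-focus pair and an even one the second.\<close>

definition block :: "nat \<Rightarrow> nat \<Rightarrow> nat set" where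
  "block s i = (if i \<le> s then {i} else if odd (i - s) then {i, Suc i} else {i - 1, i})"

lemma block_disjoint:
  assumes "i \<noteq> j" "\<not> (s < i \<and> odd (i - s) \<and> j = Suc i)" "\<not> (s < j \<and> odd (j - s) \<and> i = Suc j)"
  shows "block s i \<inter> block s j = {}"
proof -
  have "i \<le> s \<or> (\<exists>m. i = s + 2 * m + 1) \<or> (\<exists>m. i = s + 2 * m + 2)" for i by presburger
  from this[of i] this[of j] show ?thesis using assms
    by (elim disjE exE) (auto simp: block_def)
qed

lemma block_subset:
  assumes "i \<in> {1..s + 2 * kf}" shows "block s i \<subseteq> {1..s + 2 * kf}"
proof -
  have "i \<le> s \<or> (\<exists>m. i = s + 2 * m + 1) \<or> (\<exists>m. i = s + 2 * m + 2)" by presburger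
  then show ?thesis using assms by (elim disjE exE) (auto simp: block_def, presburger)
qed

lemma hamVF_elliptic:
  "1 \<le> i \<Longrightarrow> i \<le> ke \<Longrightarrow> hamVF e ke kh kf i p = 2 *\<^sub>R (- (p \<bullet> ey e i) *\<^sub>R ex e i + (p \<bullet> ex e i) *\<^sub>R ey e i)"
  by (simp add: hamVF_def xc_inner yc_inner)

lemma hamVF_hyperbolic:
  "ke < i \<Longrightarrow> i \<le> ke + kh \<Longrightarrow> hamVF e ke kh kf i p = - (p \<bullet> ex e i) *\<^sub>R ex e i + (p \<bullet> ey e i) *\<^sub>R ey e i"
  by (simp add: hamVF_def xc_inner yc_inner)

lemma hamVF_focus1:
  "ke + kh < i \<Longrightarrow> i \<le> ke + kh + 2 * kf \<Longrightarrow> odd (i - (ke + kh)) \<Longrightarrow>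
   hamVF e ke kh kf i p = - (p \<bullet> ex e i) *\<^sub>R ex e i + (p \<bullet> ey e i) *\<^sub>R ey e i
     + - (p \<bullet> ex e (Suc i)) *\<^sub>R ex e (Suc i) + (p \<bullet> ey e (Suc i)) *\<^sub>R ey e (Suc i)"
  by (simp add: hamVF_def Let_def xc_inner yc_inner)

lemma hamVF_focus2:
  "ke + kh < i \<Longrightarrow> Suc i \<le> ke + kh + 2 * kf \<Longrightarrow> odd (i - (ke + kh)) \<Longrightarrow>
   hamVF e ke kh kf (Suc i) p = - (p \<bullet> ex e i) *\<^sub>R ex e (Suc i) + (p \<bullet> ey e (Suc i)) *\<^sub>R ey e i
     + (p \<bullet> ex e (Suc i)) *\<^sub>R ex e i + - (p \<bullet> ey e i) *\<^sub>R ey e (Suc i)"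
  by (simp add: hamVF_def Let_def xc_inner yc_inner Suc_diff_le)

lemma hamVF_cases:
  assumes "i \<in> {1..ke + kh + 2 * kf}"
  obtains (elliptic) "1 \<le> i" "i \<le> ke" | (hyperbolic) "ke < i" "i \<le> ke + kh"
    | (focus1) "ke + kh < i" "Suc i \<le> ke + kh + 2 * kf" "odd (i - (ke + kh))"
    | (focus2) a where "i = Suc a" "ke + kh < a" "Suc a \<le> ke + kh + 2 * kf" "odd (a - (ke + kh))"
proof -
  have "i \<le> ke + kh \<or> (\<exists>m. i = ke + kh + 2 * m + 1) \<or> (\<exists>m. i = ke + kh + 2 * m + 2)" by presburger
  then show thesis
  proof (elim disjE exE)
    assume "i \<le> ke + kh" then show thesis using assms that(1,2) by force
  next
    fix m assume "i = ke + kh + 2 * m + 1" then show thesis using assms by (intro that(3)) (auto, presburger)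
  next
    fix m assume "i = ke + kh + 2 * m + 2" then show thesis using assms by (intro that(4)[of "i - 1"]) auto
  qed
qed

lemma linear_hamVF:
  assumes "i \<in> {1..ke + kh + 2 * kf}" shows "linear (hamVF e ke kh kf i)"
  using assms
  by (cases rule: hamVF_cases; intro linearI)
     (simp_all add: hamVF_elliptic hamVF_hyperbolic hamVF_focus1 hamVF_focus2 inner_add_left algebra_simps)

lemma local_toI:
  assumes "\<And>p. L p = (\<Sum>k\<in>K. a k p *\<^sub>R ex e k + b k p *\<^sub>R ey e k)"
    "\<And>p q. (\<And>k. k \<in> K \<Longrightarrow> p \<bullet> ex e k = q \<bullet> ex e k) \<Longrightarrow> (\<And>k. k \<in> K \<Longrightarrow> p \<bullet> ey e k = q \<bullet> ey e k) \<Longrightarrow> L p = L q"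
  shows "local_to e K L"
  unfolding local_to_def using assms by blast

lemma local_hamVF:
  assumes "i \<in> {1..ke + kh + 2 * kf}" shows "local_to e (block (ke + kh) i) (hamVF e ke kh kf i)"
  using assms
proof (cases rule: hamVF_cases)
  case elliptic
  then have K: "block (ke + kh) i = {i}" by (simp add: block_def)
  show ?thesis unfolding K
    by (rule local_toI[where a = "\<lambda>k p. - 2 * (p \<bullet> ey e i)" and b = "\<lambda>k p. 2 * (p \<bullet> ex e i)"])
      (simp_all add: hamVF_elliptic[OF elliptic] algebra_simps)
next
  case hyperbolic
  then have K: "block (ke + kh) i = {i}" by (simp add: block_def)
  show ?thesis unfolding K
    by (rule local_toI[where a = "\<lambda>k p. - (p \<bullet> ex e i)" and b = "\<lambda>k p. (p \<bullet> ey e i)"])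
      (simp_all add: hamVF_hyperbolic[OF hyperbolic])
next
  case focus1
  then have K: "block (ke + kh) i = {i, Suc i}" by (simp add: block_def)
  show ?thesis unfolding K
    by (rule local_toI[where a = "\<lambda>k p. - (p \<bullet> ex e k)" and b = "\<lambda>k p. (p \<bullet> ey e k)"])
      (use focus1 in \<open>simp_all add: hamVF_focus1 algebra_simps\<close>)
next
  case (focus2 a)
  then have K: "block (ke + kh) i = {a, Suc a}" by (simp add: block_def Suc_diff_le)
  show ?thesis unfolding K unfolding focus2(1)
    by (rule local_toI[where a = "\<lambda>k p. if k = a then p \<bullet> ex e (Suc a) else - (p \<bullet> ex e a)" and b = "\<lambda>k p. if k = a then p \<bullet> ey e (Suc a) else - (p \<bullet> ey e a)"])
      (use focus2 in \<open>simp_all add: hamVF_focus2 algebra_simps\<close>)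
qed

lemma hamVF_focus_commute:
  assumes e: "inj_on e I" "a \<in> I" "Suc a \<in> I"
    and a: "ke + kh < a" "Suc a \<le> ke + kh + 2 * kf" "odd (a - (ke + kh))"
  shows "hamVF e ke kh kf a (hamVF e ke kh kf (Suc a) p) = hamVF e ke kh kf (Suc a) (hamVF e ke kh kf a p)"
  using a by (simp add: hamVF_focus1 hamVF_focus2 inner_add_left inner_diff_left ex_ey_inner[OF e(1)] e algebra_simps)

lemma hamVF_commute:
  assumes e: "inj_on e I" "{1..ke + kh + 2 * kf} \<subseteq> I"
    and i: "i \<in> {1..ke + kh + 2 * kf}" and j: "j \<in> {1..ke + kh + 2 * kf}"
  shows "hamVF e ke kh kf i (hamVF e ke kh kf j p) = hamVF e ke kh kf j (hamVF e ke kh kf i p)"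
proof -
  consider "i = j" | "ke + kh < i" "odd (i - (ke + kh))" "j = Suc i" | "ke + kh < j" "odd (j - (ke + kh))" "i = Suc j"
    | "block (ke + kh) i \<inter> block (ke + kh) j = {}" using block_disjoint[of i j "ke + kh"] by blast
  then show ?thesis
  proof cases
    case 2
    have "i \<in> I" "Suc i \<in> I" "Suc i \<le> ke + kh + 2 * kf"
      using subsetD[OF e(2) i] subsetD[OF e(2) j] j 2(3) by auto
    from hamVF_focus_commute[OF e(1) this(1,2) 2(1) this(3) 2(2)] show ?thesis unfolding 2(3) .
  next
    case 3
    have "j \<in> I" "Suc j \<in> I" "Suc j \<le> ke + kh + 2 * kf"
      using subsetD[OF e(2) i] subsetD[OF e(2) j] i 3(3) by auto
    from hamVF_focus_commute[OF e(1) this(1,2) 3(1) this(3) 3(2)] show ?thesis unfolding 3(3) by (rule sym)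
  next
    case 4
    show ?thesis
      by (rule local_commute[OF local_hamVF[OF i] local_hamVF[OF j] e(1) _ _ 4 linear_hamVF[OF i] linear_hamVF[OF j]])
        (use block_subset[OF i] block_subset[OF j] e(2) in auto)
  qed simp
qed

text \<open>The second field of a pair generates the same rotation in the plane of the two
  \<open>x\<close> coordinates as in that of the two \<open>y\<close> coordinates; it thus commutes
  with both dilations and preserves both norms. This is the one case in which two fields share
  coordinates.\<close>

lemma compat_focus:
  assumes e: "inj_on e I" "a \<in> I" "Suc a \<in> I"
    and a: "ke + kh < a" "Suc a \<le> ke + kh + 2 * kf" "odd (a - (ke + kh))"
  shows "compat (ex e ` {a, Suc a}) (ey e ` {a, Suc a}) (hamVF e ke kh kf (Suc a))"
proof -
  let ?L = "hamVF e ke kh kf (Suc a)"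
  have l: "linear ?L" using a by (intro linear_hamVF) auto
  have pjb: "cproj B b = (if b \<in> B then b else 0)" if "b \<in> Basis" for B and b :: "'a pt"
    using that by (subst euclidean_eq_iff) (auto simp: cproj_inner inner_Basis)
  note L = hamVF_focus2[OF a, of e]
  note simps = linear_add[OF linear_cscale] linear_diff[OF linear_cscale] linear_scale[OF linear_cscale]
    linear_add[OF linear_cproj] linear_diff[OF linear_cproj] linear_scale[OF linear_cproj] cscale_inner cscale_Basis pjb cproj_inner ex_Basis ey_Basis
  have nx: "ey e k \<notin> ex e ` K" "ex e k \<notin> ey e ` K" for k K
    using ex_ey_neq[of e _ k] ex_ey_neq[of e k] by (metis imageE)+
  have cscale: "?L (cscale B t q) = cscale B t (?L q) \<and> cproj B q \<bullet> cproj B (?L q) = 0"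
    if "B = ex e ` {a, Suc a} \<or> B = ey e ` {a, Suc a}" for B t q
    using that nx[of _ "{a, Suc a}"]
    by (elim disjE) (simp_all add: L simps inner_add_right inner_diff_right algebra_simps)
  show ?thesis unfolding compat_def using l cscale by blast
qed

text \<open>Elliptic fields and second focus-focus fields are rotations, for which commuting
  suffices; hyperbolic and first focus-focus fields are instances of \<open>hyp\<close>, for which
  the other fields must be \<open>compat\<close>.\<close>

lemma splitting_hamVF:
  fixes e :: "nat \<Rightarrow> 'n::finite"
  assumes e: "inj_on e I" "{1..ke + kh + 2 * kf} \<subseteq> I" and i: "i \<in> {1..ke + kh + 2 * kf}"
  shows "\<exists>\<L>. splitting (hamVF e ke kh kf i) \<L> \<and> (\<forall>j\<in>{1..ke + kh + 2 * kf}. j \<noteq> i \<longrightarrow> hamVF e ke kh kf j \<in> \<L>)"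
  using i
proof (cases rule: hamVF_cases)
  case elliptic
  \<comment> \<open>The factor 2 of the elliptic field is taken out so that \<open>J\<close> cubed
    is \<open>- J\<close>.\<close>
  define J :: "'n pt \<Rightarrow> 'n pt" where "J p = - (p \<bullet> ey e i) *\<^sub>R ex e i + (p \<bullet> ex e i) *\<^sub>R ey e i" for p
  have X: "hamVF e ke kh kf i = (\<lambda>p. 2 *\<^sub>R J p)" unfolding J_def by (rule ext) (rule hamVF_elliptic[OF elliptic])
  have iI: "i \<in> I" using e i by auto
  have "linear J" by (rule linearI) (simp_all add: J_def inner_add_left algebra_simps)
  moreover have "J (J (J p)) = - J p" for p
    by (simp add: J_def inner_add_left inner_diff_left ex_ey_inner[OF e(1)] iI algebra_simps)
  moreover have "p \<bullet> J p = 0" for p by (simp add: J_def inner_add_right inner_diff_right)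
  ultimately have "splitting (hamVF e ke kh kf i) {L. linear L \<and> (\<forall>p. L (J p) = J (L p))}"
    unfolding X by (intro splitting_rotation) auto
  moreover have "hamVF e ke kh kf j \<in> {L. linear L \<and> (\<forall>p. L (J p) = J (L p))}" if j: "j \<in> {1..ke + kh + 2 * kf}" for j
  proof -
    have l: "linear (hamVF e ke kh kf j)" by (rule linear_hamVF[OF j])
    have "hamVF e ke kh kf j (2 *\<^sub>R J p) = 2 *\<^sub>R J (hamVF e ke kh kf j p)" for p
      using hamVF_commute[OF e i j, of p] unfolding X by simp
    then show ?thesis using l by (simp add: linear_scale[OF l])
  qed
  ultimately show ?thesis by blast
next
  case hyperbolic
  have X: "hamVF e ke kh kf i = hyp (ex e ` {i}) (ey e ` {i})"
    by (rule ext) (simp add: hamVF_hyperbolic[OF hyperbolic] hyp_def cproj_eq_sum ex_Basis ey_Basis)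
  have dis: "ex e ` {i} \<inter> ey e ` {i} = {}" using ex_ey_neq[of e] by (auto dest: sym)
  have "hamVF e ke kh kf j \<in> {L. compat (ex e ` {i}) (ey e ` {i}) L}" if j: "j \<in> {1..ke + kh + 2 * kf}" "j \<noteq> i" for j
  proof -
    have "block (ke + kh) i \<inter> block (ke + kh) j = {}" using hyperbolic j by (intro block_disjoint) auto
    then have d: "{i} \<inter> block (ke + kh) j = {}" using hyperbolic by (simp add: block_def)
    have "compat (ex e ` {i}) (ey e ` {i}) (hamVF e ke kh kf j)"
      by (rule local_compat[OF local_hamVF[OF j(1)] e(1) _ _ d linear_hamVF[OF j(1)]])
        (use block_subset[OF j(1)] e(2) i in auto)
    then show ?thesis by simp
  qed
  then show ?thesis using splitting_hyp[OF dis] unfolding X by blast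
next
  case focus1
  let ?K = "{i, Suc i}"
  have I: "i \<in> I" "Suc i \<in> I" using focus1 subsetD[OF e(2), of "Suc i"] subsetD[OF e(2) i] by auto
  have ne: "ex e i \<noteq> ex e (Suc i)" "ey e i \<noteq> ey e (Suc i)"
    using ex_ey_inner[OF e(1) I] ex_ey_inner[OF e(1) I(1,1)] by auto
  have X: "hamVF e ke kh kf i = hyp (ex e ` ?K) (ey e ` ?K)"
    using focus1 ne by (intro ext) (simp add: hamVF_focus1 hyp_def cproj_eq_sum ex_Basis ey_Basis algebra_simps)
  have dis: "ex e ` ?K \<inter> ey e ` ?K = {}" using ex_ey_neq[of e] by (auto dest: sym)
  have "hamVF e ke kh kf j \<in> {L. compat (ex e ` ?K) (ey e ` ?K) L}" if j: "j \<in> {1..ke + kh + 2 * kf}" "j \<noteq> i" for j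
  proof (cases "j = Suc i")
    case True
    then show ?thesis using compat_focus[OF e(1) I focus1] by simp
  next
    case False
    have "\<not> (ke + kh < j \<and> odd (j - (ke + kh)) \<and> i = Suc j)" using focus1 by (auto simp: Suc_diff_le)
    then have "block (ke + kh) i \<inter> block (ke + kh) j = {}" using False j by (intro block_disjoint) auto
    then have d: "?K \<inter> block (ke + kh) j = {}" using focus1 by (simp add: block_def)
    have "compat (ex e ` ?K) (ey e ` ?K) (hamVF e ke kh kf j)"
      by (rule local_compat[OF local_hamVF[OF j(1)] e(1) _ _ d linear_hamVF[OF j(1)]])
        (use block_subset[OF j(1)] e(2) I in auto)
    then show ?thesis by simp
  qed
  then show ?thesis using splitting_hyp[OF dis] unfolding X by blast
next
  case (focus2 a)
  have I: "a \<in> I" "Suc a \<in> I" using focus2 subsetD[OF e(2), of a] subsetD[OF e(2) i] by auto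
  note L = hamVF_focus2[OF focus2(2-4), of e]
  let ?J = "hamVF e ke kh kf (Suc a)"
  have "linear ?J" using linear_hamVF[OF i] focus2(1) by simp
  moreover have "?J (?J (?J p)) = - ?J p" for p
    by (simp add: L inner_add_left inner_diff_left ex_ey_inner[OF e(1)] I algebra_simps)
  moreover have "p \<bullet> ?J p = 0" for p by (simp add: L inner_add_right inner_diff_right)
  ultimately have "splitting (\<lambda>p. 1 *\<^sub>R ?J p) {L. linear L \<and> (\<forall>p. L (?J p) = ?J (L p))}"
    by (intro splitting_rotation) auto
  then have "splitting (hamVF e ke kh kf i) {L. linear L \<and> (\<forall>p. L (?J p) = ?J (L p))}" by (simp add: focus2(1))
  moreover have "hamVF e ke kh kf j \<in> {L. linear L \<and> (\<forall>p. L (?J p) = ?J (L p))}" if j: "j \<in> {1..ke + kh + 2 * kf}" for j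
    using linear_hamVF[OF j] hamVF_commute[OF e j i] focus2(1) by simp
  ultimately show ?thesis by blast
qed

theorem theorem2p2:
  fixes e :: "nat \<Rightarrow> 'n::finite"
    and ke kh kf r :: nat
    and U :: "'n pt set"
    and g :: "nat \<Rightarrow> 'n pt \<Rightarrow> real"
  assumes enum: "bij_betw e {1..CARD('n)} UNIV"
    and r_def: "r = ke + kh + 2 * kf"
    and r_le: "r \<le> CARD('n)"
    and U: "open U" "0 \<in> U"
    and g_smooth: "\<forall>i\<in>{1..r}. smooth_on U (g i)"
    and closed: "\<forall>i\<in>{1..r}. \<forall>j\<in>{1..r}. \<forall>p\<in>U.
        vf_apply (hamVF e ke kh kf i) (g j) p = vf_apply (hamVF e ke kh kf j) (g i) p"
  shows "\<exists>V G f. open V \<and> 0 \<in> V \<and> V \<subseteq> U \<and> smooth_on V G \<and>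
           (\<forall>i\<in>{1..r}. smooth_on V (f i)) \<and>
           (\<forall>i\<in>{1..r}. \<forall>j\<in>{1..r}. \<forall>p\<in>V. vf_apply (hamVF e ke kh kf j) (f i) p = 0) \<and>
           (\<forall>i\<in>{1..r}. \<forall>p\<in>V. g i p = f i p + vf_apply (hamVF e ke kh kf i) G p)"
proof -
  let ?X = "hamVF e ke kh kf"
  let ?I = "{1..CARD('n)}"
  have e: "inj_on e ?I" "{1..ke + kh + 2 * kf} \<subseteq> ?I"
    using enum r_le r_def by (auto simp: bij_betw_def)
  obtain R where R: "R > 0" "ball 0 R \<subseteq> U" using U open_contains_ball by blast
  have "\<exists>h. smooth h \<and> (\<forall>p\<in>ball 0 (R / 3). h p = g i p)" if "i \<in> {1..r}" for i
  proof -
    have "smooth_on (ball 0 R) (g i)" using smooth_on_mono[OF _ U(1) open_ball R(2)] g_smooth that by blast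
    from smooth_on_globalize[OF this R(1)] show ?thesis by metis
  qed
  then obtain h where h: "\<And>i. i \<in> {1..r} \<Longrightarrow> smooth (h i)" "\<And>i p. i \<in> {1..r} \<Longrightarrow> p \<in> ball 0 (R / 3) \<Longrightarrow> h i p = g i p"
    by metis
  have R3: "R / 3 > 0" "ball 0 (R / 3) \<subseteq> U" using R by auto
  \<comment> \<open>Derivatives depend only on values nearby, so the globalised functions inherit
    closedness on the ball where they agree with \<open>g\<close>.\<close>
  have hX: "vf_apply L (h i) p = vf_apply L (g i) p" if "i \<in> {1..r}" "p \<in> ball 0 (R / 3)" for i L p
    by (rule vf_apply_cong[OF open_ball that(2)]) (rule h(2)[OF that(1)])
  have lin: "linear (?X i)" if "i \<in> {1..r}" for i using that by (intro linear_hamVF) (simp add: r_def)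
  have "\<exists>\<delta> G. 0 < \<delta> \<and> \<delta> \<le> R / 3 \<and> smooth G \<and>
    (\<forall>i\<in>{1..r}. \<forall>j\<in>{1..r}. \<forall>p\<in>ball 0 \<delta>. vf_apply (?X j) (\<lambda>p. h i p - vf_apply (?X i) G p) p = 0)"
  proof (rule closed_family_splits[OF lin _ _ R3(1) h(1)])
    show "?X i (?X j p) = ?X j (?X i p)" if "i \<in> {1..r}" "j \<in> {1..r}" for i j p
      using that by (intro hamVF_commute[OF e]) (auto simp: r_def)
    show "\<exists>\<L>. splitting (?X i) \<L> \<and> (\<forall>j\<in>{1..r}. j \<noteq> i \<longrightarrow> ?X j \<in> \<L>)" if "i \<in> {1..r}" for i
      using splitting_hamVF[OF e, of i] that by (simp add: r_def)
    show "vf_apply (?X i) (h j) p = vf_apply (?X j) (h i) p"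
      if "i \<in> {1..r}" "j \<in> {1..r}" "p \<in> ball 0 (R / 3)" for i j p
      unfolding hX[OF that(2,3)] hX[OF that(1,3)] using that closed R3(2) by blast
  qed
  then obtain \<delta> G where \<delta>: "0 < \<delta>" "\<delta> \<le> R / 3" and G: "smooth G"
    and inv: "\<And>i j p. i \<in> {1..r} \<Longrightarrow> j \<in> {1..r} \<Longrightarrow> p \<in> ball 0 \<delta> \<Longrightarrow> vf_apply (?X j) (\<lambda>p. h i p - vf_apply (?X i) G p) p = 0"
    by blast
  define f where "f i p = h i p - vf_apply (?X i) G p" for i p
  have fs: "smooth (f i)" if "i \<in> {1..r}" for i
    unfolding f_def by (intro smooth_intros h(1) smooth_vf_apply[OF lin G] that)
  have sub: "ball 0 \<delta> \<subseteq> ball 0 (R / 3)" using \<delta>(2) by (rule subset_ball)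
  show ?thesis
  proof (rule exI[of _ "ball 0 \<delta>"], rule exI[of _ G], rule exI[of _ f], intro conjI ballI)
    show "open (ball (0::'n pt) \<delta>)" "0 \<in> ball (0::'n pt) \<delta>" "ball 0 \<delta> \<subseteq> U" using \<delta> sub R3(2) by auto
    show "smooth_on (ball 0 \<delta>) G" by (rule smooth_on_mono[OF G open_UNIV open_ball]) simp
    show "smooth_on (ball 0 \<delta>) (f i)" if "i \<in> {1..r}" for i
      by (rule smooth_on_mono[OF fs[OF that] open_UNIV open_ball]) simp
    show "vf_apply (?X j) (f i) p = 0" if "i \<in> {1..r}" "j \<in> {1..r}" "p \<in> ball 0 \<delta>" for i j p
      using inv[OF that] by (simp add: f_def[abs_def])
    show "g i p = f i p + vf_apply (?X i) G p" if "i \<in> {1..r}" "p \<in> ball 0 \<delta>" for i p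
    proof -
      have "p \<in> ball 0 (R / 3)" using that(2) sub by blast
      then show ?thesis using h(2)[OF that(1)] by (simp add: f_def)
    qed
  qed
qed

end
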